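(* Realize $L(F_\infty)$ as the infinite corner $$\chi_{[0,1]}\big(L^\infty([0,\infty))\star\mathbb C(X)\big)\chi_{[0,1]},$$ where $X$ is an infinite semicircular element, and let $\alpha_t$ ($t>0$) act on $L^\infty([0,\infty))\star\mathbb C(X)$ by dilation on $L^\infty([0,\infty))$ and by multiplying $X$ by $t^{-1/2}$. Let $\mathcal D\subseteq\chi_{[0,1]}(L^\infty([0,\infty))\star\mathbb C(X))\chi_{[0,1]}$ be the domain generated by the span of the elements $$f_0Xf_1X\cdots Xf_{n-1}Xf_n,$$ where $f_0,f_n\in C_0^1([0,1))$ and $f_1,\dots,f_{n-1}$ are differentiable with compact support. Then $$\delta(x)=\frac{d}{dt}\,\chi_{[0,1]}\alpha_t(x)\chi_{[0,1]}\Big|_{t=1}$$ is a derivation on $\mathcal D$, it is closable, and $\delta^*1=\alpha 1$ for some $\alpha>0$. Moreover $\delta$ leaves invariant a dense domain in $L^\infty([0,1])$.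
   Context: $F_\infty$ is the free group on infinitely many generators and $L(F_\infty)$ its group von Neumann algebra. $L^\infty([0,\infty))\star\mathbb C(X)$ is the semifinite von Neumann algebra, with semifinite trace extending integration against Lebesgue measure on $L^\infty([0,\infty))$, generated by $L^\infty([0,\infty))$ and an "infinite semicircular" element $X=X^*$: $X$ is an operator-valued semicircular object over $L^\infty([0,\infty))$ with covariance $f\mapsto\left(\int_0^\infty f(x)\,dx\right)1$ for compactly supported $f$; equivalently, for every bounded interval $I$, $\chi_IX\chi_I$ is a semicircular element free from $L^\infty(I)$ in the corner cut by $\chi_I$. The corner by $\chi_{[0,1]}$ is isomorphic to $L(F_\infty)$. The dilation is $(\alpha_tf)(x)=f(x/t)$, so that $\alpha_t$ scales the trace. $C^1_0([0,1))$ denotes continuously differentiable functions supported in $[0,1)$ (vanishing at $1$). A function $f\in L^\infty$ is viewed as an element of the algebra. The adjoint $\delta^*$ is taken in the $L^2$-space of the finite von Neumann algebra $\chi_{[0,1]}(L^\infty([0,\infty))\star\mathbb C(X))\chi_{[0,1]}$ with respect to its trace, and $1$ is its unit.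
   Formalization: The middle coefficients f_1,…,f_{n-1} are taken differentiable with compact support and bounded derivative (all C^1 ones included); for merely differentiable ones, e.g. a cut-off (x-1)^2 sin(1/(x-1)^2), the derivative defining δ does not exist in L^2. *)

theory Defs
  imports "HOL-Analysis.Analysis"
begin

section \<open>Complex Hilbert spaces and operators\<close>

class complex_vector = real_vector +
  fixes scaleC :: "complex \<Rightarrow> 'a \<Rightarrow> 'a"  (infixr \<open>*\<^sub>C\<close> 75)
  assumes scaleC_add_right: "c *\<^sub>C (x + y) = c *\<^sub>C x + c *\<^sub>C y"
    and scaleC_add_left: "(c + d) *\<^sub>C x = c *\<^sub>C x + d *\<^sub>C x"
    and scaleC_scaleC: "c *\<^sub>C d *\<^sub>C x = (c * d) *\<^sub>C x"
    and scaleR_scaleC: "r *\<^sub>R x = complex_of_real r *\<^sub>C x"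

text \<open>The complex inner product is linear in the first variable; the norm is the one of
  \<^class>\<open>real_inner\<close>, whose inner product is the real part of \<open>cinner\<close>.\<close>

class complex_hilbert_space = complex_vector + real_inner + complete_space +
  fixes cinner :: "'a \<Rightarrow> 'a \<Rightarrow> complex"
  assumes cinner_commute: "cinner x y = cnj (cinner y x)"
    and cinner_add_left: "cinner (x + y) z = cinner x z + cinner y z"
    and cinner_scaleC_left: "cinner (c *\<^sub>C x) y = c * cinner x y"
    and inner_cinner: "inner x y = Re (cinner x y)"

lemma norm_scaleC: "norm (c *\<^sub>C x) = cmod c * norm (x :: 'a::complex_hilbert_space)"
proof -
  have "cinner (c *\<^sub>C x) (c *\<^sub>C x) = c * cnj c * cinner x x"
    by (metis cinner_commute cinner_scaleC_left complex_cnj_cnj complex_cnj_mult mult.assoc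
        mult.commute)
  then have "cinner (c *\<^sub>C x) (c *\<^sub>C x) = complex_of_real ((cmod c)\<^sup>2) * cinner x x"
    by (simp only: complex_norm_square)
  then have "(norm (c *\<^sub>C x))\<^sup>2 = (cmod c * norm x)\<^sup>2"
    by (simp add: power2_norm_eq_inner inner_cinner power_mult_distrib)
  then show ?thesis
    by (simp add: power2_eq_iff_nonneg)
qed

lemma bounded_linear_scaleC: "bounded_linear (\<lambda>x :: 'a::complex_hilbert_space. c *\<^sub>C x)"
proof (rule bounded_linear_intro)
  show "c *\<^sub>C (r *\<^sub>R x) = r *\<^sub>R c *\<^sub>C x" for r and x :: 'a
    by (simp add: scaleR_scaleC scaleC_scaleC mult.commute)
  show "norm (c *\<^sub>C x) \<le> norm x * cmod c" for x :: 'a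
    by (simp add: norm_scaleC mult.commute)
qed (rule scaleC_add_right)

instantiation blinfun :: (real_normed_vector, complex_hilbert_space) complex_vector
begin

lift_definition scaleC_blinfun :: "complex \<Rightarrow> ('a \<Rightarrow>\<^sub>L 'b) \<Rightarrow> ('a \<Rightarrow>\<^sub>L 'b)"
  is "\<lambda>c T x. c *\<^sub>C T x"
  by (rule bounded_linear_compose[OF bounded_linear_scaleC])

instance
  by standard (transfer, simp add: scaleC_add_right scaleC_add_left scaleC_scaleC scaleR_scaleC)+

end

text \<open>Operators are elements of \<open>'h \<Rightarrow>\<^sub>L 'h\<close>, which only requires real linearity;
  \<open>B(H)\<close> is the subset \<open>bounded_ops\<close>.\<close>

definition bounded_ops :: "('h::complex_hilbert_space \<Rightarrow>\<^sub>L 'h) set" where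
  "bounded_ops = {a. \<forall>c x. blinfun_apply a (c *\<^sub>C x) = c *\<^sub>C blinfun_apply a x}"

definition adj :: "('h::complex_hilbert_space \<Rightarrow>\<^sub>L 'h) \<Rightarrow> ('h \<Rightarrow>\<^sub>L 'h)" where
  "adj a = (THE b. \<forall>x y. cinner (blinfun_apply a x) y = cinner x (blinfun_apply b y))"

definition positive_op :: "('h::complex_hilbert_space \<Rightarrow>\<^sub>L 'h) \<Rightarrow> bool" where
  "positive_op a \<longleftrightarrow>
     a \<in> bounded_ops \<and> (\<forall>x. Im (cinner (blinfun_apply a x) x) = 0 \<and>
       0 \<le> Re (cinner (blinfun_apply a x) x))"

definition op_le :: "('h::complex_hilbert_space \<Rightarrow>\<^sub>L 'h) \<Rightarrow> ('h \<Rightarrow>\<^sub>L 'h) \<Rightarrow> bool" where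
  "op_le a b \<longleftrightarrow> positive_op (b - a)"

definition commutant :: "('h::complex_hilbert_space \<Rightarrow>\<^sub>L 'h) set \<Rightarrow> ('h \<Rightarrow>\<^sub>L 'h) set" where
  "commutant S = {a \<in> bounded_ops. \<forall>b\<in>S. a o\<^sub>L b = b o\<^sub>L a}"

text \<open>For a self-adjoint set \<open>S\<close> this is the von Neumann algebra generated by \<open>S\<close>.\<close>

definition generated_vN :: "('h::complex_hilbert_space \<Rightarrow>\<^sub>L 'h) set \<Rightarrow> ('h \<Rightarrow>\<^sub>L 'h) set" where
  "generated_vN S = commutant (commutant S)"

definition star_automorphism ::
  "('h::complex_hilbert_space \<Rightarrow>\<^sub>L 'h) set \<Rightarrow> (('h \<Rightarrow>\<^sub>L 'h) \<Rightarrow> ('h \<Rightarrow>\<^sub>L 'h)) \<Rightarrow> bool" where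
  "star_automorphism M \<theta> \<longleftrightarrow> bij_betw \<theta> M M \<and>
     (\<forall>a\<in>M. \<forall>b\<in>M. \<theta> (a + b) = \<theta> a + \<theta> b \<and> \<theta> (a o\<^sub>L b) = \<theta> a o\<^sub>L \<theta> b) \<and>
     (\<forall>a\<in>M. \<theta> (adj a) = adj (\<theta> a) \<and> (\<forall>c. \<theta> (c *\<^sub>C a) = c *\<^sub>C \<theta> a))"


section \<open>Traces\<close>

definition pos_part :: "('h::complex_hilbert_space \<Rightarrow>\<^sub>L 'h) set \<Rightarrow> ('h \<Rightarrow>\<^sub>L 'h) set" where
  "pos_part M = {a \<in> M. positive_op a}"

definition is_lub_in ::
  "('h::complex_hilbert_space \<Rightarrow>\<^sub>L 'h) set \<Rightarrow> ('h \<Rightarrow>\<^sub>L 'h) set \<Rightarrow> ('h \<Rightarrow>\<^sub>L 'h) \<Rightarrow> bool" where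
  "is_lub_in P S a \<longleftrightarrow> a \<in> P \<and> (\<forall>b\<in>S. op_le b a) \<and> (\<forall>c\<in>P. (\<forall>b\<in>S. op_le b c) \<longrightarrow> op_le a c)"

text \<open>A faithful normal semifinite trace on \<open>M\<close>; only its values on positive elements matter.\<close>

locale nsf_trace =
  fixes M :: "('h::complex_hilbert_space \<Rightarrow>\<^sub>L 'h) set" and Tr :: "('h \<Rightarrow>\<^sub>L 'h) \<Rightarrow> ennreal"
  assumes additive: "\<lbrakk>a \<in> pos_part M; b \<in> pos_part M\<rbrakk> \<Longrightarrow> Tr (a + b) = Tr a + Tr b"
    and homogeneous: "\<lbrakk>a \<in> pos_part M; 0 \<le> r\<rbrakk> \<Longrightarrow> Tr (r *\<^sub>R a) = ennreal r * Tr a"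
    and tracial: "a \<in> M \<Longrightarrow> Tr (adj a o\<^sub>L a) = Tr (a o\<^sub>L adj a)"
    and faithful: "\<lbrakk>a \<in> pos_part M; Tr a = 0\<rbrakk> \<Longrightarrow> a = 0"
    and normal: "\<lbrakk>S \<subseteq> pos_part M; S \<noteq> {}; \<forall>b\<in>S. \<forall>c\<in>S. \<exists>d\<in>S. op_le b d \<and> op_le c d;
        is_lub_in (pos_part M) S a\<rbrakk> \<Longrightarrow> Tr a = (SUP b\<in>S. Tr b)"
    and semifinite: "\<lbrakk>a \<in> pos_part M; a \<noteq> 0\<rbrakk> \<Longrightarrow>
        \<exists>b\<in>pos_part M. b \<noteq> 0 \<and> op_le b a \<and> Tr b < \<infinity>"

text \<open>The linear extension of a trace to its ideal of definition, the linear span of the positive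
  elements of finite trace.\<close>

definition finite_pos ::
  "('h::complex_hilbert_space \<Rightarrow>\<^sub>L 'h) set \<Rightarrow> (('h \<Rightarrow>\<^sub>L 'h) \<Rightarrow> ennreal) \<Rightarrow> ('h \<Rightarrow>\<^sub>L 'h) set" where
  "finite_pos M Tr = {a \<in> pos_part M. Tr a < \<infinity>}"

definition linear_trace ::
  "('h::complex_hilbert_space \<Rightarrow>\<^sub>L 'h) set \<Rightarrow> (('h \<Rightarrow>\<^sub>L 'h) \<Rightarrow> ennreal) \<Rightarrow> ('h \<Rightarrow>\<^sub>L 'h) \<Rightarrow> complex"
where
  "linear_trace M Tr a = (THE z. \<exists>p\<in>finite_pos M Tr. \<exists>q\<in>finite_pos M Tr.
     \<exists>r\<in>finite_pos M Tr. \<exists>s\<in>finite_pos M Tr.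
       a = (p - q) + \<i> *\<^sub>C (r - s) \<and>
       z = Complex (enn2real (Tr p) - enn2real (Tr q)) (enn2real (Tr r) - enn2real (Tr s)))"

text \<open>\<open>H = L\<^sup>2(M, Tr)\<close>: the map \<open>\<Lambda>\<close> is the inclusion of the square integrable elements, and \<open>M\<close>
  acts by left multiplication.\<close>

definition square_integrable ::
  "('h::complex_hilbert_space \<Rightarrow>\<^sub>L 'h) set \<Rightarrow> (('h \<Rightarrow>\<^sub>L 'h) \<Rightarrow> ennreal) \<Rightarrow> ('h \<Rightarrow>\<^sub>L 'h) set" where
  "square_integrable M Tr = {a \<in> M. Tr (adj a o\<^sub>L a) < \<infinity>}"

locale standard_representation =
  fixes M :: "('h::complex_hilbert_space \<Rightarrow>\<^sub>L 'h) set" and Tr :: "('h \<Rightarrow>\<^sub>L 'h) \<Rightarrow> ennreal"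
    and \<Lambda> :: "('h \<Rightarrow>\<^sub>L 'h) \<Rightarrow> 'h"
  assumes L2_add: "\<lbrakk>a \<in> square_integrable M Tr; b \<in> square_integrable M Tr\<rbrakk> \<Longrightarrow>
        \<Lambda> (a + b) = \<Lambda> a + \<Lambda> b"
    and L2_scaleC: "a \<in> square_integrable M Tr \<Longrightarrow> \<Lambda> (c *\<^sub>C a) = c *\<^sub>C \<Lambda> a"
    and L2_cinner: "\<lbrakk>a \<in> square_integrable M Tr; b \<in> square_integrable M Tr\<rbrakk> \<Longrightarrow>
        cinner (\<Lambda> a) (\<Lambda> b) = linear_trace M Tr (adj b o\<^sub>L a)"
    and L2_left: "\<lbrakk>a \<in> M; b \<in> square_integrable M Tr\<rbrakk> \<Longrightarrow>
        blinfun_apply a (\<Lambda> b) = \<Lambda> (a o\<^sub>L b)"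
    and L2_dense: "closure (\<Lambda> ` square_integrable M Tr) = UNIV"


section \<open>The algebra generated by \<open>L\<^sup>\<infinity>([0,\<infinity>))\<close> and an infinite semicircular element\<close>

abbreviation half_line :: "real measure" where
  "half_line \<equiv> lebesgue_on {0..}"

text \<open>Elements of \<open>L\<^sup>\<infinity>([0,\<infinity>))\<close> are represented by functions on \<^typ>\<open>real\<close> whose values on the
  negative axis are irrelevant; a.e. equal functions are identified by the embedding \<open>\<iota>\<close> below.\<close>

definition Linf :: "(real \<Rightarrow> complex) set" where
  "Linf = {f \<in> borel_measurable half_line. \<exists>C. AE x in half_line. cmod (f x) \<le> C}"

definition supported_upto :: "real \<Rightarrow> (real \<Rightarrow> complex) \<Rightarrow> bool" where
  "supported_upto r f \<longleftrightarrow> (\<forall>x>r. f x = 0)"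

definition chi :: "((real \<Rightarrow> complex) \<Rightarrow> 'h::complex_hilbert_space \<Rightarrow>\<^sub>L 'h) \<Rightarrow> real \<Rightarrow> 'h \<Rightarrow>\<^sub>L 'h" where
  "chi \<iota> r = \<iota> (indicator {0..r})"

text \<open>The infinite semicircular element \<open>X\<close> is not an operator; it is given by its bounded
  compressions \<open>X r = \<chi>\<^bsub>[0,r]\<^esub> X \<chi>\<^bsub>[0,r]\<^esub>\<close>. If \<open>f\<^sub>0, \<dots>, f\<^sub>n\<close> are supported in \<open>[0,r]\<close>, then
  \<open>sc_word \<iota> (X r) [f\<^sub>0, \<dots>, f\<^sub>n]\<close> is the element \<open>f\<^sub>0 X f\<^sub>1 X \<cdots> X f\<^sub>n\<close>, independently of \<open>r\<close>.\<close>

fun sc_word :: "((real \<Rightarrow> complex) \<Rightarrow> 'h::complex_hilbert_space \<Rightarrow>\<^sub>L 'h) \<Rightarrow> ('h \<Rightarrow>\<^sub>L 'h) \<Rightarrow>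
    (real \<Rightarrow> complex) list \<Rightarrow> 'h \<Rightarrow>\<^sub>L 'h" where
  "sc_word \<iota> Y [] = id_blinfun"
| "sc_word \<iota> Y [f] = \<iota> f"
| "sc_word \<iota> Y (f # g # gs) = \<iota> f o\<^sub>L (Y o\<^sub>L sc_word \<iota> Y (g # gs))"

text \<open>The moments \<open>E(f\<^sub>0 X f\<^sub>1 X \<cdots> X f\<^sub>n)\<close> of an operator-valued semicircular object with covariance
  \<open>\<eta>(f) = (\<integral> f) 1\<close>: the only nonzero operator-valued cumulant is the second one, so the first \<open>X\<close>
  is paired with the one between \<open>f\<^sub>k\<close> and \<open>f\<^bsub>k+1\<^esub>\<close>, and
  \<open>E(f\<^sub>0 X \<cdots> X f\<^sub>n) = \<Sum>\<^sub>k f\<^sub>0 \<eta>(E(f\<^sub>1 X \<cdots> X f\<^sub>k)) E(f\<^bsub>k+1\<^esub> X \<cdots> X f\<^sub>n)\<close>.\<close>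

function sc_moment :: "(real \<Rightarrow> complex) list \<Rightarrow> real \<Rightarrow> complex" where
  "sc_moment [] = (\<lambda>x. 1)"
| "sc_moment [f] = f"
| "sc_moment (f # g # gs) = (\<lambda>x. \<Sum>k = 1..<length (g # gs).
     f x * (LINT y|half_line. sc_moment (take k (g # gs)) y) * sc_moment (drop k (g # gs)) x)"
  by pat_completeness auto
termination
  by (relation "Wellfounded.measure length") auto

definition sc_algebra :: "((real \<Rightarrow> complex) \<Rightarrow> 'h::complex_hilbert_space \<Rightarrow>\<^sub>L 'h) \<Rightarrow>
    (real \<Rightarrow> 'h \<Rightarrow>\<^sub>L 'h) \<Rightarrow> ('h \<Rightarrow>\<^sub>L 'h) set" where
  "sc_algebra \<iota> X = generated_vN (\<iota> ` Linf \<union> X ` {0<..})"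

text \<open>\<open>E(a) = g\<close> for the trace preserving conditional expectation \<open>E\<close> onto \<open>L\<^sup>\<infinity>([0,\<infinity>))\<close> (for
  elements \<open>a\<close> of the ideal of definition of the trace).\<close>

definition has_cond_expectation :: "('h::complex_hilbert_space \<Rightarrow>\<^sub>L 'h) set \<Rightarrow>
    (('h \<Rightarrow>\<^sub>L 'h) \<Rightarrow> ennreal) \<Rightarrow> ((real \<Rightarrow> complex) \<Rightarrow> 'h \<Rightarrow>\<^sub>L 'h) \<Rightarrow>
    ('h \<Rightarrow>\<^sub>L 'h) \<Rightarrow> (real \<Rightarrow> complex) \<Rightarrow> bool" where
  "has_cond_expectation M Tr \<iota> a g \<longleftrightarrow>
     (\<forall>h\<in>Linf. linear_trace M Tr (\<iota> h o\<^sub>L a) = (LINT x|half_line. h x * g x))"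

locale infinite_semicircular =
  fixes \<iota> :: "(real \<Rightarrow> complex) \<Rightarrow> 'h::complex_hilbert_space \<Rightarrow>\<^sub>L 'h"
    and X :: "real \<Rightarrow> 'h \<Rightarrow>\<^sub>L 'h"
    and Tr :: "('h \<Rightarrow>\<^sub>L 'h) \<Rightarrow> ennreal"
  assumes embed_op: "f \<in> Linf \<Longrightarrow> \<iota> f \<in> bounded_ops"
    and embed_AE: "\<lbrakk>f \<in> Linf; g \<in> Linf; AE x in half_line. f x = g x\<rbrakk> \<Longrightarrow> \<iota> f = \<iota> g"
    and embed_one: "\<iota> (\<lambda>x. 1) = id_blinfun"
    and embed_add: "\<lbrakk>f \<in> Linf; g \<in> Linf\<rbrakk> \<Longrightarrow> \<iota> (\<lambda>x. f x + g x) = \<iota> f + \<iota> g"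
    and embed_scaleC: "f \<in> Linf \<Longrightarrow> \<iota> (\<lambda>x. c * f x) = c *\<^sub>C \<iota> f"
    and embed_mult: "\<lbrakk>f \<in> Linf; g \<in> Linf\<rbrakk> \<Longrightarrow> \<iota> (\<lambda>x. f x * g x) = \<iota> f o\<^sub>L \<iota> g"
    and embed_cnj: "f \<in> Linf \<Longrightarrow> \<iota> (\<lambda>x. cnj (f x)) = adj (\<iota> f)"
    and embed_normal: "\<lbrakk>\<And>n. (\<lambda>x. complex_of_real (U n x)) \<in> Linf;
        (\<lambda>x. complex_of_real (u x)) \<in> Linf;
        AE x in half_line. incseq (\<lambda>n. U n x) \<and> 0 \<le> U 0 x \<and> (\<lambda>n. U n x) \<longlonglongrightarrow> u x\<rbrakk> \<Longrightarrow>
        (\<lambda>n. cinner (blinfun_apply (\<iota> (\<lambda>x. complex_of_real (U n x))) \<xi>) \<xi>)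
          \<longlonglongrightarrow> cinner (blinfun_apply (\<iota> (\<lambda>x. complex_of_real (u x))) \<xi>) \<xi>"
    and X_op: "0 < r \<Longrightarrow> X r \<in> bounded_ops"
    and X_selfadjoint: "0 < r \<Longrightarrow> adj (X r) = X r"
    and X_compress: "\<lbrakk>0 < r; r \<le> s\<rbrakk> \<Longrightarrow> chi \<iota> r o\<^sub>L X s o\<^sub>L chi \<iota> r = X r"
    and trace: "nsf_trace (sc_algebra \<iota> X) Tr"
    and trace_embed: "\<lbrakk>(\<lambda>x. complex_of_real (u x)) \<in> Linf; \<And>x. 0 \<le> u x\<rbrakk> \<Longrightarrow>
        Tr (\<iota> (\<lambda>x. complex_of_real (u x))) = (\<integral>\<^sup>+ x. ennreal (u x) \<partial>half_line)"
    and semicircular: "\<lbrakk>0 < r; fs \<noteq> []; \<forall>f\<in>set fs. f \<in> Linf \<and> supported_upto r f\<rbrakk> \<Longrightarrow>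
        has_cond_expectation (sc_algebra \<iota> X) Tr \<iota> (sc_word \<iota> (X r) fs) (sc_moment fs)"

text \<open>Since \<open>\<alpha>\<^sub>t\<close> maps \<open>\<chi>\<^bsub>[0,r]\<^esub>\<close> to \<open>\<chi>\<^bsub>[0,tr]\<^esub>\<close>, the rule \<open>\<alpha>\<^sub>t(X) = t\<^bsup>-1/2\<^esup> X\<close> amounts to
  \<open>\<alpha>\<^sub>t(X r) = t\<^bsup>-1/2\<^esup> X (t r)\<close> on compressions.\<close>

definition dilation_action :: "((real \<Rightarrow> complex) \<Rightarrow> 'h::complex_hilbert_space \<Rightarrow>\<^sub>L 'h) \<Rightarrow>
    (real \<Rightarrow> 'h \<Rightarrow>\<^sub>L 'h) \<Rightarrow> (real \<Rightarrow> ('h \<Rightarrow>\<^sub>L 'h) \<Rightarrow> ('h \<Rightarrow>\<^sub>L 'h)) \<Rightarrow> bool" where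
  "dilation_action \<iota> X \<alpha> \<longleftrightarrow> (\<forall>t>0. star_automorphism (sc_algebra \<iota> X) (\<alpha> t) \<and>
     (\<forall>f\<in>Linf. \<alpha> t (\<iota> f) = \<iota> (\<lambda>x. f (x / t))) \<and>
     (\<forall>r>0. \<alpha> t (X r) = (t powr (-1/2)) *\<^sub>R X (t * r)))"


section \<open>The derivation\<close>

definition corner :: "((real \<Rightarrow> complex) \<Rightarrow> 'h::complex_hilbert_space \<Rightarrow>\<^sub>L 'h) \<Rightarrow>
    (real \<Rightarrow> 'h \<Rightarrow>\<^sub>L 'h) \<Rightarrow> ('h \<Rightarrow>\<^sub>L 'h) set" where
  "corner \<iota> X = {chi \<iota> 1 o\<^sub>L a o\<^sub>L chi \<iota> 1 | a. a \<in> sc_algebra \<iota> X}"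

text \<open>\<open>C\<^sup>1\<^sub>0([0,1))\<close>: continuously differentiable on \<open>[0,1]\<close> (one-sidedly at the end points), vanishing
  at \<open>1\<close>, extended by \<open>0\<close>.\<close>

definition C10 :: "(real \<Rightarrow> complex) set" where
  "C10 = {f. (\<forall>x\<ge>1. f x = 0) \<and> (\<exists>f'. continuous_on {0..1} f' \<and>
     (\<forall>x\<in>{0..1}. (f has_vector_derivative f' x) (at x within {0..1})))}"

text \<open>Differentiable functions of compact support in \<open>[0,\<infinity>)\<close>. The derivative has to be bounded, for
  otherwise \<open>\<delta>\<close>, which replaces \<open>f\<close> by \<open>-x f'(x)\<close>, does not take values in the algebra.\<close>

definition Dc :: "(real \<Rightarrow> complex) set" where
  "Dc = {f. (\<exists>r. supported_upto r f) \<and> (\<exists>f' C. \<forall>x\<ge>0. cmod (f' x) \<le> C \<and>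
     (f has_vector_derivative f' x) (at x within {0..}))}"

inductive_set deriv_domain :: "((real \<Rightarrow> complex) \<Rightarrow> 'h::complex_hilbert_space \<Rightarrow>\<^sub>L 'h) \<Rightarrow>
    (real \<Rightarrow> 'h \<Rightarrow>\<^sub>L 'h) \<Rightarrow> ('h \<Rightarrow>\<^sub>L 'h) set"
  for \<iota> :: "(real \<Rightarrow> complex) \<Rightarrow> 'h::complex_hilbert_space \<Rightarrow>\<^sub>L 'h" and X :: "real \<Rightarrow> 'h \<Rightarrow>\<^sub>L 'h"
  where
    embed: "f \<in> C10 \<Longrightarrow> \<iota> f \<in> deriv_domain \<iota> X"
  | word: "\<lbrakk>f \<in> C10; g \<in> C10; set fs \<subseteq> Dc; 0 < r; \<forall>h\<in>set (f # fs @ [g]). supported_upto r h\<rbrakk> \<Longrightarrow>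
      sc_word \<iota> (X r) (f # fs @ [g]) \<in> deriv_domain \<iota> X"
  | add: "\<lbrakk>a \<in> deriv_domain \<iota> X; b \<in> deriv_domain \<iota> X\<rbrakk> \<Longrightarrow> a + b \<in> deriv_domain \<iota> X"
  | scale: "a \<in> deriv_domain \<iota> X \<Longrightarrow> c *\<^sub>C a \<in> deriv_domain \<iota> X"
  | mult: "\<lbrakk>a \<in> deriv_domain \<iota> X; b \<in> deriv_domain \<iota> X\<rbrakk> \<Longrightarrow> a o\<^sub>L b \<in> deriv_domain \<iota> X"

text \<open>\<open>d = d/dt \<chi>\<^bsub>[0,1]\<^esub> \<alpha>\<^sub>t(a) \<chi>\<^bsub>[0,1]\<^esub>\<close> at \<open>t = 1\<close>, the derivative being taken in \<open>L\<^sup>2\<close>.\<close>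

definition has_dilation_derivative :: "((real \<Rightarrow> complex) \<Rightarrow> 'h::complex_hilbert_space \<Rightarrow>\<^sub>L 'h) \<Rightarrow>
    (('h \<Rightarrow>\<^sub>L 'h) \<Rightarrow> 'h) \<Rightarrow> (real \<Rightarrow> ('h \<Rightarrow>\<^sub>L 'h) \<Rightarrow> ('h \<Rightarrow>\<^sub>L 'h)) \<Rightarrow>
    ('h \<Rightarrow>\<^sub>L 'h) \<Rightarrow> ('h \<Rightarrow>\<^sub>L 'h) \<Rightarrow> bool" where
  "has_dilation_derivative \<iota> \<Lambda> \<alpha> a d \<longleftrightarrow>
     ((\<lambda>t. \<Lambda> (chi \<iota> 1 o\<^sub>L \<alpha> t a o\<^sub>L chi \<iota> 1)) has_vector_derivative \<Lambda> d) (at 1)"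

definition dilation_deriv :: "((real \<Rightarrow> complex) \<Rightarrow> 'h::complex_hilbert_space \<Rightarrow>\<^sub>L 'h) \<Rightarrow>
    (real \<Rightarrow> 'h \<Rightarrow>\<^sub>L 'h) \<Rightarrow> (('h \<Rightarrow>\<^sub>L 'h) \<Rightarrow> 'h) \<Rightarrow> (real \<Rightarrow> ('h \<Rightarrow>\<^sub>L 'h) \<Rightarrow> ('h \<Rightarrow>\<^sub>L 'h)) \<Rightarrow>
    ('h \<Rightarrow>\<^sub>L 'h) \<Rightarrow> ('h \<Rightarrow>\<^sub>L 'h)" where
  "dilation_deriv \<iota> X \<Lambda> \<alpha> a = (THE d. d \<in> corner \<iota> X \<and> has_dilation_derivative \<iota> \<Lambda> \<alpha> a d)"

definition is_subalgebra :: "('h::complex_hilbert_space \<Rightarrow>\<^sub>L 'h) set \<Rightarrow> bool" where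
  "is_subalgebra D \<longleftrightarrow> 0 \<in> D \<and> (\<forall>a\<in>D. \<forall>b\<in>D. a + b \<in> D \<and> a o\<^sub>L b \<in> D) \<and>
     (\<forall>a\<in>D. \<forall>c. c *\<^sub>C a \<in> D)"

definition is_derivation :: "('h::complex_hilbert_space \<Rightarrow>\<^sub>L 'h) set \<Rightarrow> ('h \<Rightarrow>\<^sub>L 'h) set \<Rightarrow>
    (('h \<Rightarrow>\<^sub>L 'h) \<Rightarrow> ('h \<Rightarrow>\<^sub>L 'h)) \<Rightarrow> bool" where
  "is_derivation D N \<delta> \<longleftrightarrow> is_subalgebra D \<and> D \<subseteq> N \<and> \<delta> ` D \<subseteq> N \<and>
     (\<forall>a\<in>D. \<forall>b\<in>D. \<delta> (a + b) = \<delta> a + \<delta> b \<and> \<delta> (a o\<^sub>L b) = (\<delta> a o\<^sub>L b) + (a o\<^sub>L \<delta> b)) \<and>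
     (\<forall>a\<in>D. \<forall>c. \<delta> (c *\<^sub>C a) = c *\<^sub>C \<delta> a)"

text \<open>Unbounded operators on a Hilbert space are given by their graphs.\<close>

definition L2_graph :: "(('h::complex_hilbert_space \<Rightarrow>\<^sub>L 'h) \<Rightarrow> 'h) \<Rightarrow> ('h \<Rightarrow>\<^sub>L 'h) set \<Rightarrow>
    (('h \<Rightarrow>\<^sub>L 'h) \<Rightarrow> ('h \<Rightarrow>\<^sub>L 'h)) \<Rightarrow> ('h \<times> 'h) set" where
  "L2_graph \<Lambda> D \<delta> = {(\<Lambda> a, \<Lambda> (\<delta> a)) | a. a \<in> D}"

definition closable :: "('h::complex_hilbert_space \<times> 'h) set \<Rightarrow> bool" where
  "closable G \<longleftrightarrow> (\<forall>y. (0, y) \<in> closure G \<longrightarrow> y = 0)"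

text \<open>The adjoint inside the Hilbert subspace \<open>K\<close>; it is the graph of an operator if and only if the
  domain of \<open>G\<close> is dense in \<open>K\<close>.\<close>

definition adjoint_graph :: "'h::complex_hilbert_space set \<Rightarrow> ('h \<times> 'h) set \<Rightarrow> ('h \<times> 'h) set" where
  "adjoint_graph K G = {(y, z) \<in> K \<times> K. \<forall>(x, w)\<in>G. cinner w y = cinner x z}"

text \<open>\<open>L\<^sup>\<infinity>([0,1])\<close>, and density in its weak* topology as the dual of \<open>L\<^sup>1([0,1])\<close>.\<close>

definition Linf01 :: "(real \<Rightarrow> complex) set" where
  "Linf01 = {f \<in> Linf. supported_upto 1 f}"

definition weak_star_dense01 :: "(real \<Rightarrow> complex) set \<Rightarrow> bool" where
  "weak_star_dense01 A \<longleftrightarrow> A \<subseteq> Linf01 \<and> (\<forall>f\<in>Linf01. \<forall>G e. finite G \<longrightarrow> 0 < e \<longrightarrow>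
     (\<forall>g\<in>G. integrable (lebesgue_on {0..1}) (g :: real \<Rightarrow> complex)) \<longrightarrow>
     (\<exists>h\<in>A. \<forall>g\<in>G. cmod (LINT x|lebesgue_on {0..1}. (f x - h x) * g x) < e))"

end

theory Submission
  imports Defs
begin

text \<open>Everything rests on two facts about the action \<open>\<alpha>\<^sub>t\<close> near \<open>t = 1\<close>: it is differentiable in the
  strong operator topology on the elements of \<open>\<D>\<close>, and it multiplies the trace by \<open>t\<close>.

  Differentiability. Multiplication operators depend on their symbol by dominated convergence: if
  functions converge boundedly almost everywhere, then the operators converge strongly
  (\<open>iota_strong_limit\<close>). Hence \<open>f(\<cdot>/t)\<close> is strongly differentiable at \<open>t = 1\<close> when the difference
  quotients are bounded and converge almost everywhere, which covers \<open>C\<^sup>1\<^sub>0([0,1))\<close> despite the corner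
  of its elements at \<open>1\<close>. Since the product rule holds for strong derivatives of locally bounded
  families, all words are differentiable, and a product of words is a word, so that all of \<open>\<D>\<close> is
  covered (\<open>word_span_derivative\<close>). No truncation by \<open>\<chi>\<^bsub>[0,1]\<^esub>\<close> occurs in this argument, and for this
  reason the Leibniz rule for \<open>\<delta>\<close> is just the product rule for \<open>\<alpha>\<^sub>t(a)\<alpha>\<^sub>t(b)\<close>. The derivative lies in
  the corner as it is the limit from the left, and \<open>\<alpha>\<^sub>t\<close> shrinks the corner for \<open>t < 1\<close>.

  Trace. In the moment formula every contraction of two semicircular letters integrates over the half
  line, which gives a factor \<open>t\<close> after dilation and cancels the two factors \<open>t\<^bsup>-1/2\<^esup>\<close>; the trace
  itself is one more integral (\<open>sc_moment_dilate\<close>). So the trace of \<open>\<alpha>\<^sub>t(a)\<close> is \<open>t\<close> times the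
  trace of \<open>a\<close>, and differentiation yields \<open>\<tau>(\<delta>(a)) = \<tau>(a)\<close> (\<open>trace_derivative\<close>), that is
  \<open>\<delta>\<^sup>*1 = 1\<close>.

  Closability is then formal: for \<open>z \<in> \<D>\<close> the Leibniz rule gives
  \<open>\<tau>(z \<delta>(x)) = \<tau>(z x) - \<tau>(\<delta>(z) x)\<close>, which is continuous in \<open>x\<close> for the \<open>L\<^sup>2\<close> norm, and the adjoints
  of the elements of \<open>\<D>\<close> form a dense set. Density of \<open>\<D>\<close> follows from the double commutant theorem
  in the form \<open>generated_vN_invariant\<close>, which reduces to words with bounded coefficients, and the
  approximation of these coefficients one at a time.

  On functions \<open>\<delta>\<close> is \<open>f \<mapsto> -x f'\<close>. A subspace of \<open>C\<^sup>1\<^sub>0([0,1))\<close> invariant under it consists of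
  functions that vanish to infinite order at \<open>1\<close>; the algebra generated by
  \<open>(1-x)\<^bsup>-k\<^esup> exp(-1/(1-x))\<close> over the polynomials is invariant and weak* dense. Its dilated copies
  approximate the coefficients of words.\<close>

section \<open>Adjoints and commutants\<close>

lemma scaleC_zero_left [simp]: "0 *\<^sub>C (x::'a::complex_vector) = 0"
  using scaleR_scaleC[of 0 x] by simp

lemma scaleC_zero_right [simp]: "c *\<^sub>C (0::'a::complex_vector) = 0"
  using scaleC_add_right[of c 0 "0::'a"] by simp

lemma scaleC_minus_right: "c *\<^sub>C (- x) = - (c *\<^sub>C (x::'a::complex_vector))"
  using scaleC_add_right[of c x "-x"] by (simp add: eq_neg_iff_add_eq_0 add.commute)

lemma scaleC_diff_right: "c *\<^sub>C (x - y) = c *\<^sub>C x - c *\<^sub>C (y::'a::complex_vector)"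
  using scaleC_add_right[of c x "-y"] by (simp add: scaleC_minus_right)

lemma scaleC_minus_one: "(-1) *\<^sub>C (x::'a::complex_vector) = - x"
  using scaleR_scaleC[of "-1" x] by simp

lemma blinfun_apply_scaleC [simp]:
  "blinfun_apply (c *\<^sub>C a) x = c *\<^sub>C blinfun_apply (a::'a::real_normed_vector \<Rightarrow>\<^sub>L 'b::complex_hilbert_space) x"
  by (simp add: scaleC_blinfun.rep_eq)

lemma cinner_add_right: "cinner x (y + z) = cinner x y + cinner x (z::'a::complex_hilbert_space)"
  by (metis cinner_add_left cinner_commute complex_cnj_add)

lemma cinner_scaleC_right: "cinner x (c *\<^sub>C y) = cnj c * cinner x (y::'a::complex_hilbert_space)"
  by (metis cinner_scaleC_left cinner_commute complex_cnj_mult)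

lemma cinner_zero_left [simp]: "cinner 0 (x::'a::complex_hilbert_space) = 0"
  using cinner_scaleC_left[of 0 0 x] by simp

lemma cinner_minus_left: "cinner (- x) y = - cinner x (y::'a::complex_hilbert_space)"
  using cinner_scaleC_left[of "-1" x y] by (simp add: scaleC_minus_one)

lemma cinner_minus_right: "cinner x (- y) = - cinner x (y::'a::complex_hilbert_space)"
  using cinner_scaleC_right[of x "-1" y] by (simp add: scaleC_minus_one)

lemma cinner_diff_left: "cinner (x - y) z = cinner x z - cinner y (z::'a::complex_hilbert_space)"
  using cinner_add_left[of x "-y" z] by (simp add: cinner_minus_left)

lemma cinner_diff_right: "cinner x (y - z) = cinner x y - cinner x (z::'a::complex_hilbert_space)"
  using cinner_add_right[of x y "-z"] by (simp add: cinner_minus_right)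

lemma cinner_scaleR_left: "cinner (r *\<^sub>R x) y = of_real r * cinner x (y::'a::complex_hilbert_space)"
  by (simp add: scaleR_scaleC cinner_scaleC_left)

lemma cinner_Complex: "cinner x y = Complex (inner x y) (inner x (\<i> *\<^sub>C (y::'a::complex_hilbert_space)))"
  by (simp add: complex_eq_iff inner_cinner cinner_scaleC_right)

lemma cinner_self: "cinner x x = of_real ((norm (x::'a::complex_hilbert_space))\<^sup>2)"
proof -
  have "Im (cinner x x) = 0"
    using cinner_commute[of x x] by (metis complex_cnj_cancel_iff cnj.simps(2) equal_neg_zero)
  then show ?thesis
    by (simp add: complex_eq_iff power2_norm_eq_inner inner_cinner)
qed

lemma cinner_self_eq_0: "cinner x x = 0 \<longleftrightarrow> (x::'a::complex_hilbert_space) = 0"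
  by (simp add: cinner_self)

lemma tendsto_cinner_left:
  "(f \<longlongrightarrow> l) F \<Longrightarrow> ((\<lambda>t. cinner (f t) (y::'a::complex_hilbert_space)) \<longlongrightarrow> cinner l y) F"
  unfolding cinner_Complex Complex_eq
  by (intro tendsto_intros)

lemma bounded_linear_cinner_left: "bounded_linear (\<lambda>x. cinner x (y::'a::complex_hilbert_space))"
  unfolding cinner_Complex Complex_eq
  by (intro bounded_linear_add bounded_linear_const_mult
      bounded_linear_compose[OF bounded_linear_of_real bounded_linear_inner_left])

text \<open>A minimizing sequence for the distance is Cauchy by the parallelogram identity, and its
  limit cannot be improved in any direction of the subspace.\<close>

lemma orthogonal_projection_exists:
  fixes V :: "'a::{real_inner, complete_space} set"
  assumes "closed V" "subspace V"
  shows "\<exists>v\<in>V. \<forall>w\<in>V. inner (x - v) w = 0"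
proof -
  define d where "d = Inf ((\<lambda>v. (norm (x - v))\<^sup>2) ` V)"
  have V0: "0 \<in> V" using assms(2) by (simp add: subspace_0)
  have bdd: "bdd_below ((\<lambda>v. (norm (x - v))\<^sup>2) ` V)"
    by (rule bdd_belowI[of _ 0]) auto
  have lower: "d \<le> (norm (x - v))\<^sup>2" if "v \<in> V" for v
    unfolding d_def by (rule cInf_lower[OF _ bdd]) (use that in auto)
  have "\<exists>v\<in>V. (norm (x - v))\<^sup>2 < d + 1 / real (Suc n)" for n
  proof -
    have "Inf ((\<lambda>v. (norm (x - v))\<^sup>2) ` V) < d + 1 / real (Suc n)"
      by (simp add: d_def)
    then show ?thesis
      by (subst (asm) cInf_less_iff[OF _ bdd]) (use V0 in auto)
  qed
  then obtain v where vV: "\<And>n. v n \<in> V" and vd: "\<And>n. (norm (x - v n))\<^sup>2 < d + 1 / real (Suc n)"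
    by metis
  have near: "(norm (v m - v n))\<^sup>2 \<le> 2 / real (Suc m) + 2 / real (Suc n)" for m n
  proof -
    have "(1/2) *\<^sub>R (v m + v n) \<in> V"
      using assms(2) vV by (simp add: subspace_add subspace_scale)
    from lower[OF this] have "4 * d \<le> 4 * (norm (x - (1/2) *\<^sub>R (v m + v n)))\<^sup>2" by simp
    also have "\<dots> = (norm ((x - v m) + (x - v n)))\<^sup>2"
    proof -
      have "(x - v m) + (x - v n) = 2 *\<^sub>R (x - (1/2) *\<^sub>R (v m + v n))"
        by (simp add: algebra_simps scaleR_2)
      then show ?thesis by (simp add: power_mult_distrib)
    qed
    finally have "4 * d \<le> (norm ((x - v m) + (x - v n)))\<^sup>2" .
    moreover have "(norm (v m - v n))\<^sup>2 = 2 * (norm (x - v m))\<^sup>2 + 2 * (norm (x - v n))\<^sup>2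
        - (norm ((x - v m) + (x - v n)))\<^sup>2"
      by (simp add: power2_norm_eq_inner inner_add_left inner_add_right inner_diff_left
          inner_diff_right inner_commute)
    ultimately show ?thesis using vd[of m] vd[of n] by simp
  qed
  have "Cauchy v"
  proof (rule metric_CauchyI)
    fix e :: real assume "0 < e"
    then obtain N where N: "4 / e\<^sup>2 < real N" using reals_Archimedean2 by blast
    have "dist (v m) (v n) < e" if "m \<ge> N" "n \<ge> N" for m n
    proof -
      have "0 < real N" using N \<open>0 < e\<close> by (smt (verit) divide_pos_pos zero_less_power)
      have "2 / real (Suc k) \<le> 2 / real N" if "k \<ge> N" for k
        using that \<open>0 < real N\<close> by (intro divide_left_mono) auto
      then have "(norm (v m - v n))\<^sup>2 \<le> 2 / real N + 2 / real N"
        using near[of m n] that by (smt (verit))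
      also have "\<dots> = 4 / real N" by simp
      also have "\<dots> < e\<^sup>2" using N \<open>0 < e\<close> \<open>0 < real N\<close> by (simp add: field_simps)
      finally show ?thesis using \<open>0 < e\<close> by (simp add: dist_norm power2_less_imp_less)
    qed
    then show "\<exists>M. \<forall>m\<ge>M. \<forall>n\<ge>M. dist (v m) (v n) < e" by blast
  qed
  then obtain u where u: "v \<longlonglongrightarrow> u" using Cauchy_convergent convergent_def by blast
  have uV: "u \<in> V" using closed_sequentially[OF assms(1)] vV u by blast
  have "(norm (x - u))\<^sup>2 \<le> d"
  proof (rule LIMSEQ_le)
    show "(\<lambda>n. (norm (x - v n))\<^sup>2) \<longlonglongrightarrow> (norm (x - u))\<^sup>2" by (intro tendsto_intros u)
    have "(\<lambda>n. d + 1 / real (Suc n)) \<longlonglongrightarrow> d + 0"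
      by (intro tendsto_intros) (use LIMSEQ_inverse_real_of_nat in \<open>simp add: inverse_eq_divide\<close>)
    then show "(\<lambda>n. d + 1 / real (Suc n)) \<longlonglongrightarrow> d" by simp
  qed (use vd less_imp_le in blast)
  then have min: "(norm (x - u))\<^sup>2 \<le> (norm (x - v))\<^sup>2" if "v \<in> V" for v
    using lower[OF that] by (rule order_trans)
  have "inner (x - u) w = 0" if "w \<in> V" for w
  proof (cases "w = 0")
    case False
    define s where "s = inner (x - u) w / inner w w"
    have "u + s *\<^sub>R w \<in> V" using uV that assms(2) by (simp add: subspace_add subspace_scale)
    from min[OF this] have "inner (x - u) (x - u) \<le> inner (x - u - s *\<^sub>R w) (x - u - s *\<^sub>R w)"
      by (simp only: power2_norm_eq_inner diff_diff_add)
    also have "\<dots> = inner (x - u) (x - u) + (s\<^sup>2 * inner w w - 2 * s * inner (x - u) w)"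
    proof -
      have "inner (y - s *\<^sub>R w) (y - s *\<^sub>R w) = inner y y + (s\<^sup>2 * inner w w - 2 * s * inner y w)" for y
        by (simp add: inner_diff_left inner_diff_right inner_commute power2_eq_square algebra_simps)
      then show ?thesis .
    qed
    finally have "0 \<le> s\<^sup>2 * inner w w - 2 * s * inner (x - u) w" by simp
    moreover have "s * inner w w = inner (x - u) w" using False by (simp add: s_def)
    then have "s\<^sup>2 * inner w w = s * inner (x - u) w" by (simp add: power2_eq_square)
    ultimately have "s * inner (x - u) w \<le> 0" by simp
    then have "(inner (x - u) w)\<^sup>2 / inner w w \<le> 0" by (simp add: s_def power2_eq_square)
    moreover have "0 < inner w w" using False by simp
    ultimately have "(inner (x - u) w)\<^sup>2 \<le> 0" by (simp add: divide_le_0_iff)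
    then show ?thesis by simp
  qed simp
  then show ?thesis using uV by blast
qed

text \<open>The representing vector lies in the orthogonal complement of the kernel, which is at most one-dimensional.\<close>

lemma riesz_representation:
  fixes \<phi> :: "'a::{real_inner, complete_space} \<Rightarrow> real"
  assumes "bounded_linear \<phi>"
  shows "\<exists>z. \<forall>x. \<phi> x = inner x z"
proof -
  interpret bounded_linear \<phi> by fact
  have cl: "closed {x. \<phi> x = 0}"
    by (intro closed_Collect_eq continuous_on continuous_on_const) (simp add: linear_continuous_on bounded_linear_axioms)
  have sub: "subspace {x. \<phi> x = 0}"
    by (simp add: subspace_def add scaleR zero)
  show ?thesis
  proof (cases "\<forall>x. \<phi> x = 0")
    case True
    then show ?thesis by (intro exI[of _ 0]) simp
  next
    case False
    then obtain y where y: "\<phi> y \<noteq> 0" by blast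
    obtain v where v: "\<phi> v = 0" "\<And>w. \<phi> w = 0 \<Longrightarrow> inner (y - v) w = 0"
      using orthogonal_projection_exists[OF cl sub, of y] by blast
    define u where "u = y - v"
    have pu: "\<phi> u \<noteq> 0" using y v by (simp add: u_def diff)
    then have u0: "inner u u > 0" using zero by force
    have "\<phi> x = inner x ((\<phi> u / inner u u) *\<^sub>R u)" for x
    proof -
      have "\<phi> (x - (\<phi> x / \<phi> u) *\<^sub>R u) = 0" using pu by (simp add: diff scaleR)
      from v(2)[OF this] have "inner u x = (\<phi> x / \<phi> u) * inner u u"
        by (simp add: u_def[symmetric] inner_diff_right)
      then show ?thesis using pu u0 by (simp add: inner_commute field_simps)
    qed
    then show ?thesis by blast
  qed
qed

lemma bounded_opsD: "a \<in> bounded_ops \<Longrightarrow> blinfun_apply a (c *\<^sub>C x) = c *\<^sub>C blinfun_apply a x"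
  by (simp add: bounded_ops_def)

text \<open>The real Riesz theorem gives the adjoint for the real inner product. Complex linearity of the
  operator makes it an adjoint for the complex inner product as well. Thus the definite description
  in \<^const>\<open>adj\<close> denotes something on \<^const>\<open>bounded_ops\<close>.\<close>

lemma adjoint_exists:
  fixes a :: "'h::complex_hilbert_space \<Rightarrow>\<^sub>L 'h"
  assumes "a \<in> bounded_ops"
  shows "\<exists>b\<in>bounded_ops. \<forall>x y. cinner (blinfun_apply a x) y = cinner x (blinfun_apply b y)"
proof -
  have "\<exists>z. \<forall>x. inner (blinfun_apply a x) y = inner x z" for y
    by (rule riesz_representation)
       (intro bounded_linear_compose[OF bounded_linear_inner_left] blinfun.bounded_linear_right)
  then obtain b where b: "\<And>x y. inner (blinfun_apply a x) y = inner x (b y)" by metis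
  have eqI: "u = v" if "\<And>x. inner x u = inner x v" for u v :: 'h
    using that[of "u - v"] by (metis inner_diff_right inner_eq_zero_iff eq_iff_diff_eq_0)
  have ic: "inner u (c *\<^sub>C v) = inner (cnj c *\<^sub>C u) v" for c and u v :: 'h
    by (simp add: inner_cinner cinner_scaleC_left cinner_scaleC_right)
  have bc: "b (c *\<^sub>C y) = c *\<^sub>C b y" for c y
    by (rule eqI) (metis b ic bounded_opsD[OF assms])
  have "bounded_linear b"
  proof (rule bounded_linear_intro[where K = "norm a"])
    show "b (x + y) = b x + b y" for x y
      by (rule eqI) (simp add: b[symmetric] inner_add_right)
    show "b (r *\<^sub>R x) = r *\<^sub>R b x" for r x
      by (rule eqI) (simp add: b[symmetric])
    show "norm (b y) \<le> norm y * norm a" for y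
    proof (cases "norm (b y) = 0")
      case False
      have "norm (b y) * norm (b y) = inner (blinfun_apply a (b y)) y"
        by (metis b power2_eq_square power2_norm_eq_inner)
      also have "\<dots> \<le> norm a * norm (b y) * norm y"
        by (meson norm_cauchy_schwarz norm_blinfun mult_right_mono norm_ge_zero order_trans)
      finally have "norm (b y) * norm (b y) \<le> norm (b y) * (norm y * norm a)" by (simp add: ac_simps)
      then show ?thesis using False by simp
    qed simp
  qed
  then have B: "blinfun_apply (Blinfun b) = b" by (rule bounded_linear_Blinfun_apply)
  have "Blinfun b \<in> bounded_ops" by (simp add: bounded_ops_def B bc)
  moreover have "cinner (blinfun_apply a x) y = cinner x (blinfun_apply (Blinfun b) y)" for x y
    by (simp add: cinner_Complex B b bc)
  ultimately show ?thesis by blast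
qed

lemma adj_eqI:
  assumes "\<And>x y. cinner (blinfun_apply a x) y = cinner x (blinfun_apply b y)"
  shows "adj a = b"
  unfolding adj_def
proof (rule the_equality)
  fix c assume c: "\<forall>x y. cinner (blinfun_apply a x) y = cinner x (blinfun_apply c y)"
  have "blinfun_apply c y - blinfun_apply b y = 0" for y
    by (subst cinner_self_eq_0[symmetric]) (metis c assms cinner_diff_right diff_self)
  then show "c = b" by (intro blinfun_eqI) simp
qed (use assms in blast)

lemma
  assumes "a \<in> bounded_ops"
  shows adj_bounded_ops: "adj a \<in> bounded_ops"
    and cinner_adj: "cinner (blinfun_apply a x) y = cinner x (blinfun_apply (adj a) y)"
proof -
  obtain b where b: "b \<in> bounded_ops" "\<And>x y. cinner (blinfun_apply a x) y = cinner x (blinfun_apply b y)"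
    using adjoint_exists[OF assms] by blast
  have "adj a = b" by (rule adj_eqI) (rule b(2))
  with b show "adj a \<in> bounded_ops" "cinner (blinfun_apply a x) y = cinner x (blinfun_apply (adj a) y)"
    by simp_all
qed

lemma cinner_adj_left:
  "a \<in> bounded_ops \<Longrightarrow> cinner (blinfun_apply (adj a) x) y = cinner x (blinfun_apply a y)"
  by (metis cinner_adj cinner_commute)

lemma adj_adj: "a \<in> bounded_ops \<Longrightarrow> adj (adj a) = a"
  by (rule adj_eqI) (rule cinner_adj_left)

lemma bounded_ops_id [simp]: "id_blinfun \<in> bounded_ops"
  by (simp add: bounded_ops_def)

lemma bounded_ops_zero [simp]: "0 \<in> bounded_ops"
  by (simp add: bounded_ops_def)

lemma bounded_ops_add: "a \<in> bounded_ops \<Longrightarrow> b \<in> bounded_ops \<Longrightarrow> a + b \<in> bounded_ops"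
  by (simp add: bounded_ops_def blinfun.add_left scaleC_add_right)

lemma bounded_ops_scaleC: "a \<in> bounded_ops \<Longrightarrow> c *\<^sub>C a \<in> bounded_ops"
  by (simp add: bounded_ops_def scaleC_scaleC mult.commute)

lemma bounded_ops_compose: "a \<in> bounded_ops \<Longrightarrow> b \<in> bounded_ops \<Longrightarrow> a o\<^sub>L b \<in> bounded_ops"
  by (simp add: bounded_ops_def)

lemma adj_add: "a \<in> bounded_ops \<Longrightarrow> b \<in> bounded_ops \<Longrightarrow> adj (a + b) = adj a + adj b"
  by (rule adj_eqI) (simp add: blinfun.add_left cinner_add_left cinner_add_right cinner_adj)

lemma adj_scaleC: "a \<in> bounded_ops \<Longrightarrow> adj (c *\<^sub>C a) = cnj c *\<^sub>C adj a"
  by (rule adj_eqI) (simp add: cinner_scaleC_left cinner_scaleC_right cinner_adj)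

lemma adj_compose: "a \<in> bounded_ops \<Longrightarrow> b \<in> bounded_ops \<Longrightarrow> adj (a o\<^sub>L b) = adj b o\<^sub>L adj a"
  by (rule adj_eqI) (simp add: cinner_adj)

lemma blinfun_compose_scaleC_left:
  fixes a b :: "'h::complex_hilbert_space \<Rightarrow>\<^sub>L 'h"
  shows "(c *\<^sub>C a) o\<^sub>L b = c *\<^sub>C (a o\<^sub>L b)"
  by (rule blinfun_eqI) simp

lemma blinfun_compose_scaleC_right:
  fixes a b :: "'h::complex_hilbert_space \<Rightarrow>\<^sub>L 'h"
  shows "a \<in> bounded_ops \<Longrightarrow> a o\<^sub>L (c *\<^sub>C b) = c *\<^sub>C (a o\<^sub>L b)"
  by (rule blinfun_eqI) (simp add: bounded_opsD)

lemma blinfun_compose_assoc: "(a o\<^sub>L b) o\<^sub>L c = a o\<^sub>L (b o\<^sub>L c)"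
  by (rule blinfun_eqI) simp

lemmas blinfun_compose_add_left = bounded_bilinear.add_left[OF bounded_bilinear_blinfun_compose]
lemmas blinfun_compose_add_right = bounded_bilinear.add_right[OF bounded_bilinear_blinfun_compose]

lemma id_blinfun_compose: "id_blinfun o\<^sub>L a = a" "a o\<^sub>L id_blinfun = a"
  by (rule blinfun_eqI, simp)+

text \<open>Polarization, with the vectors \<open>x + y\<close> and \<open>x + i y\<close>.\<close>

lemma quadratic_form_zero:
  fixes a :: "'h::complex_hilbert_space \<Rightarrow>\<^sub>L 'h"
  assumes "a \<in> bounded_ops" and q: "\<And>x. cinner (blinfun_apply a x) x = 0"
  shows "a = 0"
proof -
  have "cinner (blinfun_apply a x) y = 0" for x y
  proof -
    have 1: "cinner (blinfun_apply a x) y + cinner (blinfun_apply a y) x = 0"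
      using q[of "x + y"] by (simp add: q blinfun.add_right cinner_add_left cinner_add_right add.commute)
    have "- \<i> * cinner (blinfun_apply a x) y + \<i> * cinner (blinfun_apply a y) x = 0"
      using q[of "x + \<i> *\<^sub>C y"]
      by (simp add: q bounded_opsD[OF assms(1)] blinfun.add_right cinner_add_left cinner_add_right
          cinner_scaleC_left cinner_scaleC_right add.commute)
    then have "\<i> * (cinner (blinfun_apply a y) x - cinner (blinfun_apply a x) y) = 0"
      by (simp add: algebra_simps)
    then have "cinner (blinfun_apply a y) x = cinner (blinfun_apply a x) y" by simp
    with 1 show ?thesis by simp
  qed
  then have "blinfun_apply a x = 0" for x by (metis cinner_self_eq_0)
  then show ?thesis by (intro blinfun_eqI) simp
qed

lemma commutant_bounded: "a \<in> commutant S \<Longrightarrow> a \<in> bounded_ops"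
  by (simp add: commutant_def)

lemma commutant_id: "id_blinfun \<in> commutant S"
  by (auto simp: commutant_def intro: blinfun_eqI)

lemma commutant_add: "a \<in> commutant S \<Longrightarrow> b \<in> commutant S \<Longrightarrow> a + b \<in> commutant S"
  by (simp add: commutant_def bounded_ops_add blinfun_compose_add_left blinfun_compose_add_right)

lemma commutant_scaleC:
  "a \<in> commutant S \<Longrightarrow> S \<subseteq> bounded_ops \<Longrightarrow> c *\<^sub>C a \<in> commutant S"
  by (auto simp: commutant_def bounded_ops_scaleC blinfun_compose_scaleC_left
      blinfun_compose_scaleC_right subset_iff)

lemma commutant_compose: "a \<in> commutant S \<Longrightarrow> b \<in> commutant S \<Longrightarrow> a o\<^sub>L b \<in> commutant S"
  by (simp add: commutant_def bounded_ops_compose)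
     (metis (no_types, lifting) blinfun_compose_assoc)

lemma commutant_adj:
  assumes "a \<in> commutant S" "\<And>b. b \<in> S \<Longrightarrow> b \<in> bounded_ops \<and> adj b \<in> S"
  shows "adj a \<in> commutant S"
proof -
  have a: "a \<in> bounded_ops" using assms(1) by (rule commutant_bounded)
  have "adj a o\<^sub>L b = b o\<^sub>L adj a" if "b \<in> S" for b
  proof -
    have "a o\<^sub>L adj b = adj b o\<^sub>L a" using assms that by (simp add: commutant_def)
    then have "adj (a o\<^sub>L adj b) = adj (adj b o\<^sub>L a)" by simp
    then show ?thesis using assms(2)[OF that] a by (simp add: adj_compose adj_bounded_ops adj_adj)
  qed
  then show ?thesis using a by (simp add: commutant_def adj_bounded_ops)
qed

text \<open>Multiplication by a fixed operator from either side is strongly continuous, so commutation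
  relations pass to strong limits.\<close>

lemma commutant_strong_limit:
  fixes a :: "'h::complex_hilbert_space \<Rightarrow>\<^sub>L 'h"
  assumes "F \<noteq> bot" "\<forall>\<^sub>F t in F. A t \<in> commutant S"
    and lim: "\<And>\<xi>. ((\<lambda>t. blinfun_apply (A t) \<xi>) \<longlongrightarrow> blinfun_apply a \<xi>) F"
  shows "a \<in> commutant S"
proof -
  have ev: "\<forall>\<^sub>F t in F. A t \<in> bounded_ops"
    using assms(2) by eventually_elim (rule commutant_bounded)
  have "blinfun_apply a (c *\<^sub>C x) = c *\<^sub>C blinfun_apply a x" for c x
  proof (rule tendsto_unique[OF assms(1) lim])
    have "((\<lambda>t. c *\<^sub>C blinfun_apply (A t) x) \<longlongrightarrow> c *\<^sub>C blinfun_apply a x) F"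
      by (rule bounded_linear.tendsto[OF bounded_linear_scaleC lim])
    then show "((\<lambda>t. blinfun_apply (A t) (c *\<^sub>C x)) \<longlongrightarrow> c *\<^sub>C blinfun_apply a x) F"
      by (rule Lim_transform_eventually) (use ev in \<open>eventually_elim, simp add: bounded_opsD\<close>)
  qed
  moreover have "a o\<^sub>L b = b o\<^sub>L a" if "b \<in> S" for b
  proof (rule blinfun_eqI)
    fix x
    have "blinfun_apply a (blinfun_apply b x) = blinfun_apply b (blinfun_apply a x)"
    proof (rule tendsto_unique[OF assms(1) lim])
      have "((\<lambda>t. blinfun_apply b (blinfun_apply (A t) x)) \<longlongrightarrow> blinfun_apply b (blinfun_apply a x)) F"
        by (rule blinfun.tendsto[OF tendsto_const lim])
      moreover have "\<forall>\<^sub>F t in F. blinfun_apply b (blinfun_apply (A t) x) = blinfun_apply (A t) (blinfun_apply b x)"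
        using assms(2)
      proof eventually_elim
        case (elim t)
        then have "A t o\<^sub>L b = b o\<^sub>L A t" using that by (simp add: commutant_def)
        then show ?case by (metis blinfun_apply_blinfun_compose)
      qed
      ultimately show "((\<lambda>t. blinfun_apply (A t) (blinfun_apply b x)) \<longlongrightarrow> blinfun_apply b (blinfun_apply a x)) F"
        by (rule Lim_transform_eventually)
    qed
    then show "blinfun_apply (a o\<^sub>L b) x = blinfun_apply (b o\<^sub>L a) x" by simp
  qed
  ultimately show ?thesis by (simp add: commutant_def bounded_ops_def)
qed

text \<open>The orthogonal projection onto a closed subspace that is invariant under a self-adjoint set
  commutes with this set. Hence the subspace is invariant under the generated von Neumann
  algebra; this is the part of the double commutant theorem that density arguments use.\<close>

lemma generated_vN_invariant:
  fixes V :: "'h::complex_hilbert_space set"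
  assumes "closed V" and V0: "0 \<in> V" and Vadd: "\<And>x y. x \<in> V \<Longrightarrow> y \<in> V \<Longrightarrow> x + y \<in> V"
    and Vsc: "\<And>c x. x \<in> V \<Longrightarrow> c *\<^sub>C x \<in> V"
    and S: "\<And>b. b \<in> S \<Longrightarrow> b \<in> bounded_ops \<and> adj b \<in> S"
    and inv: "\<And>b x. b \<in> S \<Longrightarrow> x \<in> V \<Longrightarrow> blinfun_apply b x \<in> V"
    and a: "a \<in> generated_vN S" and x: "x \<in> V"
  shows "blinfun_apply a x \<in> V"
proof -
  have sub: "subspace V" by (simp add: subspace_def V0 Vadd Vsc scaleR_scaleC)
  obtain P where PV: "\<And>x. P x \<in> V" and Pr: "\<And>x w. w \<in> V \<Longrightarrow> inner (x - P x) w = 0"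
    using orthogonal_projection_exists[OF \<open>closed V\<close> sub] by metis
  have Porth: "cinner (x - P x) w = 0" if "w \<in> V" for x w
    using that by (simp add: cinner_Complex Pr Vsc complex_eq_iff)
  have Vdiff: "x - y \<in> V" if "x \<in> V" "y \<in> V" for x y
    using sub that by (rule subspace_diff)
  have Pu: "P x = v" if "v \<in> V" "\<And>w. w \<in> V \<Longrightarrow> cinner (x - v) w = 0" for x v
  proof -
    have "cinner (P x - v) w = 0" if "w \<in> V" for w
      using Porth[OF that, of x] \<open>\<And>w. w \<in> V \<Longrightarrow> cinner (x - v) w = 0\<close>[OF that]
      by (simp add: cinner_diff_left)
    from this[OF Vdiff[OF PV that(1), of x]] show ?thesis
      by (simp add: cinner_self_eq_0)
  qed
  have Padd: "P (x + y) = P x + P y" for x y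
  proof (rule Pu)
    show "P x + P y \<in> V" by (intro Vadd PV)
    show "cinner (x + y - (P x + P y)) w = 0" if "w \<in> V" for w
      using Porth[OF that, of x] Porth[OF that, of y] by (simp add: cinner_diff_left cinner_add_left)
  qed
  have Psc: "P (c *\<^sub>C x) = c *\<^sub>C P x" for c x
  proof (rule Pu)
    show "c *\<^sub>C P x \<in> V" by (intro Vsc PV)
    show "cinner (c *\<^sub>C x - c *\<^sub>C P x) w = 0" if "w \<in> V" for w
      using Porth[OF that, of x] by (simp add: scaleC_diff_right[symmetric] cinner_scaleC_left)
  qed
  have "bounded_linear P"
  proof (rule bounded_linear_intro[where K = 1])
    show "P (x + y) = P x + P y" for x y by (rule Padd)
    show "P (r *\<^sub>R x) = r *\<^sub>R P x" for r x by (simp add: scaleR_scaleC Psc)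
    show "norm (P x) \<le> norm x * 1" for x
    proof -
      have "inner (P x) (P x) = inner x (P x)"
        using Pr[OF PV, of x] by (simp add: inner_diff_left)
      also have "\<dots> \<le> norm x * norm (P x)" by (rule norm_cauchy_schwarz)
      finally have "norm (P x) * norm (P x) \<le> norm x * norm (P x)"
        by (simp add: power2_norm_eq_inner[symmetric] power2_eq_square)
      then show ?thesis by (cases "norm (P x) = 0") auto
    qed
  qed
  then have B: "blinfun_apply (Blinfun P) = P" by (rule bounded_linear_Blinfun_apply)
  have "Blinfun P \<in> commutant S"
    unfolding commutant_def
  proof (intro CollectI conjI ballI)
    show "Blinfun P \<in> bounded_ops" by (simp add: bounded_ops_def B Psc)
    fix b assume b: "b \<in> S"
    show "Blinfun P o\<^sub>L b = b o\<^sub>L Blinfun P"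
    proof (rule blinfun_eqI)
      fix x
      have "P (blinfun_apply b x) = blinfun_apply b (P x)"
      proof (rule Pu)
        show "blinfun_apply b (P x) \<in> V" by (rule inv[OF b PV])
        show "cinner (blinfun_apply b x - blinfun_apply b (P x)) w = 0" if "w \<in> V" for w
          using Porth[OF inv[OF conjunct2[OF S[OF b]] that], of x] S[OF b]
          by (simp add: blinfun.diff_right[symmetric] cinner_adj)
      qed
      then show "blinfun_apply (Blinfun P o\<^sub>L b) x = blinfun_apply (b o\<^sub>L Blinfun P) x" by (simp add: B)
    qed
  qed
  then have "a o\<^sub>L Blinfun P = Blinfun P o\<^sub>L a"
    using a by (simp add: generated_vN_def commutant_def)
  then have "blinfun_apply a (P x) = P (blinfun_apply a x)"
    by (metis B blinfun_apply_blinfun_compose)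
  moreover have "P x = x" by (rule Pu[OF x]) simp
  ultimately show ?thesis using PV by metis
qed


section \<open>Bounded functions on the half line\<close>

abbreviation dilate :: "real \<Rightarrow> (real \<Rightarrow> complex) \<Rightarrow> real \<Rightarrow> complex" where
  "dilate t f \<equiv> \<lambda>x. f (x / t)"

lemma AE_half_line: "(AE x in half_line. P x) \<longleftrightarrow> (AE x in lebesgue. 0 \<le> x \<longrightarrow> P x)"
  by (subst AE_restrict_space_iff) auto

lemma AE_half_line_neq: "AE x in half_line. x \<noteq> a"
proof -
  have "AE x in lebesgue. x \<notin> {a}"
    by (rule AE_not_in) (metis negligible_iff_null_sets negligible_sing)
  then show ?thesis unfolding AE_half_line by eventually_elim auto
qed

lemma measurable_scale: "(\<lambda>x::real. x / t) \<in> lebesgue \<rightarrow>\<^sub>M lebesgue"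
proof -
  have "(\<lambda>x::real. x / t) = (*\<^sub>R) (1 / t)" by auto
  then show ?thesis using lebesgue_measurable_scaling[of "1 / t"] by metis
qed

lemma AE_half_line_scale:
  assumes "AE x in half_line. P x" "0 < t"
  shows "AE x in half_line. P (x / t)"
proof -
  have "AE x in lebesgue. 0 \<le> x \<longrightarrow> P x" using assms(1) by (simp add: AE_half_line)
  then have "AE x in density (distr lebesgue lebesgue (\<lambda>x. x / t)) (\<lambda>x. ennreal \<bar>1/t\<bar>). 0 \<le> x \<longrightarrow> P x"
  proof -
    have "(lebesgue :: real measure) = density (distr lebesgue lebesgue (\<lambda>x. x / t)) (\<lambda>x. ennreal \<bar>1/t\<bar>)"
      using lebesgue_real_scale[of "1/t"] assms(2) by simp
    from this[symmetric] show ?thesis using \<open>AE x in lebesgue. 0 \<le> x \<longrightarrow> P x\<close> by (simp only:)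
  qed
  then have "AE x in distr lebesgue lebesgue (\<lambda>x. x / t). 0 \<le> x \<longrightarrow> P x"
    by (subst (asm) AE_density) (use assms(2) in auto)
  from AE_distrD[OF measurable_scale this] have "AE x in lebesgue. 0 \<le> x / t \<longrightarrow> P (x / t)" .
  then show ?thesis unfolding AE_half_line by eventually_elim (use assms(2) in auto)
qed

lemma measurable_dilate:
  assumes f: "f \<in> borel_measurable half_line" and t: "0 < t"
  shows "dilate t f \<in> borel_measurable half_line"
proof -
  have "(\<lambda>x. x / t) \<in> half_line \<rightarrow>\<^sub>M half_line"
    using t measurable_scale by (intro measurable_restrict_space3) auto
  from measurable_compose[OF this f] show ?thesis .
qed

lemma Linf_dilate: "f \<in> Linf \<Longrightarrow> 0 < t \<Longrightarrow> dilate t f \<in> Linf"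
  unfolding Linf_def using AE_half_line_scale[where t = t] by (auto intro!: measurable_dilate)

lemma LinfI:
  "f \<in> borel_measurable half_line \<Longrightarrow> (\<And>x. 0 \<le> x \<Longrightarrow> cmod (f x) \<le> C) \<Longrightarrow> f \<in> Linf"
  unfolding Linf_def by (auto intro!: exI[of _ C] simp: AE_half_line)

lemma Linf_mult: "f \<in> Linf \<Longrightarrow> g \<in> Linf \<Longrightarrow> (\<lambda>x. f x * g x) \<in> Linf"
proof -
  assume "f \<in> Linf" "g \<in> Linf"
  then obtain A B where "AE x in half_line. cmod (f x) \<le> A" "AE x in half_line. cmod (g x) \<le> B"
    and m: "f \<in> borel_measurable half_line" "g \<in> borel_measurable half_line"
    by (auto simp: Linf_def)
  from this(1,2) have "AE x in half_line. cmod (f x * g x) \<le> A * B"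
    by eventually_elim (simp add: norm_mult mult_mono')
  then show ?thesis using m by (auto simp: Linf_def)
qed

lemma Linf_add: "f \<in> Linf \<Longrightarrow> g \<in> Linf \<Longrightarrow> (\<lambda>x. f x + g x) \<in> Linf"
proof -
  assume "f \<in> Linf" "g \<in> Linf"
  then obtain A B where "AE x in half_line. cmod (f x) \<le> A" "AE x in half_line. cmod (g x) \<le> B"
    and m: "f \<in> borel_measurable half_line" "g \<in> borel_measurable half_line"
    by (auto simp: Linf_def)
  from this(1,2) have "AE x in half_line. cmod (f x + g x) \<le> A + B"
    by eventually_elim (rule norm_triangle_mono)
  then show ?thesis using m by (auto simp: Linf_def)
qed

lemma Linf_const: "(\<lambda>x. c) \<in> Linf"
  by (rule LinfI[where C = "cmod c"]) auto

lemma Linf_scale: "f \<in> Linf \<Longrightarrow> (\<lambda>x. c * f x) \<in> Linf"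
  using Linf_mult[OF Linf_const] by simp

lemma Linf_diff: "f \<in> Linf \<Longrightarrow> g \<in> Linf \<Longrightarrow> (\<lambda>x. f x - g x) \<in> Linf"
  using Linf_add[OF _ Linf_scale[of g "-1"], of f] by simp

lemma Linf_cnj: "f \<in> Linf \<Longrightarrow> (\<lambda>x. cnj (f x)) \<in> Linf"
  by (auto simp: Linf_def intro: measurable_compose[OF _ borel_measurable_continuous_onI]
      continuous_intros)

lemma Linf_indicator: "indicator {0..r} \<in> Linf"
proof (rule LinfI[where C = 1])
  show "indicator {0..r} \<in> borel_measurable half_line"
    by (intro measurable_restrict_space1 borel_measurable_indicator) simp
qed (simp add: indicator_def)

lemma integral_dilate:
  fixes f :: "real \<Rightarrow> complex"
  assumes "0 < t"
  shows "(LINT x|half_line. f (x / t)) = t * (LINT x|half_line. f x)"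
proof -
  have "(LINT x|half_line. f x) = (LINT x|lebesgue. (if x \<in> {0..} then f x else 0))"
    by (subst Lebesgue_Measure.integral_restrict_UNIV) auto
  also have "\<dots> = \<bar>1/t\<bar> *\<^sub>R (LINT x|lebesgue. (if 0 + 1/t * x \<in> {0..} then f (0 + 1/t * x) else 0))"
    by (rule lebesgue_integral_real_affine) (use assms in simp)
  also have "(LINT x|lebesgue. (if 0 + 1/t * x \<in> {0..} then f (0 + 1/t * x) else 0))
      = (LINT x|lebesgue. (if x \<in> {0..} then f (x / t) else 0))"
    by (rule Bochner_Integration.integral_cong) (use assms in \<open>auto simp: zero_le_divide_iff\<close>)
  also have "\<dots> = (LINT x|half_line. f (x / t))"
    by (subst Lebesgue_Measure.integral_restrict_UNIV) auto
  finally show ?thesis using assms by (simp add: scaleR_conv_of_real field_simps)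
qed

text \<open>A word with \<open>n\<close> semicircular letters is evaluated by \<open>n/2\<close> contractions, each of which is an
  integral over the half line and contributes a factor \<open>t\<close>.\<close>

lemma sc_moment_dilate:
  assumes "0 < t" "fs \<noteq> []"
  shows "sc_moment (map (dilate t) fs) x
    = of_real (t powr ((real (length fs) - 1) / 2)) * sc_moment fs (x / t)"
  using assms(2)
proof (induction fs arbitrary: x rule: sc_moment.induct)
  case 1
  then show ?case by simp
next
  case (2 f)
  then show ?case using assms(1) by simp
next
  case (3 f g gs)
  let ?l = "g # gs"
  have "sc_moment (map (dilate t) (f # ?l)) x = (\<Sum>k = 1..<length ?l. f (x / t) *
      (LINT y|half_line. sc_moment (map (dilate t) (take k ?l)) y) * sc_moment (map (dilate t) (drop k ?l)) x)"
    by (simp only: list.map sc_moment.simps)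
       (simp only: list.map(2)[symmetric, of "dilate t"] take_map drop_map length_map)
  also have "\<dots> = (\<Sum>k = 1..<length ?l. of_real (t powr (real (length ?l) / 2)) * (f (x / t) *
      (LINT y|half_line. sc_moment (take k ?l) y) * sc_moment (drop k ?l) (x / t)))"
  proof (rule sum.cong[OF refl])
    fix k assume k: "k \<in> {1..<length ?l}"
    have 1: "sc_moment (map (dilate t) (take k ?l)) y
        = of_real (t powr ((real k - 1) / 2)) * sc_moment (take k ?l) (y / t)" for y
      using 3(1)[OF k, of y] k by (auto simp: min_def)
    have 2: "sc_moment (map (dilate t) (drop k ?l)) x
        = of_real (t powr ((real (length ?l - k) - 1) / 2)) * sc_moment (drop k ?l) (x / t)"
      using 3(2)[OF k, of x] k by auto
    have "(real k - 1) / 2 + 1 + (real (length ?l - k) - 1) / 2 = real (length ?l) / 2"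
      using k by (simp add: field_simps of_nat_diff)
    then have e: "t powr (real (length ?l) / 2)
        = t powr ((real k - 1) / 2) * t * t powr ((real (length ?l - k) - 1) / 2)"
      using assms(1) by (metis powr_add powr_one less_imp_le)
    have "(LINT y|half_line. sc_moment (map (dilate t) (take k ?l)) y)
        = of_real (t powr ((real k - 1) / 2)) * (of_real t * (LINT y|half_line. sc_moment (take k ?l) y))"
      unfolding 1 by (simp add: integral_dilate[OF assms(1)])
    then show "f (x / t) * (LINT y|half_line. sc_moment (map (dilate t) (take k ?l)) y)
        * sc_moment (map (dilate t) (drop k ?l)) x
      = of_real (t powr (real (length ?l) / 2)) * (f (x / t) *
      (LINT y|half_line. sc_moment (take k ?l) y) * sc_moment (drop k ?l) (x / t))"
      unfolding 2 e by (simp add: algebra_simps)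
  qed
  also have "\<dots> = of_real (t powr ((real (length (f # ?l)) - 1) / 2)) * sc_moment (f # ?l) (x / t)"
    by (simp only: sc_moment.simps sum_distrib_left) simp
  finally show ?case .
qed

lemma sc_moment_support: "f x = 0 \<Longrightarrow> sc_moment (f # fs) x = 0"
  by (cases fs) auto


section \<open>Functions with a dilation derivative\<close>

text \<open>The Lipschitz bound makes the difference quotients uniformly bounded, as dominated convergence
  needs. The point \<open>1\<close> is exempted because an element of \<^const>\<open>C10\<close> may have a corner there after its
  extension by \<open>0\<close>.\<close>

definition dilation_derivative :: "(real \<Rightarrow> complex) \<Rightarrow> (real \<Rightarrow> complex) \<Rightarrow> bool" where
  "dilation_derivative f g \<longleftrightarrow> f \<in> borel_measurable half_line \<and>
     (\<exists>C. \<forall>x\<ge>0. cmod (f x) \<le> C) \<and>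
     (\<exists>C. \<forall>x\<ge>0. \<forall>t\<in>{1/2<..<2}. cmod (f (x / t) - f x) \<le> C * \<bar>t - 1\<bar>) \<and>
     (\<forall>x\<ge>0. x \<noteq> 1 \<longrightarrow> ((\<lambda>t. f (x / t)) has_vector_derivative g x) (at 1))"

lemma has_vector_derivative_iff_quotient:
  "(f has_vector_derivative d) (at a) \<longleftrightarrow> ((\<lambda>t. (1 / (t - a)) *\<^sub>R (f t - f a)) \<longlongrightarrow> d) (at a)"
proof -
  have "((\<lambda>t. (1 / (t - a)) *\<^sub>R (f t - f a)) \<longlongrightarrow> d) (at a)
     \<longleftrightarrow> ((\<lambda>t. norm ((1 / (t - a)) *\<^sub>R (f t - f a) - d)) \<longlongrightarrow> 0) (at a)"
    by (subst tendsto_norm_zero_iff) (rule LIM_zero_iff[symmetric])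
  also have "\<dots> \<longleftrightarrow> ((\<lambda>t. norm (f t - f a - (t - a) *\<^sub>R d) / norm (t - a)) \<longlongrightarrow> 0) (at a)"
  proof (rule filterlim_cong[OF refl refl])
    show "\<forall>\<^sub>F t in at a. norm ((1 / (t - a)) *\<^sub>R (f t - f a) - d) = norm (f t - f a - (t - a) *\<^sub>R d) / norm (t - a)"
      using eventually_at_ball'[of 1 a UNIV, simplified]
    proof eventually_elim
      case (elim t)
      then have "(1 / (t - a)) *\<^sub>R (f t - f a) - d = (1 / (t - a)) *\<^sub>R (f t - f a - (t - a) *\<^sub>R d)"
        by (simp add: scaleR_diff_right)
      then show ?case by (simp add: divide_inverse mult.commute)
    qed
  qed
  also have "\<dots> \<longleftrightarrow> (f has_vector_derivative d) (at a)"
    by (simp add: has_vector_derivative_def bounded_linear_scaleR_left has_derivative_iff_norm)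
  finally show ?thesis by simp
qed

lemma eventually_at_1_near: "\<forall>\<^sub>F t::real in at 1. t \<in> {1/2<..<2} \<and> t \<noteq> 1"
proof -
  have "\<forall>\<^sub>F t::real in at 1. t \<in> {1/2<..<2}" by (rule eventually_at_in_open') auto
  then show ?thesis using eventually_at_topological by (simp add: eventually_conj_iff eventually_neq_at_within)
qed

text \<open>The derivative inherits boundedness and measurability from the difference quotients.\<close>

lemma dilation_derivative_Linf:
  assumes "dilation_derivative f g"
  shows "f \<in> Linf" "g \<in> Linf"
proof -
  have m: "f \<in> borel_measurable half_line" using assms by (simp add: dilation_derivative_def)
  then show "f \<in> Linf" using assms LinfI by (auto simp: dilation_derivative_def)
  obtain C where C: "\<And>x t. 0 \<le> x \<Longrightarrow> t \<in> {1/2<..<2} \<Longrightarrow> cmod (f (x / t) - f x) \<le> C * \<bar>t - 1\<bar>"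
    using assms unfolding dilation_derivative_def by blast
  have lim: "((\<lambda>t. (1 / (t - 1)) *\<^sub>R (f (x / t) - f x)) \<longlongrightarrow> g x) (at 1)" if "0 \<le> x" "x \<noteq> 1" for x
    using assms that by (auto simp: dilation_derivative_def has_vector_derivative_iff_quotient)
  have bound: "cmod (g x) \<le> max C (cmod (g 1))" if "0 \<le> x" for x
  proof (cases "x = 1")
    case False
    have "cmod (g x) \<le> C"
    proof (rule tendsto_upperbound[OF tendsto_norm[OF lim[OF that False]]])
      show "\<forall>\<^sub>F t in at 1. cmod ((1 / (t - 1)) *\<^sub>R (f (x / t) - f x)) \<le> C"
        using eventually_at_1_near
      proof eventually_elim
        case (elim t)
        then show ?case using C[OF that, of t] by (simp add: divide_simps)
      qed
    qed simp
    then show ?thesis by simp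
  qed simp
  \<comment> \<open>the pointwise limit along a sequence is measurable\<close>
  define s where "s n = 1 + inverse (real (Suc n))" for n
  have "s \<longlonglongrightarrow> 1" unfolding s_def by (rule LIMSEQ_inverse_real_of_nat_add)
  then have s: "filterlim s (at 1) sequentially"
    by (auto simp: filterlim_at s_def)
  have "g \<in> borel_measurable half_line"
  proof (rule borel_measurable_LIMSEQ_metric)
    fix n
    have "0 < s n" by (simp add: s_def add_pos_pos)
    then have "(\<lambda>x. (1 / (s n - 1)) *\<^sub>R (f (x / s n) - f x)) \<in> borel_measurable half_line"
      by (intro borel_measurable_scaleR borel_measurable_diff measurable_dilate m) auto
    moreover have "Measurable.pred half_line (\<lambda>x. x = 1)"
      by (intro measurable_restrict_space1) (simp add: pred_def)
    ultimately show "(\<lambda>x. if x = 1 then g 1 else (1 / (s n - 1)) *\<^sub>R (f (x / s n) - f x)) \<in> borel_measurable half_line"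
      by (intro measurable_If) (auto simp: pred_def)
  next
    fix x assume "x \<in> space half_line"
    then have "0 \<le> x" by simp
    show "(\<lambda>n. if x = 1 then g 1 else (1 / (s n - 1)) *\<^sub>R (f (x / s n) - f x)) \<longlonglongrightarrow> g x"
      using filterlim_compose[OF lim[OF \<open>0 \<le> x\<close>] s] by (cases "x = 1") auto
  qed
  then show "g \<in> Linf" using bound by (rule LinfI)
qed

lemma dilation_derivative_mult:
  assumes "dilation_derivative f f'" "dilation_derivative g g'"
  shows "dilation_derivative (\<lambda>x. f x * g x) (\<lambda>x. f x * g' x + f' x * g x)"
  unfolding dilation_derivative_def
proof (intro conjI)
  show "(\<lambda>x. f x * g x) \<in> borel_measurable half_line"
    using assms by (auto simp: dilation_derivative_def)
  obtain A A' B B' where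
    A: "\<And>x. 0 \<le> x \<Longrightarrow> cmod (f x) \<le> A" and B: "\<And>x. 0 \<le> x \<Longrightarrow> cmod (g x) \<le> B" and
    A': "\<And>x t. 0 \<le> x \<Longrightarrow> t \<in> {1/2<..<2} \<Longrightarrow> cmod (f (x / t) - f x) \<le> A' * \<bar>t - 1\<bar>" and
    B': "\<And>x t. 0 \<le> x \<Longrightarrow> t \<in> {1/2<..<2} \<Longrightarrow> cmod (g (x / t) - g x) \<le> B' * \<bar>t - 1\<bar>"
    using assms unfolding dilation_derivative_def by metis
  have "cmod (f x * g x) \<le> A * B" if "0 \<le> x" for x
    using A[OF that] B[OF that] by (simp add: norm_mult mult_mono')
  then show "\<exists>C. \<forall>x\<ge>0. cmod (f x * g x) \<le> C" by blast
  have "cmod (f (x / t) * g (x / t) - f x * g x) \<le> (A * B' + A' * B) * \<bar>t - 1\<bar>"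
    if x: "0 \<le> x" and t: "t \<in> {1/2<..<2}" for x t
  proof -
    have "f (x / t) * g (x / t) - f x * g x = f (x / t) * (g (x / t) - g x) + (f (x / t) - f x) * g x"
      by (simp add: algebra_simps)
    also have "cmod \<dots> \<le> cmod (f (x / t)) * cmod (g (x / t) - g x) + cmod (f (x / t) - f x) * cmod (g x)"
      by (metis norm_mult norm_triangle_ineq)
    also have "\<dots> \<le> A * (B' * \<bar>t - 1\<bar>) + (A' * \<bar>t - 1\<bar>) * B"
    proof -
      have "cmod (f (x / t)) \<le> A" using A[of "x / t"] x t by simp
      moreover have "0 \<le> A" using A[OF x] norm_ge_zero order_trans by blast
      moreover have "0 \<le> A' * \<bar>t - 1\<bar>" using A'[OF x t] norm_ge_zero order_trans by blast
      ultimately show ?thesis using A'[OF x t] B'[OF x t] B[OF x]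
        by (intro add_mono mult_mono) auto
    qed
    finally show ?thesis by (simp add: algebra_simps)
  qed
  then show "\<exists>C. \<forall>x\<ge>0. \<forall>t\<in>{1/2<..<2}. cmod (f (x / t) * g (x / t) - f x * g x) \<le> C * \<bar>t - 1\<bar>"
    by blast
  show "\<forall>x\<ge>0. x \<noteq> 1 \<longrightarrow> ((\<lambda>t. f (x / t) * g (x / t)) has_vector_derivative f x * g' x + f' x * g x) (at 1)"
    using assms has_vector_derivative_mult[of "\<lambda>t. f (_ / t)" _ 1 UNIV "\<lambda>t. g (_ / t)"]
    by (fastforce simp: dilation_derivative_def)
qed

text \<open>The compact support bounds the factor \<open>x\<close> in \<open>x/t - x = x (1 - t)/t\<close>; differentiability is the
  chain rule.\<close>

lemma dilation_derivative_lipschitz: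
  assumes L: "\<And>x y. 0 \<le> x \<Longrightarrow> 0 \<le> y \<Longrightarrow> cmod (f x - f y) \<le> L * \<bar>x - y\<bar>"
    and supp: "supported_upto r f" and r: "0 < r"
    and d: "\<And>x. 0 \<le> x \<Longrightarrow> x \<noteq> 1 \<Longrightarrow> (f has_vector_derivative f' x) (at x within {0..})"
  shows "dilation_derivative f (\<lambda>x. - of_real x * f' x)"
  unfolding dilation_derivative_def
proof (intro conjI)
  have L0: "0 \<le> L" using L[of 0 1] norm_ge_zero[of "f 0 - f 1"] by (simp del: norm_ge_zero)
  have "L-lipschitz_on {0..} f"
    by (rule lipschitz_onI) (use L L0 in \<open>auto simp: dist_norm\<close>)
  then have "continuous_on {0..} f" by (rule lipschitz_on_continuous_on)
  then show "f \<in> borel_measurable half_line"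
    by (rule continuous_imp_measurable_on_sets_lebesgue) simp
  have "cmod (f x) \<le> L * (r + 1)" if "0 \<le> x" for x
  proof (cases "x \<le> r")
    case True
    have "f (r + 1) = 0" using supp by (simp add: supported_upto_def)
    then have "cmod (f x) \<le> L * \<bar>x - (r + 1)\<bar>" using L[of x "r + 1"] that r by simp
    also have "\<dots> \<le> L * (r + 1)" using True that L0 by (intro mult_left_mono) auto
    finally show ?thesis .
  next
    case False
    then show ?thesis using supp r L0 by (simp add: supported_upto_def)
  qed
  then show "\<exists>C. \<forall>x\<ge>0. cmod (f x) \<le> C" by blast
  have "cmod (f (x / t) - f x) \<le> (4 * r * L) * \<bar>t - 1\<bar>" if x: "0 \<le> x" and t: "t \<in> {1/2<..<2}" for x t
  proof (cases "x \<le> 2 * r")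
    case True
    have "x / t - x = x * (1 - t) / t" using t by (simp add: field_simps)
    then have "\<bar>x / t - x\<bar> = x * \<bar>t - 1\<bar> / t" using x t by (simp add: abs_mult abs_minus_commute)
    also have "\<dots> \<le> (2 * r) * \<bar>t - 1\<bar> / (1/2)"
      using x t True r by (intro frac_le mult_right_mono) auto
    finally have "L * \<bar>x / t - x\<bar> \<le> L * (2 * r * \<bar>t - 1\<bar> / (1/2))" by (rule mult_left_mono) (rule L0)
    moreover have "cmod (f (x / t) - f x) \<le> L * \<bar>x / t - x\<bar>" using L[of "x / t" x] x t by simp
    ultimately show ?thesis by (simp add: algebra_simps)
  next
    case False
    moreover have "r * t < r * 2" using t r by (intro mult_strict_left_mono) auto
    ultimately have "x / t > r" using t by (simp add: pos_less_divide_eq)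
    then show ?thesis using False supp r L0 by (simp add: supported_upto_def)
  qed
  then show "\<exists>C. \<forall>x\<ge>0. \<forall>t\<in>{1/2<..<2}. cmod (f (x / t) - f x) \<le> C * \<bar>t - 1\<bar>" by blast
  show "\<forall>x\<ge>0. x \<noteq> 1 \<longrightarrow> ((\<lambda>t. f (x / t)) has_vector_derivative - of_real x * f' x) (at 1)"
  proof (intro allI impI)
    fix x :: real assume x: "0 \<le> x" "x \<noteq> 1"
    have "((\<lambda>t. x / t) has_vector_derivative - x) (at 1 within {0<..})"
      by (rule has_vector_derivative_at_within)
         (auto intro!: derivative_eq_intros simp: has_real_derivative_iff_has_vector_derivative[symmetric])
    moreover have "(f has_vector_derivative f' x) (at (x / 1) within (\<lambda>t. x / t) ` {0<..})"
    proof -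
      have "(\<lambda>t. x / t) ` {0<..} \<subseteq> {0..}" using x by auto
      from has_vector_derivative_within_subset[OF d[OF x] this] show ?thesis by simp
    qed
    ultimately have "(f \<circ> (\<lambda>t. x / t) has_vector_derivative (- x) *\<^sub>R f' x) (at 1 within {0<..})"
      by (rule vector_diff_chain_within)
    then show "((\<lambda>t. f (x / t)) has_vector_derivative - of_real x * f' x) (at 1)"
      by (simp add: o_def scaleR_conv_of_real at_within_open[of 1 "{0<..}"])
  qed
qed

text \<open>Because \<open>f\<close> vanishes at \<open>1\<close>, its extension by \<open>0\<close> is as Lipschitz as \<open>f\<close> is on \<open>[0,1]\<close>.\<close>

lemma C10_dilation_derivative:
  assumes "f \<in> C10"
  shows "\<exists>g. dilation_derivative f g"
proof -
  obtain f' where f1: "\<And>x. 1 \<le> x \<Longrightarrow> f x = 0" and c: "continuous_on {0..1} f'"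
    and d: "\<And>x. x \<in> {0..1} \<Longrightarrow> (f has_vector_derivative f' x) (at x within {0..1})"
    using assms by (auto simp: C10_def)
  have "bounded (f' ` {0..1})" by (intro compact_imp_bounded compact_continuous_image c) auto
  then obtain L where "\<forall>y\<in>f' ` {0..1}. cmod y \<le> L" unfolding bounded_iff ..
  then have L: "\<And>x. x \<in> {0..1} \<Longrightarrow> cmod (f' x) \<le> L" by simp
  have L0: "0 \<le> L" by (rule order_trans[OF norm_ge_zero L[of 0]]) simp
  have in01: "cmod (f x - f y) \<le> L * \<bar>x - y\<bar>" if "x \<in> {0..1}" "y \<in> {0..1}" for x y
  proof -
    have "norm (f x - f y) \<le> L * norm (x - y)"
    proof (rule differentiable_bound[of "{0..1}" f "\<lambda>x h. h *\<^sub>R f' x"])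
      show "onorm (\<lambda>h. h *\<^sub>R f' x) \<le> L" if "x \<in> {0..1}" for x
        by (rule onorm_le) (use L[OF that] in \<open>simp add: mult_left_mono mult.commute[of L]\<close>)
    qed (use d that in \<open>auto simp: has_vector_derivative_def\<close>)
    then show ?thesis by simp
  qed
  have lip: "cmod (f x - f y) \<le> L * \<bar>x - y\<bar>" if "0 \<le> x" "0 \<le> y" for x y
  proof -
    have min: "f x = f (min x 1)" for x using f1[of x] f1[of 1] by (simp add: min_def)
    have "cmod (f x - f y) \<le> L * \<bar>min x 1 - min y 1\<bar>"
      unfolding min[of x] min[of y] by (rule in01) (use that in auto)
    also have "\<dots> \<le> L * \<bar>x - y\<bar>" using L0 by (intro mult_left_mono) auto
    finally show ?thesis .
  qed
  have "dilation_derivative f (\<lambda>x. - of_real x * (if x < 1 then f' x else 0))"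
  proof (rule dilation_derivative_lipschitz[OF lip])
    show "supported_upto 1 f" using f1 by (simp add: supported_upto_def)
    fix x :: real assume x: "0 \<le> x" "x \<noteq> 1"
    show "(f has_vector_derivative (if x < 1 then f' x else 0)) (at x within {0..})"
    proof (cases "x < 1")
      case True
      have "at x within {0..} = at x within {0..1}"
        by (rule at_within_nhd[of _ "{..<1}"]) (use True in auto)
      then show ?thesis using d[of x] True x by simp
    next
      case False
      have "(f has_vector_derivative 0) (at x)"
        by (rule has_vector_derivative_transform_within_open[of "\<lambda>x. 0" _ _ "{1<..}"])
           (use False x f1 in auto)
      then show ?thesis using False by (simp add: has_vector_derivative_at_within)
    qed
  qed simp_all
  then show ?thesis by blast
qed

lemma Dc_dilation_derivative:
  assumes "f \<in> Dc"
  shows "\<exists>g. dilation_derivative f g"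
proof -
  obtain r f' L where supp: "supported_upto r f" and L: "\<And>x. 0 \<le> x \<Longrightarrow> cmod (f' x) \<le> L"
    and d: "\<And>x. 0 \<le> x \<Longrightarrow> (f has_vector_derivative f' x) (at x within {0..})"
    using assms unfolding Dc_def by blast
  have lip: "cmod (f x - f y) \<le> L * \<bar>x - y\<bar>" if "0 \<le> x" "0 \<le> y" for x y
  proof -
    have "norm (f x - f y) \<le> L * norm (x - y)"
    proof (rule differentiable_bound[of "{0..}" f "\<lambda>x h. h *\<^sub>R f' x"])
      show "onorm (\<lambda>h. h *\<^sub>R f' x) \<le> L" if "x \<in> {0..}" for x
        by (rule onorm_le) (use L that in \<open>simp add: mult_left_mono mult.commute[of L]\<close>)
    qed (use d that in \<open>auto simp: has_vector_derivative_def\<close>)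
    then show ?thesis by simp
  qed
  have supp': "supported_upto (max r 1) f" using supp by (simp add: supported_upto_def)
  have "dilation_derivative f (\<lambda>x. - of_real x * f' x)"
    by (rule dilation_derivative_lipschitz[OF lip supp' _ d]) auto
  then show ?thesis by blast
qed

lemma C10_cnj: "f \<in> C10 \<Longrightarrow> (\<lambda>x. cnj (f x)) \<in> C10"
proof -
  assume "f \<in> C10"
  then obtain f' where "\<And>x. 1 \<le> x \<Longrightarrow> f x = 0" "continuous_on {0..1} f'"
    "\<And>x. x \<in> {0..1} \<Longrightarrow> (f has_vector_derivative f' x) (at x within {0..1})"
    by (auto simp: C10_def)
  then show ?thesis unfolding C10_def
    by (auto intro!: exI[of _ "\<lambda>x. cnj (f' x)"] continuous_intros
        bounded_linear.has_vector_derivative[OF bounded_linear_cnj])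
qed

lemma Dc_cnj: "f \<in> Dc \<Longrightarrow> (\<lambda>x. cnj (f x)) \<in> Dc"
proof -
  assume "f \<in> Dc"
  then obtain r f' L where "supported_upto r f" "\<And>x. 0 \<le> x \<Longrightarrow> cmod (f' x) \<le> L"
    "\<And>x. 0 \<le> x \<Longrightarrow> (f has_vector_derivative f' x) (at x within {0..})"
    unfolding Dc_def by blast
  then have "supported_upto r (\<lambda>x. cnj (f x))" "\<forall>x\<ge>0. cmod (cnj (f' x)) \<le> L \<and>
      ((\<lambda>x. cnj (f x)) has_vector_derivative cnj (f' x)) (at x within {0..})"
    by (auto simp: supported_upto_def intro: bounded_linear.has_vector_derivative[OF bounded_linear_cnj])
  then show ?thesis unfolding Dc_def
    by (intro CollectI conjI exI[of _ r] exI[of _ "\<lambda>x. cnj (f' x)"] exI[of _ L])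
qed


section \<open>Functions that are flat at the end point\<close>

definition bump :: "nat \<Rightarrow> real \<Rightarrow> real" where
  "bump k x = (if x < 1 then exp (- inverse (1 - x)) * inverse (1 - x) ^ k else 0)"

text \<open>The operator \<open>f \<mapsto> -x f'\<close> preserves the boundary condition \<open>f(1) = 0\<close> only on functions that
  vanish to infinite order at \<open>1\<close>. It maps the generator with exponent \<open>k\<close> to a combination of
  generators with exponents \<open>k + 1\<close> and \<open>k + 2\<close>, multiplied by \<open>x\<close>, and hence preserves the algebra.\<close>

inductive_set flat_algebra :: "(real \<Rightarrow> complex) set" where
  bump: "(\<lambda>x. complex_of_real (bump k x)) \<in> flat_algebra"
| ident: "f \<in> flat_algebra \<Longrightarrow> (\<lambda>x. complex_of_real x * f x) \<in> flat_algebra"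
| scale: "f \<in> flat_algebra \<Longrightarrow> (\<lambda>x. c * f x) \<in> flat_algebra"
| add: "f \<in> flat_algebra \<Longrightarrow> g \<in> flat_algebra \<Longrightarrow> (\<lambda>x. f x + g x) \<in> flat_algebra"
| mult: "f \<in> flat_algebra \<Longrightarrow> g \<in> flat_algebra \<Longrightarrow> (\<lambda>x. f x * g x) \<in> flat_algebra"

lemma bump_tendsto_0: "(bump k \<longlongrightarrow> 0) (at 1)"
proof -
  have "((\<lambda>x::real. 1 - x) \<longlongrightarrow> 1 - 1) (at_left 1)" by (intro tendsto_intros)
  then have "filterlim (\<lambda>x::real. 1 - x) (at_right 0) (at_left 1)"
    by (auto simp: filterlim_at eventually_at_filter)
  then have "filterlim (\<lambda>x::real. inverse (1 - x)) at_top (at_left 1)"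
    by (rule filterlim_compose[OF filterlim_inverse_at_top_right])
  from filterlim_compose[OF tendsto_power_div_exp_0 this, of k]
  have "((\<lambda>x::real. inverse (1 - x) ^ k / exp (inverse (1 - x))) \<longlongrightarrow> 0) (at_left 1)" .
  then have "(bump k \<longlongrightarrow> 0) (at_left 1)"
  proof (rule Lim_transform_eventually)
    show "\<forall>\<^sub>F x in at_left 1. inverse (1 - x) ^ k / exp (inverse (1 - x)) = bump k x"
      by (auto simp: eventually_at_filter bump_def exp_minus divide_inverse)
  qed
  moreover have "(bump k \<longlongrightarrow> 0) (at_right 1)"
    by (rule Lim_transform_eventually[OF tendsto_const]) (auto simp: eventually_at_filter bump_def)
  ultimately show ?thesis by (simp add: filterlim_at_split)
qed

text \<open>At \<open>1\<close> the difference quotient of the function with exponent \<open>k\<close> is the negative of the function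
  with exponent \<open>k + 1\<close>, which tends to \<open>0\<close>.\<close>

lemma bump_derivative:
  "(bump k has_real_derivative (real k * bump (k + 1) x - bump (k + 2) x)) (at x)"
proof (cases x "1::real" rule: linorder_cases)
  case less
  have "((\<lambda>x. exp (- inverse (1 - x)) * inverse (1 - x) ^ k) has_real_derivative
      exp (- inverse (1 - x)) * (- (inverse (1 - x) * inverse (1 - x))) * inverse (1 - x) ^ k
      + exp (- inverse (1 - x)) * (real k * (inverse (1 - x) * inverse (1 - x) * inverse (1 - x) ^ (k - 1)))) (at x)"
    by (rule derivative_eq_intros refl | use less in simp)+
  also have "exp (- inverse (1 - x)) * (- (inverse (1 - x) * inverse (1 - x))) * inverse (1 - x) ^ k
      + exp (- inverse (1 - x)) * (real k * (inverse (1 - x) * inverse (1 - x) * inverse (1 - x) ^ (k - 1)))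
      = real k * bump (k + 1) x - bump (k + 2) x"
    using less by (cases k) (simp_all add: bump_def algebra_simps)
  finally have "((\<lambda>x. exp (- inverse (1 - x)) * inverse (1 - x) ^ k) has_real_derivative
      (real k * bump (k + 1) x - bump (k + 2) x)) (at x)" .
  then show ?thesis
    by (rule has_field_derivative_transform_within_open[of _ _ _ "{..<1}"])
       (use less in \<open>auto simp: bump_def\<close>)
next
  case equal
  have "(bump k y - bump k 1) / (y - 1) = - bump (k + 1) y" for y
  proof -
    have "inverse (y - 1) = - inverse (1 - y)" by (simp flip: inverse_minus_eq)
    then show ?thesis by (simp add: bump_def divide_inverse)
  qed
  then have "((\<lambda>y. (bump k y - bump k 1) / (y - 1)) \<longlongrightarrow> 0) (at 1)"
    using tendsto_minus[OF bump_tendsto_0, of "k + 1"] by simp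
  then show ?thesis using equal by (simp add: has_field_derivative_iff bump_def)
next
  case greater
  have "((\<lambda>x. 0) has_real_derivative (real k * bump (k + 1) x - bump (k + 2) x)) (at x)"
    using greater by (simp add: bump_def)
  then show ?thesis
    by (rule has_field_derivative_transform_within_open[of _ _ _ "{1<..}"])
       (use greater in \<open>auto simp: bump_def\<close>)
qed

lemma continuous_bump: "continuous_on S (bump k)"
  by (meson DERIV_continuous bump_derivative continuous_at_imp_continuous_on)

lemma flat_algebra_supp: "f \<in> flat_algebra \<Longrightarrow> 1 \<le> x \<Longrightarrow> f x = 0"
  by (induction rule: flat_algebra.induct) (auto simp: bump_def)

lemma flat_algebra_derivative:
  assumes "f \<in> flat_algebra"
  shows "\<exists>f'. continuous_on UNIV f' \<and> (\<forall>x. (f has_vector_derivative f' x) (at x)) \<and>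
     (\<lambda>x. - of_real x * f' x) \<in> flat_algebra"
  using assms
proof induction
  case (bump k)
  let ?b = "\<lambda>k x. complex_of_real (bump k x)"
  show ?case
  proof (intro exI[of _ "\<lambda>x. of_real (real k * bump (k + 1) x - bump (k + 2) x)"] conjI allI)
    show "continuous_on UNIV (\<lambda>x. complex_of_real (real k * bump (k + 1) x - bump (k + 2) x))"
      by (intro continuous_intros continuous_bump)
    show "(?b k has_vector_derivative of_real (real k * bump (k + 1) x - bump (k + 2) x)) (at x)" for x
      by (rule has_vector_derivative_of_real)
         (use bump_derivative in \<open>simp add: has_real_derivative_iff_has_vector_derivative\<close>)
    have "(\<lambda>x. of_real x * ((- of_real k) * ?b (k + 1) x + 1 * ?b (k + 2) x)) \<in> flat_algebra"
      by (intro flat_algebra.intros)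
    moreover have "(\<lambda>x. of_real x * ((- of_real k) * ?b (k + 1) x + 1 * ?b (k + 2) x))
        = (\<lambda>x. - of_real x * of_real (real k * bump (k + 1) x - bump (k + 2) x))"
      by (rule ext) (simp add: algebra_simps)
    ultimately show "(\<lambda>x. - of_real x * of_real (real k * bump (k + 1) x - bump (k + 2) x)) \<in> flat_algebra"
      by simp
  qed
next
  case (ident f)
  then obtain f' where c: "continuous_on UNIV f'" and d: "\<And>x. (f has_vector_derivative f' x) (at x)"
    and a: "(\<lambda>x. - of_real x * f' x) \<in> flat_algebra" by blast
  have cf: "continuous_on UNIV f"
    using d by (meson continuous_at_imp_continuous_on has_vector_derivative_continuous)
  show ?case
  proof (intro exI[of _ "\<lambda>x. of_real x * f' x + f x"] conjI allI)
    show "continuous_on UNIV (\<lambda>x. of_real x * f' x + f x)" by (intro continuous_intros c cf)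
    have "(of_real has_vector_derivative (1::complex)) (at x)" for x
      using has_vector_derivative_of_real[OF DERIV_ident] by simp
    from has_vector_derivative_mult[OF this d]
    show "((\<lambda>x. of_real x * f x) has_vector_derivative of_real x * f' x + f x) (at x)" for x by simp
    have "(\<lambda>x. of_real x * (- of_real x * f' x) + (- 1) * (of_real x * f x)) \<in> flat_algebra"
      by (intro flat_algebra.intros a ident.hyps)
    then show "(\<lambda>x. - of_real x * (of_real x * f' x + f x)) \<in> flat_algebra"
      by (simp add: algebra_simps)
  qed
next
  case (scale f k)
  then obtain f' where c: "continuous_on UNIV f'" and d: "\<And>x. (f has_vector_derivative f' x) (at x)"
    and a: "(\<lambda>x. - of_real x * f' x) \<in> flat_algebra" by blast
  show ?case
  proof (intro exI[of _ "\<lambda>x. k * f' x"] conjI allI)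
    show "continuous_on UNIV (\<lambda>x. k * f' x)" by (intro continuous_intros c)
    show "((\<lambda>x. k * f x) has_vector_derivative k * f' x) (at x)" for x
      by (intro has_vector_derivative_mult_right d)
    show "(\<lambda>x. - of_real x * (k * f' x)) \<in> flat_algebra"
      using flat_algebra.scale[OF a, of k] by (simp add: algebra_simps)
  qed
next
  case (add f g)
  from add.IH(1) obtain f' where f: "continuous_on UNIV f'"
    "\<And>x. (f has_vector_derivative f' x) (at x)" "(\<lambda>x. - of_real x * f' x) \<in> flat_algebra" by blast
  from add.IH(2) obtain g' where g: "continuous_on UNIV g'"
    "\<And>x. (g has_vector_derivative g' x) (at x)" "(\<lambda>x. - of_real x * g' x) \<in> flat_algebra" by blast
  note c = f(1) g(1) and d = f(2) g(2) and a = f(3) g(3)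
  show ?case
  proof (intro exI[of _ "\<lambda>x. f' x + g' x"] conjI allI)
    show "continuous_on UNIV (\<lambda>x. f' x + g' x)" by (intro continuous_intros c)
    show "((\<lambda>x. f x + g x) has_vector_derivative f' x + g' x) (at x)" for x
      by (intro has_vector_derivative_add d)
    show "(\<lambda>x. - of_real x * (f' x + g' x)) \<in> flat_algebra"
      using flat_algebra.add[OF a] by (simp add: algebra_simps)
  qed
next
  case (mult f g)
  from mult.IH(1) obtain f' where f: "continuous_on UNIV f'"
    "\<And>x. (f has_vector_derivative f' x) (at x)" "(\<lambda>x. - of_real x * f' x) \<in> flat_algebra" by blast
  from mult.IH(2) obtain g' where g: "continuous_on UNIV g'"
    "\<And>x. (g has_vector_derivative g' x) (at x)" "(\<lambda>x. - of_real x * g' x) \<in> flat_algebra" by blast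
  note c = f(1) g(1) and d = f(2) g(2) and a = f(3) g(3)
  have cf: "continuous_on UNIV f" "continuous_on UNIV g"
    using d by (meson continuous_at_imp_continuous_on has_vector_derivative_continuous)+
  show ?case
  proof (intro exI[of _ "\<lambda>x. f x * g' x + f' x * g x"] conjI allI)
    show "continuous_on UNIV (\<lambda>x. f x * g' x + f' x * g x)" by (intro continuous_intros c cf)
    show "((\<lambda>x. f x * g x) has_vector_derivative f x * g' x + f' x * g x) (at x)" for x
      by (intro has_vector_derivative_mult d)
    have "(\<lambda>x. f x * (- of_real x * g' x) + (- of_real x * f' x) * g x) \<in> flat_algebra"
      by (intro flat_algebra.add flat_algebra.mult a mult.hyps)
    then show "(\<lambda>x. - of_real x * (f x * g' x + f' x * g x)) \<in> flat_algebra"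
      by (simp add: algebra_simps)
  qed
qed

lemma flat_algebra_C10:
  assumes "f \<in> flat_algebra"
  shows "f \<in> C10"
proof -
  obtain f' where "continuous_on UNIV f'" "\<And>x. (f has_vector_derivative f' x) (at x)"
    using flat_algebra_derivative[OF assms] by blast
  then have "continuous_on {0..1} f'" "\<forall>x\<in>{0..1}. (f has_vector_derivative f' x) (at x within {0..1})"
    by (auto intro: continuous_on_subset has_vector_derivative_at_within)
  then show ?thesis unfolding C10_def using flat_algebra_supp[OF assms] by blast
qed

lemma flat_algebra_dilate_Dc:
  assumes "f \<in> flat_algebra" "0 < r"
  shows "dilate r f \<in> Dc"
proof -
  obtain f' where c: "continuous_on UNIV f'" and d: "\<And>x. (f has_vector_derivative f' x) (at x)"
    using flat_algebra_derivative[OF assms(1)] by blast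
  have "bounded (f' ` {0..1})"
    by (intro compact_imp_bounded compact_continuous_image continuous_on_subset[OF c]) auto
  then obtain L where "\<forall>y\<in>f' ` {0..1}. cmod y \<le> L" unfolding bounded_iff ..
  then have L: "\<And>x. x \<in> {0..1} \<Longrightarrow> cmod (f' x) \<le> L" by simp
  have f0: "f' x = 0" if "1 < x" for x
  proof -
    have "(f has_vector_derivative 0) (at x)"
      by (rule has_vector_derivative_transform_within_open[of "\<lambda>x. 0" _ _ "{1<..}"])
         (use that flat_algebra_supp[OF assms(1)] in auto)
    then show ?thesis using d vector_derivative_unique_at by blast
  qed
  have L0: "0 \<le> L" by (rule order_trans[OF norm_ge_zero L[of 0]]) simp
  have L': "cmod (f' x) \<le> L" if "0 \<le> x" for x
    using L[of x] f0[of x] that L0 by (cases "x \<le> 1") auto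
  have "(dilate r f has_vector_derivative (1 / r) *\<^sub>R f' (x / r)) (at x)" for x
  proof -
    have "((\<lambda>x. x / r) has_vector_derivative 1 / r) (at x)"
      using assms(2) by (auto intro!: derivative_eq_intros simp: has_real_derivative_iff_has_vector_derivative[symmetric])
    from vector_diff_chain_at[OF this d] show ?thesis by (simp add: o_def)
  qed
  moreover have "cmod ((1 / r) *\<^sub>R f' (x / r)) \<le> L / r" if "0 \<le> x" for x
    using L'[of "x / r"] that assms(2) by (simp add: divide_right_mono)
  moreover have "supported_upto r (dilate r f)"
    using flat_algebra_supp[OF assms(1)] assms(2) by (simp add: supported_upto_def)
  ultimately show ?thesis unfolding Dc_def
    by (intro CollectI conjI exI[of _ r] exI[of _ "\<lambda>x. (1 / r) *\<^sub>R f' (x / r)"] exI[of _ "L / r"] allI impI)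
       (auto intro: has_vector_derivative_at_within)
qed

lemma flat_algebra_dilation_derivative:
  assumes "f \<in> flat_algebra"
  shows "\<exists>g\<in>flat_algebra. dilation_derivative f g"
proof -
  obtain f' where d: "\<And>x. (f has_vector_derivative f' x) (at x)"
    and a: "(\<lambda>x. - of_real x * f' x) \<in> flat_algebra"
    using flat_algebra_derivative[OF assms] by blast
  obtain g where g: "dilation_derivative f g" using C10_dilation_derivative[OF flat_algebra_C10[OF assms]] ..
  have "((\<lambda>t. f (x / t)) has_vector_derivative - of_real x * f' x) (at 1)" for x
  proof -
    have "((\<lambda>t. x / t) has_vector_derivative - x) (at 1)"
      by (auto intro!: derivative_eq_intros simp: has_real_derivative_iff_has_vector_derivative[symmetric])
    from vector_diff_chain_at[OF this d] show ?thesis by (simp add: o_def scaleR_conv_of_real)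
  qed
  then have "dilation_derivative f (\<lambda>x. - of_real x * f' x)"
    using g by (simp add: dilation_derivative_def)
  then show ?thesis using a by blast
qed

lemma flat_algebra_polynomial:
  assumes "real_polynomial_function p" "f \<in> flat_algebra"
  shows "(\<lambda>x. complex_of_real (p x) * f x) \<in> flat_algebra"
  using assms
proof (induction arbitrary: f)
  case (linear p)
  then interpret bounded_linear p by simp
  have p: "p x = p 1 * x" for x using scaleR[of x 1] by simp
  show ?case using flat_algebra.scale[OF flat_algebra.ident[OF linear.prems], of "of_real (p 1)"]
    by (subst p) (simp add: mult.assoc)
next
  case (const c)
  then show ?case by (rule flat_algebra.scale)
next
  case (add p q)
  from flat_algebra.add[OF add.IH(1)[OF add.prems] add.IH(2)[OF add.prems]] show ?case
    by (simp add: algebra_simps)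
next
  case (mult p q)
  from mult.IH(1)[OF mult.IH(2)[OF mult.prems]] show ?case by (simp add: algebra_simps)
qed

text \<open>These functions have values in \<open>[0,1]\<close> and increase to \<open>1\<close> on \<open>[0,1)\<close>; they turn polynomials into
  elements of the algebra.\<close>

lemma flat_algebra_cutoff: "(\<lambda>x. complex_of_real (1 - (1 - bump 0 x) ^ n)) \<in> flat_algebra"
proof (induction n)
  case 0
  show ?case using flat_algebra.scale[OF flat_algebra.bump, of 0] by simp
next
  case (Suc n)
  let ?c = "\<lambda>n x. complex_of_real (1 - (1 - bump 0 x) ^ n)" and ?b = "\<lambda>x. complex_of_real (bump 0 x)"
  have "(\<lambda>x. ?c n x + (?b x + (-1) * (?c n x * ?b x))) \<in> flat_algebra"
    by (intro flat_algebra.add flat_algebra.scale flat_algebra.mult flat_algebra.bump Suc)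
  moreover have "(\<lambda>x. ?c n x + (?b x + (-1) * (?c n x * ?b x))) = ?c (Suc n)"
    by (rule ext) (simp add: algebra_simps)
  ultimately show ?case by simp
qed

text \<open>A bounded measurable function is an almost everywhere limit of continuous functions, which may be
  truncated to a fixed bound; these are uniformly close to polynomials on \<open>[0,1]\<close>, and the cutoffs
  bring the polynomials into the algebra. Bounded convergence almost everywhere serves both the strong
  operator topology and the weak* topology.\<close>

lemma flat_algebra_approximation:
  assumes "f \<in> Linf" "supported_upto 1 f"
  obtains C g where "\<And>n. g n \<in> flat_algebra" "\<And>n x. 0 \<le> x \<Longrightarrow> cmod (g n x) \<le> C"
    "AE x in half_line. (\<lambda>n. g n x) \<longlonglongrightarrow> f x"
proof -
  obtain C0 where "AE x in half_line. cmod (f x) \<le> C0" and m: "f \<in> borel_measurable half_line"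
    using assms(1) by (auto simp: Linf_def)
  define C where "C = max C0 1"
  have C: "AE x in half_line. cmod (f x) \<le> C" "0 < C"
    using \<open>AE x in half_line. cmod (f x) \<le> C0\<close> unfolding C_def by (eventually_elim, auto)
  have "f measurable_on {0..}" using m by (simp add: measurable_on_iff_borel_measurable)
  then obtain N G where N: "negligible N" and G: "\<And>n. continuous_on UNIV (G n)"
    and lim: "\<And>x. x \<notin> N \<Longrightarrow> (\<lambda>n. G n x) \<longlonglongrightarrow> (if x \<in> {0..} then f x else 0)"
    by (auto simp: measurable_on_def)
  \<comment> \<open>radial truncation to the disc of radius \<open>C\<close>\<close>
  define cl where "cl z = of_real (C / max C (cmod z)) * z" for z
  have max0: "max C (cmod z) \<noteq> 0" for z using less_le_trans[OF C(2) max.cobounded1[of C "cmod z"]] by simp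
  have cl_cont: "continuous_on UNIV cl" unfolding cl_def
    by (intro continuous_intros) (use max0 in auto)
  have cl_le: "cmod (cl z) \<le> C" for z
  proof -
    have "cmod (cl z) = C * (cmod z / max C (cmod z))"
      using C(2) max0[of z] by (simp add: cl_def norm_mult norm_divide del: of_real_divide)
    also have "\<dots> \<le> C * 1" using C(2) by (intro mult_left_mono) (auto simp: divide_le_eq_1 max_def)
    finally show ?thesis by simp
  qed
  have cl_id: "cl z = z" if "cmod z \<le> C" for z using that C(2) by (simp add: cl_def max_def)
  have "\<exists>p. polynomial_function p \<and> (\<forall>x\<in>{0..1}. cmod (cl (G n x) - p x) < 1 / real (Suc n))" for n
    by (rule Stone_Weierstrass_polynomial_function)
       (auto intro!: continuous_on_compose2[OF cl_cont] continuous_on_subset[OF G])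
  then obtain p where p: "\<And>n. polynomial_function (p n)"
    and pa: "\<And>n x. x \<in> {0..1} \<Longrightarrow> cmod (cl (G n x) - p n x) < 1 / real (Suc n)" by metis
  define c where "c n x = 1 - (1 - bump 0 x) ^ n" for n x
  have b01: "0 \<le> bump 0 x" "bump 0 x \<le> 1" for x by (auto simp: bump_def)
  have c01: "0 \<le> c n x" "c n x \<le> 1" for n x
    using b01[of x] by (auto simp: c_def power_le_one)
  define g where "g n x = p n x * of_real (c n x)" for n x
  show thesis
  proof (rule that[of g "C + 1"])
    fix n
    let ?c = "\<lambda>x. complex_of_real (c n x)"
    have r: "real_polynomial_function (\<lambda>x. Re (p n x))" "real_polynomial_function (\<lambda>x. Im (p n x))"
      using p[of n] bounded_linear_Re bounded_linear_Im by (auto simp: polynomial_function_def o_def)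
    have "?c \<in> flat_algebra" using flat_algebra_cutoff by (simp add: c_def)
    then have "(\<lambda>x. of_real (Re (p n x)) * ?c x + \<i> * (of_real (Im (p n x)) * ?c x)) \<in> flat_algebra"
      by (intro flat_algebra.add flat_algebra.scale flat_algebra_polynomial r)
    moreover have "(\<lambda>x. of_real (Re (p n x)) * ?c x + \<i> * (of_real (Im (p n x)) * ?c x)) = g n"
      by (rule ext) (simp add: g_def complex_eq_iff)
    ultimately show "g n \<in> flat_algebra" by simp
    fix x :: real assume "0 \<le> x"
    show "cmod (g n x) \<le> C + 1"
    proof (cases "x < 1")
      case True
      have "cmod (p n x) \<le> cmod (cl (G n x)) + cmod (cl (G n x) - p n x)"
        by (metis norm_minus_commute norm_triangle_sub)
      also have "\<dots> \<le> C + 1"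
        using cl_le[of "G n x"] pa[of x n] \<open>0 \<le> x\<close> True
        by (intro add_mono) (auto intro: order_trans[OF less_imp_le])
      finally have "cmod (p n x) \<le> C + 1" .
      then have "cmod (p n x) * c n x \<le> (C + 1) * 1"
        using c01[of n x] C(2) by (intro mult_mono) auto
      then show ?thesis using c01[of n x] by (simp add: g_def norm_mult)
    next
      case False
      then show ?thesis using C(2) by (simp add: g_def c_def bump_def)
    qed
  next
    have "AE x in lebesgue. x \<notin> N" by (rule AE_not_in) (use N negligible_iff_null_sets in blast)
    then have "AE x in half_line. x \<notin> N" unfolding AE_half_line by eventually_elim simp
    with C(1) AE_half_line_neq[of 1] AE_space[of half_line]
    show "AE x in half_line. (\<lambda>n. g n x) \<longlonglongrightarrow> f x"
    proof eventually_elim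
      case (elim x)
      show ?case
      proof (cases "x < 1")
        case True
        have x: "x \<in> {0..1}" using elim True by auto
        have "(\<lambda>n. cl (G n x)) \<longlonglongrightarrow> cl (f x)"
        proof (rule isCont_tendsto_compose[of _ cl])
          show "isCont cl (f x)" using cl_cont by (simp add: continuous_on_eq_continuous_at)
          show "(\<lambda>n. G n x) \<longlonglongrightarrow> f x" using lim[of x] elim by auto
        qed
        moreover have "cl (f x) = f x" using elim by (intro cl_id)
        moreover have "(\<lambda>n. cl (G n x) - p n x) \<longlonglongrightarrow> 0"
        proof (rule tendsto_0_le[where K = 1])
          show "(\<lambda>n. 1 / real (Suc n)) \<longlonglongrightarrow> 0"
            using LIMSEQ_inverse_real_of_nat by (simp add: inverse_eq_divide)
          show "\<forall>\<^sub>F n in sequentially. norm (cl (G n x) - p n x) \<le> norm (1 / real (Suc n)) * 1"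
            using pa[OF x] by (intro always_eventually) (simp add: less_imp_le)
        qed
        ultimately have "(\<lambda>n. cl (G n x) - (cl (G n x) - p n x)) \<longlonglongrightarrow> f x - 0"
          by (intro tendsto_diff) auto
        then have plim: "(\<lambda>n. p n x) \<longlonglongrightarrow> f x" by simp
        have "(\<lambda>n. (1 - bump 0 x) ^ n) \<longlonglongrightarrow> 0"
        proof (rule LIMSEQ_power_zero)
          have "0 < bump 0 x" using True by (simp add: bump_def)
          then show "norm (1 - bump 0 x) < 1" using b01[of x] by simp
        qed
        then have "(\<lambda>n. complex_of_real (c n x)) \<longlonglongrightarrow> of_real (1 - 0)"
          unfolding c_def by (intro tendsto_of_real tendsto_diff tendsto_const)
        from tendsto_mult[OF plim this] show ?thesis by (simp add: g_def)
      next
        case False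
        then show ?thesis using assms(2) elim by (simp add: g_def c_def bump_def supported_upto_def)
      qed
    qed
  qed
qed


section \<open>Strong derivatives of operator valued functions\<close>

text \<open>Local boundedness is part of the definition because multiplication of operators is strongly
  continuous only on bounded sets.\<close>

definition strong_derivative ::
  "(real \<Rightarrow> 'h::complex_hilbert_space \<Rightarrow>\<^sub>L 'h) \<Rightarrow> ('h \<Rightarrow>\<^sub>L 'h) \<Rightarrow> bool" where
  "strong_derivative A a \<longleftrightarrow> (\<exists>C. \<forall>\<^sub>F t in at 1. norm (A t) \<le> C) \<and>
     (\<forall>\<xi>. ((\<lambda>t. blinfun_apply (A t) \<xi>) has_vector_derivative blinfun_apply a \<xi>) (at 1))"

lemma strong_derivativeD:
  "strong_derivative A a \<Longrightarrow> ((\<lambda>t. blinfun_apply (A t) \<xi>) has_vector_derivative blinfun_apply a \<xi>) (at 1)"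
  by (simp add: strong_derivative_def)

lemma strong_derivative_tendsto:
  "strong_derivative A a \<Longrightarrow> ((\<lambda>t. blinfun_apply (A t) \<xi>) \<longlongrightarrow> blinfun_apply (A 1) \<xi>) (at 1)"
  using has_vector_derivative_continuous[OF strong_derivativeD] by (simp add: isCont_def)

lemma strong_derivative_cong:
  assumes "strong_derivative A a" "\<forall>\<^sub>F t in at 1. A t = B t" "A 1 = B 1"
  shows "strong_derivative B a"
  unfolding strong_derivative_def
proof (intro conjI allI)
  obtain C where "\<forall>\<^sub>F t in at 1. norm (A t) \<le> C" using assms(1) by (auto simp: strong_derivative_def)
  with assms(2) have "\<forall>\<^sub>F t in at 1. norm (B t) \<le> C" by eventually_elim simp
  then show "\<exists>C. \<forall>\<^sub>F t in at 1. norm (B t) \<le> C" ..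
  fix \<xi>
  have "((\<lambda>t. (1 / (t - 1)) *\<^sub>R (blinfun_apply (A t) \<xi> - blinfun_apply (A 1) \<xi>)) \<longlongrightarrow> blinfun_apply a \<xi>) (at 1)"
    using strong_derivativeD[OF assms(1)] by (simp add: has_vector_derivative_iff_quotient)
  then have "((\<lambda>t. (1 / (t - 1)) *\<^sub>R (blinfun_apply (B t) \<xi> - blinfun_apply (B 1) \<xi>)) \<longlongrightarrow> blinfun_apply a \<xi>) (at 1)"
    by (rule Lim_transform_eventually) (use assms(2) in \<open>eventually_elim, simp add: assms(3)\<close>)
  then show "((\<lambda>t. blinfun_apply (B t) \<xi>) has_vector_derivative blinfun_apply a \<xi>) (at 1)"
    by (simp add: has_vector_derivative_iff_quotient)
qed

lemma strong_derivative_const: "strong_derivative (\<lambda>t. a) 0"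
  by (auto simp: strong_derivative_def)

lemma strong_derivative_add:
  assumes "strong_derivative A a" "strong_derivative B b"
  shows "strong_derivative (\<lambda>t. A t + B t) (a + b)"
  unfolding strong_derivative_def
proof (intro conjI allI)
  obtain C D where "\<forall>\<^sub>F t in at 1. norm (A t) \<le> C" "\<forall>\<^sub>F t in at 1. norm (B t) \<le> D"
    using assms by (auto simp: strong_derivative_def)
  then have "\<forall>\<^sub>F t in at 1. norm (A t + B t) \<le> C + D" by eventually_elim (rule norm_triangle_mono)
  then show "\<exists>C. \<forall>\<^sub>F t in at 1. norm (A t + B t) \<le> C" ..
  show "((\<lambda>t. blinfun_apply (A t + B t) \<xi>) has_vector_derivative blinfun_apply (a + b) \<xi>) (at 1)" for \<xi>
    unfolding blinfun.add_left
    by (intro has_vector_derivative_add strong_derivativeD assms)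
qed

lemma strong_derivative_compose:
  assumes "strong_derivative A a" "strong_derivative B b"
  shows "strong_derivative (\<lambda>t. A t o\<^sub>L B t) ((a o\<^sub>L B 1) + (A 1 o\<^sub>L b))"
  unfolding strong_derivative_def
proof (intro conjI allI)
  obtain C D where C: "\<forall>\<^sub>F t in at 1. norm (A t) \<le> C" and D: "\<forall>\<^sub>F t in at 1. norm (B t) \<le> D"
    using assms by (auto simp: strong_derivative_def)
  from C D have "\<forall>\<^sub>F t in at 1. norm (A t o\<^sub>L B t) \<le> C * D"
    by eventually_elim (rule order_trans[OF norm_blinfun_compose], simp add: mult_mono')
  then show "\<exists>C. \<forall>\<^sub>F t in at 1. norm (A t o\<^sub>L B t) \<le> C" ..
  fix \<xi>
  let ?q = "\<lambda>F t \<xi>. (1 / (t - 1)) *\<^sub>R (blinfun_apply (F t) \<xi> - blinfun_apply (F 1) \<xi>)"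
  have qA: "((\<lambda>t. ?q A t \<eta>) \<longlongrightarrow> blinfun_apply a \<eta>) (at 1)"
    and qB: "((\<lambda>t. ?q B t \<eta>) \<longlongrightarrow> blinfun_apply b \<eta>) (at 1)" for \<eta>
    using assms[THEN strong_derivativeD] by (simp_all add: has_vector_derivative_iff_quotient)
  have "((\<lambda>t. blinfun_apply (A t) (?q B t \<xi> - blinfun_apply b \<xi>)) \<longlongrightarrow> 0) (at 1)"
  proof (rule tendsto_0_le[where K = C])
    show "((\<lambda>t. ?q B t \<xi> - blinfun_apply b \<xi>) \<longlongrightarrow> 0) (at 1)" using qB by (rule LIM_zero)
    show "\<forall>\<^sub>F t in at 1. norm (blinfun_apply (A t) (?q B t \<xi> - blinfun_apply b \<xi>))
        \<le> norm (?q B t \<xi> - blinfun_apply b \<xi>) * C"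
      using C
    proof eventually_elim
      case (elim t)
      then show ?case
        by (subst mult.commute) (rule order_trans[OF norm_blinfun], rule mult_right_mono, simp_all)
    qed
  qed
  from tendsto_add[OF tendsto_add[OF this strong_derivative_tendsto[OF assms(1), of "blinfun_apply b \<xi>"]] qA]
  have "((\<lambda>t. blinfun_apply (A t) (?q B t \<xi> - blinfun_apply b \<xi>) + blinfun_apply (A t) (blinfun_apply b \<xi>)
      + ?q A t (blinfun_apply (B 1) \<xi>)) \<longlongrightarrow> 0 + blinfun_apply (A 1) (blinfun_apply b \<xi>)
      + blinfun_apply a (blinfun_apply (B 1) \<xi>)) (at 1)" .
  moreover have "blinfun_apply (A t) (?q B t \<xi> - blinfun_apply b \<xi>) + blinfun_apply (A t) (blinfun_apply b \<xi>)
      + ?q A t (blinfun_apply (B 1) \<xi>) = ?q (\<lambda>t. A t o\<^sub>L B t) t \<xi>" for t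
    by (simp add: blinfun.diff_right blinfun.scaleR_right scaleR_diff_right)
  ultimately show "((\<lambda>t. blinfun_apply (A t o\<^sub>L B t) \<xi>) has_vector_derivative
      blinfun_apply ((a o\<^sub>L B 1) + (A 1 o\<^sub>L b)) \<xi>) (at 1)"
    by (simp add: has_vector_derivative_iff_quotient blinfun.add_left add.commute)
qed

lemma strong_derivative_scaleR:
  assumes "(s has_real_derivative s') (at 1)" "strong_derivative A a"
  shows "strong_derivative (\<lambda>t. s t *\<^sub>R A t) (s' *\<^sub>R A 1 + s 1 *\<^sub>R a)"
proof -
  have "strong_derivative (\<lambda>t. s t *\<^sub>R id_blinfun :: 'a \<Rightarrow>\<^sub>L 'a) (s' *\<^sub>R id_blinfun)"
    unfolding strong_derivative_def
  proof (intro conjI allI exI)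
    have "(s \<longlongrightarrow> s 1) (at 1)" using DERIV_isCont[OF assms(1)] by (simp add: isCont_def)
    then have "\<forall>\<^sub>F t in at 1. dist (s t) (s 1) < 1" by (rule tendstoD) simp
    then show "\<forall>\<^sub>F t in at 1. norm (s t *\<^sub>R id_blinfun :: 'a \<Rightarrow>\<^sub>L 'a) \<le> (\<bar>s 1\<bar> + 1) * norm (id_blinfun :: 'a \<Rightarrow>\<^sub>L 'a)"
      by eventually_elim (auto simp: dist_real_def intro!: mult_right_mono)
    have "(s has_vector_derivative s') (at 1)"
      using assms(1) by (simp add: has_real_derivative_iff_has_vector_derivative)
    from bounded_linear.has_vector_derivative[OF bounded_linear_scaleR_left this]
    show "((\<lambda>t. blinfun_apply (s t *\<^sub>R id_blinfun) \<xi>) has_vector_derivative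
        blinfun_apply (s' *\<^sub>R id_blinfun) (\<xi> :: 'a)) (at 1)" for \<xi>
      by (simp add: blinfun.scaleR_left)
  qed
  from strong_derivative_compose[OF this assms(2)] show ?thesis
    by (simp add: scaleR_scaleC blinfun_compose_scaleC_left id_blinfun_compose)
qed


lemma closure_add:
  fixes S :: "'a::real_normed_vector set"
  assumes "\<And>x y. x \<in> S \<Longrightarrow> y \<in> S \<Longrightarrow> x + y \<in> S" "x \<in> closure S" "y \<in> closure S"
  shows "x + y \<in> closure S"
proof -
  obtain u v where "\<forall>n. u n \<in> S" "u \<longlonglongrightarrow> x" "\<forall>n. v n \<in> S" "v \<longlonglongrightarrow> y"
    using assms(2,3) by (auto simp: closure_sequential)
  then have "\<forall>n. u n + v n \<in> S" "(\<lambda>n. u n + v n) \<longlonglongrightarrow> x + y"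
    using assms(1) by (auto intro: tendsto_add)
  then show ?thesis unfolding closure_sequential by (intro exI[of _ "\<lambda>n. u n + v n"]) simp
qed

lemma closure_bounded_linear_image:
  assumes "bounded_linear f" "\<And>x. x \<in> S \<Longrightarrow> f x \<in> closure T" "x \<in> closure S"
  shows "f x \<in> closure T"
proof -
  have "f ` closure S \<subseteq> closure T"
    by (rule image_closure_subset) (use assms in \<open>auto intro: linear_continuous_on\<close>)
  then show ?thesis using assms(3) by blast
qed


section \<open>The von Neumann algebra and its trace\<close>

locale dilated_semicircular =
  infinite_semicircular \<iota> X Tr + standard_representation "sc_algebra \<iota> X" Tr \<Lambda>
  for \<iota> :: "(real \<Rightarrow> complex) \<Rightarrow> 'h::complex_hilbert_space \<Rightarrow>\<^sub>L 'h"
    and X :: "real \<Rightarrow> 'h \<Rightarrow>\<^sub>L 'h"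
    and Tr :: "('h \<Rightarrow>\<^sub>L 'h) \<Rightarrow> ennreal"
    and \<Lambda> :: "('h \<Rightarrow>\<^sub>L 'h) \<Rightarrow> 'h" +
  fixes \<alpha> :: "real \<Rightarrow> ('h \<Rightarrow>\<^sub>L 'h) \<Rightarrow> ('h \<Rightarrow>\<^sub>L 'h)"
  assumes dilation: "dilation_action \<iota> X \<alpha>"
begin

abbreviation "M \<equiv> sc_algebra \<iota> X"
abbreviation "gens \<equiv> \<iota> ` Linf \<union> X ` {0<..}"
abbreviation cut where "cut \<equiv> chi \<iota>"

sublocale trace: nsf_trace M Tr
  by (rule trace)

lemma gens_adj: "b \<in> gens \<Longrightarrow> b \<in> bounded_ops \<and> adj b \<in> gens"
  using embed_op X_op X_selfadjoint by (auto simp: embed_cnj[symmetric] Linf_cnj)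

lemma commutant_gens_adj: "b \<in> commutant gens \<Longrightarrow> b \<in> bounded_ops \<and> adj b \<in> commutant gens"
  by (meson commutant_adj commutant_bounded gens_adj)

lemma M_bounded: "a \<in> M \<Longrightarrow> a \<in> bounded_ops"
  unfolding sc_algebra_def generated_vN_def by (rule commutant_bounded)

lemma M_id: "id_blinfun \<in> M"
  unfolding sc_algebra_def generated_vN_def by (rule commutant_id)

lemma M_add: "a \<in> M \<Longrightarrow> b \<in> M \<Longrightarrow> a + b \<in> M"
  unfolding sc_algebra_def generated_vN_def by (rule commutant_add)

lemma M_scaleC: "a \<in> M \<Longrightarrow> c *\<^sub>C a \<in> M"
  unfolding sc_algebra_def generated_vN_def
  by (rule commutant_scaleC) (auto dest: commutant_bounded)

lemma M_scaleR: "a \<in> M \<Longrightarrow> r *\<^sub>R a \<in> M"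
  by (simp add: scaleR_scaleC M_scaleC)

lemma M_diff: "a \<in> M \<Longrightarrow> b \<in> M \<Longrightarrow> a - b \<in> M"
  using M_add[OF _ M_scaleR[of b "-1"], of a] by simp

lemma M_compose: "a \<in> M \<Longrightarrow> b \<in> M \<Longrightarrow> a o\<^sub>L b \<in> M"
  unfolding sc_algebra_def generated_vN_def by (rule commutant_compose)

lemma M_adj: "a \<in> M \<Longrightarrow> adj a \<in> M"
  unfolding sc_algebra_def generated_vN_def by (rule commutant_adj[OF _ commutant_gens_adj])

lemma M_gens: "b \<in> gens \<Longrightarrow> b \<in> M"
  unfolding sc_algebra_def generated_vN_def
  by (subst commutant_def) (use gens_adj in \<open>auto simp: commutant_def\<close>)

lemma iota_M: "f \<in> Linf \<Longrightarrow> \<iota> f \<in> M"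
  by (rule M_gens) simp

lemma X_M: "0 < r \<Longrightarrow> X r \<in> M"
  by (rule M_gens) simp

lemma chi_M: "cut r \<in> M"
  by (simp add: chi_def iota_M Linf_indicator)

lemma iota_cong: "f \<in> Linf \<Longrightarrow> g \<in> Linf \<Longrightarrow> (\<And>x. 0 \<le> x \<Longrightarrow> f x = g x) \<Longrightarrow> \<iota> f = \<iota> g"
  by (rule embed_AE) (auto simp: AE_half_line)

lemma iota_diff: "f \<in> Linf \<Longrightarrow> g \<in> Linf \<Longrightarrow> \<iota> (\<lambda>x. f x - g x) = \<iota> f - \<iota> g"
  using embed_add[OF _ Linf_scale[of g "-1"], of f] embed_scaleC[of g "-1"]
  by (simp add: scaleC_minus_one)

lemma chi_iota:
  assumes "f \<in> Linf" "supported_upto r f"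
  shows "cut r o\<^sub>L \<iota> f = \<iota> f" "\<iota> f o\<^sub>L cut r = \<iota> f"
proof -
  have "\<iota> (\<lambda>x. indicator {0..r} x * f x) = \<iota> f"
    by (rule iota_cong[OF Linf_mult[OF Linf_indicator assms(1)] assms(1)])
       (use assms(2) in \<open>auto simp: supported_upto_def indicator_def\<close>)
  moreover have "\<iota> (\<lambda>x. f x * indicator {0..r} x) = \<iota> f"
    by (rule iota_cong[OF Linf_mult[OF assms(1) Linf_indicator] assms(1)])
       (use assms(2) in \<open>auto simp: supported_upto_def indicator_def\<close>)
  ultimately show "cut r o\<^sub>L \<iota> f = \<iota> f" "\<iota> f o\<^sub>L cut r = \<iota> f"
    by (simp_all add: chi_def embed_mult Linf_indicator assms(1))
qed

lemma chi_compose: "r \<le> s \<Longrightarrow> cut r o\<^sub>L cut s = cut r" "r \<le> s \<Longrightarrow> cut s o\<^sub>L cut r = cut r"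
  using chi_iota[OF Linf_indicator, of s r] by (auto simp: chi_def supported_upto_def)

lemma chi_selfadjoint: "adj (cut r) = cut r"
  unfolding chi_def embed_cnj[OF Linf_indicator, symmetric]
  by (rule iota_cong[OF Linf_cnj[OF Linf_indicator] Linf_indicator]) (simp add: indicator_def)

lemma cinner_iota_square:
  assumes "f \<in> Linf"
  shows "cinner (blinfun_apply (\<iota> (\<lambda>x. cnj (f x) * f x)) \<xi>) \<xi> = of_real ((norm (blinfun_apply (\<iota> f) \<xi>))\<^sup>2)"
  using assms
  by (simp add: embed_mult Linf_cnj embed_cnj cinner_adj_left embed_op cinner_self)

lemma Linf_of_real_compose:
  assumes "(\<lambda>x. complex_of_real (u x)) \<in> Linf" "\<phi> \<in> borel_measurable borel" "\<And>y. \<bar>\<phi> y\<bar> \<le> max 1 \<bar>y\<bar>"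
  shows "(\<lambda>x. complex_of_real (\<phi> (u x))) \<in> Linf"
proof -
  obtain C where C: "AE x in half_line. cmod (complex_of_real (u x)) \<le> C"
    and "(\<lambda>x. complex_of_real (u x)) \<in> borel_measurable half_line" using assms(1) by (auto simp: Linf_def)
  then have "(\<lambda>x. Re (complex_of_real (u x))) \<in> borel_measurable half_line" by measurable
  then have "u \<in> borel_measurable half_line" by simp
  from measurable_compose[OF this assms(2)]
  have "(\<lambda>x. complex_of_real (\<phi> (u x))) \<in> borel_measurable half_line" by measurable
  moreover have "AE x in half_line. cmod (complex_of_real (\<phi> (u x))) \<le> max 1 C"
    using C
  proof eventually_elim
    case (elim x)
    then show ?case using assms(3)[of "u x"] by (simp add: max_def split: if_splits)
  qed
  ultimately show ?thesis unfolding Linf_def by blast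
qed

text \<open>A nonnegative function is the square of a real function.\<close>

lemma iota_nonneg:
  assumes u: "(\<lambda>x. complex_of_real (u x)) \<in> Linf" and nn: "AE x in half_line. 0 \<le> u x"
  shows "Im (cinner (blinfun_apply (\<iota> (\<lambda>x. complex_of_real (u x))) \<xi>) \<xi>) = 0"
    and "0 \<le> Re (cinner (blinfun_apply (\<iota> (\<lambda>x. complex_of_real (u x))) \<xi>) \<xi>)"
proof -
  have "sqrt \<bar>y\<bar> \<le> max 1 \<bar>y\<bar>" for y :: real
  proof (cases "\<bar>y\<bar> \<le> 1")
    case False
    then have "\<bar>y\<bar> * 1 \<le> \<bar>y\<bar> * \<bar>y\<bar>" by (intro mult_left_mono) auto
    then have "sqrt \<bar>y\<bar> \<le> \<bar>y\<bar>" by (intro real_le_lsqrt) (simp_all add: power2_eq_square)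
    then show ?thesis by simp
  qed simp
  then have v: "(\<lambda>x. complex_of_real (sqrt \<bar>u x\<bar>)) \<in> Linf"
    by (intro Linf_of_real_compose[OF u]) auto
  have "\<iota> (\<lambda>x. complex_of_real (u x)) = \<iota> (\<lambda>x. cnj (complex_of_real (sqrt \<bar>u x\<bar>)) * complex_of_real (sqrt \<bar>u x\<bar>))"
    by (rule embed_AE[OF u Linf_mult[OF Linf_cnj[OF v] v]])
       (use nn in \<open>eventually_elim, simp flip: of_real_mult\<close>)
  then show "Im (cinner (blinfun_apply (\<iota> (\<lambda>x. complex_of_real (u x))) \<xi>) \<xi>) = 0"
    "0 \<le> Re (cinner (blinfun_apply (\<iota> (\<lambda>x. complex_of_real (u x))) \<xi>) \<xi>)"
    by (simp_all add: cinner_iota_square[OF v] del: complex_cnj_complex_of_real)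
qed

lemma norm_iota_square_le:
  assumes f: "f \<in> Linf" and u: "(\<lambda>x. complex_of_real (u x)) \<in> Linf"
    and le: "AE x in half_line. (cmod (f x))\<^sup>2 \<le> u x"
  shows "(norm (blinfun_apply (\<iota> f) \<xi>))\<^sup>2 \<le> Re (cinner (blinfun_apply (\<iota> (\<lambda>x. complex_of_real (u x))) \<xi>) \<xi>)"
proof -
  have eq: "complex_of_real (u x - (cmod (f x))\<^sup>2) = complex_of_real (u x) - cnj (f x) * f x" for x
    by (simp add: complex_norm_square mult.commute del: of_real_power)
  have L: "(\<lambda>x. cnj (f x) * f x) \<in> Linf" by (intro Linf_mult Linf_cnj f)
  have "(\<lambda>x. complex_of_real (u x - (cmod (f x))\<^sup>2)) \<in> Linf"
    unfolding eq by (intro Linf_diff u L)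
  from iota_nonneg(2)[OF this, of \<xi>] le
  have "0 \<le> Re (cinner (blinfun_apply (\<iota> (\<lambda>x. complex_of_real (u x) - cnj (f x) * f x)) \<xi>) \<xi>)"
    unfolding eq by auto
  then show ?thesis
    by (simp add: iota_diff[OF u L] blinfun.diff_left cinner_diff_left cinner_iota_square[OF f])
qed

lemma norm_iota:
  assumes f: "f \<in> Linf" and C: "AE x in half_line. cmod (f x) \<le> C" "0 \<le> C"
  shows "norm (\<iota> f) \<le> C"
proof (rule norm_blinfun_bound[OF C(2)])
  fix \<xi>
  have "\<iota> (\<lambda>x. complex_of_real (C\<^sup>2)) = complex_of_real (C\<^sup>2) *\<^sub>C id_blinfun"
    using embed_scaleC[OF Linf_const[of 1], of "complex_of_real (C\<^sup>2)"] by (simp add: embed_one)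
  moreover have "AE x in half_line. (cmod (f x))\<^sup>2 \<le> C\<^sup>2"
    using C(1) by eventually_elim (simp add: power_mono)
  ultimately have "(norm (blinfun_apply (\<iota> f) \<xi>))\<^sup>2 \<le> C\<^sup>2 * (norm \<xi>)\<^sup>2"
    using norm_iota_square_le[OF f Linf_const[of "complex_of_real (C\<^sup>2)"], of \<xi>]
    by (simp add: cinner_scaleC_left cinner_self flip: of_real_mult of_real_power)
  then have "(norm (blinfun_apply (\<iota> f) \<xi>))\<^sup>2 \<le> (C * norm \<xi>)\<^sup>2" by (simp add: power_mult_distrib)
  then show "norm (blinfun_apply (\<iota> f) \<xi>) \<le> C * norm \<xi>"
    by (rule power2_le_imp_le) (simp add: C(2))
qed

text \<open>Normality speaks of increasing sequences only. The suprema over the tails of \<open>|h\<^sub>m|\<^sup>2\<close> decrease to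
  \<open>0\<close>, so that normality applies to their differences from the constant bound, and they dominate
  \<open>|h\<^sub>n|\<^sup>2\<close>.\<close>

lemma iota_strong_limit_0:
  assumes h: "\<And>n. h n \<in> Linf" and C: "\<And>n. AE x in half_line. cmod (h n x) \<le> C"
    and lim: "AE x in half_line. (\<lambda>n. h n x) \<longlonglongrightarrow> 0"
  shows "(\<lambda>n. blinfun_apply (\<iota> (h n)) \<xi>) \<longlonglongrightarrow> 0"
proof -
  define K where "K = C\<^sup>2"
  have K0: "0 \<le> K" by (simp add: K_def)
  \<comment> \<open>truncated at \<open>K\<close> since the bound on \<open>h\<close> holds almost everywhere only\<close>
  define s where "s n x = (SUP m\<in>{n..}. min K ((cmod (h m x))\<^sup>2))" for n x
  have bdd: "bdd_above ((\<lambda>m. min K ((cmod (h m x))\<^sup>2)) ` {n..})" for n x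
    by (rule bdd_aboveI[of _ K]) auto
  have s_upper: "min K ((cmod (h m x))\<^sup>2) \<le> s n x" if "n \<le> m" for m n x
    unfolding s_def using bdd that by (intro cSUP_upper) auto
  have s_least: "s n x \<le> y" if "\<And>m. n \<le> m \<Longrightarrow> min K ((cmod (h m x))\<^sup>2) \<le> y" for n x y
    unfolding s_def by (rule cSUP_least) (use that in auto)
  have s0: "0 \<le> s n x" for n x
    by (rule order_trans[OF _ s_upper[OF order_refl]]) (simp add: K0)
  have sK: "s n x \<le> K" for n x by (rule s_least) simp
  have sm: "s n \<in> borel_measurable half_line" for n
    unfolding s_def
  proof (rule borel_measurable_cSUP)
    have "h m \<in> borel_measurable half_line" for m using h by (simp add: Linf_def)
    then show "(\<lambda>x. min K ((cmod (h m x))\<^sup>2)) \<in> borel_measurable half_line" for m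
      by measurable
  qed (use bdd in auto)
  have sL: "(\<lambda>x. complex_of_real (s n x)) \<in> Linf" for n
    by (rule LinfI[where C = K]) (use sm s0 sK in auto)
  have UL: "(\<lambda>x. complex_of_real (K - s n x)) \<in> Linf" for n
    using Linf_diff[OF Linf_const[of "complex_of_real K"] sL] by simp
  have "(\<lambda>n. cinner (blinfun_apply (\<iota> (\<lambda>x. complex_of_real (K - s n x))) \<xi>) \<xi>)
          \<longlonglongrightarrow> cinner (blinfun_apply (\<iota> (\<lambda>x. complex_of_real K)) \<xi>) \<xi>"
  proof (rule embed_normal[OF UL Linf_const])
    show "AE x in half_line. incseq (\<lambda>n. K - s n x) \<and> 0 \<le> K - s 0 x \<and> (\<lambda>n. K - s n x) \<longlonglongrightarrow> K"
      using lim
    proof eventually_elim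
      case (elim x)
      have "incseq (\<lambda>n. K - s n x)"
        by (rule incseq_SucI) (simp, rule s_least, rule s_upper, simp)
      moreover have "(\<lambda>n. s n x) \<longlonglongrightarrow> 0"
      proof (rule LIMSEQ_I)
        fix e :: real assume e: "0 < e"
        have "(\<lambda>n. (cmod (h n x))\<^sup>2) \<longlonglongrightarrow> (cmod 0)\<^sup>2" by (intro tendsto_intros elim)
        then have "(\<lambda>n. (cmod (h n x))\<^sup>2) \<longlonglongrightarrow> 0" by simp
        from LIMSEQ_D[OF this, of "e/2"] e
        obtain n0 where n0: "\<And>n. n \<ge> n0 \<Longrightarrow> (cmod (h n x))\<^sup>2 < e / 2" by auto
        have "s n x \<le> e / 2" if "n \<ge> n0" for n
          by (rule s_least) (rule min.coboundedI2, rule less_imp_le, rule n0, use that in simp)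
        then show "\<exists>n0. \<forall>n\<ge>n0. norm (s n x - 0) < e"
          using s0 e by (intro exI[of _ n0]) (fastforce simp: abs_of_nonneg)
      qed
      then have "(\<lambda>n. K - s n x) \<longlonglongrightarrow> K - 0" by (intro tendsto_intros)
      ultimately show ?case using sK by simp
    qed
  qed
  then have "(\<lambda>n. Re (cinner (blinfun_apply (\<iota> (\<lambda>x. complex_of_real K)) \<xi>) \<xi>)
      - Re (cinner (blinfun_apply (\<iota> (\<lambda>x. complex_of_real (K - s n x))) \<xi>) \<xi>))
          \<longlonglongrightarrow> Re (cinner (blinfun_apply (\<iota> (\<lambda>x. complex_of_real K)) \<xi>) \<xi>)
            - Re (cinner (blinfun_apply (\<iota> (\<lambda>x. complex_of_real K)) \<xi>) \<xi>)"
    by (intro tendsto_intros)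
  moreover have "Re (cinner (blinfun_apply (\<iota> (\<lambda>x. complex_of_real K)) \<xi>) \<xi>)
      - Re (cinner (blinfun_apply (\<iota> (\<lambda>x. complex_of_real (K - s n x))) \<xi>) \<xi>)
      = Re (cinner (blinfun_apply (\<iota> (\<lambda>x. complex_of_real (s n x))) \<xi>) \<xi>)" for n
    by (simp add: iota_diff[OF Linf_const sL] blinfun.diff_left cinner_diff_left)
  ultimately have "(\<lambda>n. Re (cinner (blinfun_apply (\<iota> (\<lambda>x. complex_of_real (s n x))) \<xi>) \<xi>)) \<longlonglongrightarrow> 0"
    by simp
  moreover have "(norm (blinfun_apply (\<iota> (h n)) \<xi>))\<^sup>2 \<le> Re (cinner (blinfun_apply (\<iota> (\<lambda>x. complex_of_real (s n x))) \<xi>) \<xi>)" for n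
  proof (rule norm_iota_square_le[OF h sL])
    show "AE x in half_line. (cmod (h n x))\<^sup>2 \<le> s n x"
      using C[of n]
    proof eventually_elim
      case (elim x)
      then have "(cmod (h n x))\<^sup>2 \<le> K" by (simp add: K_def power_mono)
      then show ?case using s_upper[of n n x] by simp
    qed
  qed
  ultimately have "(\<lambda>n. (norm (blinfun_apply (\<iota> (h n)) \<xi>))\<^sup>2) \<longlonglongrightarrow> 0"
    by (intro Lim_null_comparison[of "\<lambda>n. (norm (blinfun_apply (\<iota> (h n)) \<xi>))\<^sup>2"]) auto
  then have "(\<lambda>n. sqrt ((norm (blinfun_apply (\<iota> (h n)) \<xi>))\<^sup>2)) \<longlonglongrightarrow> sqrt 0"
    by (rule tendsto_real_sqrt)
  then show ?thesis by (simp add: tendsto_norm_zero_iff)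
qed

lemma iota_strong_limit:
  assumes h: "\<And>n. h n \<in> Linf" and f: "f \<in> Linf" and C: "\<And>n. AE x in half_line. cmod (h n x) \<le> C"
    and lim: "AE x in half_line. (\<lambda>n. h n x) \<longlonglongrightarrow> f x"
  shows "(\<lambda>n. blinfun_apply (\<iota> (h n)) \<xi>) \<longlonglongrightarrow> blinfun_apply (\<iota> f) \<xi>"
proof -
  obtain D where D: "AE x in half_line. cmod (f x) \<le> D" using f by (auto simp: Linf_def)
  have "(\<lambda>n. blinfun_apply (\<iota> (\<lambda>x. h n x - f x)) \<xi>) \<longlonglongrightarrow> 0"
  proof (rule iota_strong_limit_0)
    show "(\<lambda>x. h n x - f x) \<in> Linf" for n by (intro Linf_diff h f)
    show "AE x in half_line. cmod (h n x - f x) \<le> C + D" for n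
      using C[of n] D by eventually_elim (rule order_trans[OF norm_triangle_ineq4], rule add_mono)
    show "AE x in half_line. (\<lambda>n. h n x - f x) \<longlonglongrightarrow> 0"
      using lim by eventually_elim (rule LIM_zero)
  qed
  then show ?thesis by (simp add: iota_diff h f blinfun.diff_left LIM_zero_iff)
qed

lemma iota_strong_derivative:
  assumes "dilation_derivative f g"
  shows "strong_derivative (\<lambda>t. \<iota> (dilate t f)) (\<iota> g)"
  unfolding strong_derivative_def
proof (intro conjI allI)
  have f: "f \<in> Linf" and g: "g \<in> Linf" using dilation_derivative_Linf[OF assms] by auto
  obtain B where "\<forall>x\<ge>0. cmod (f x) \<le> B" using assms by (auto simp: dilation_derivative_def)
  then have B: "\<And>x. 0 \<le> x \<Longrightarrow> cmod (f x) \<le> B" by blast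
  then have B0: "0 \<le> B" using order_trans[OF norm_ge_zero B[of 0]] by simp
  show "\<exists>C. \<forall>\<^sub>F t in at 1. norm (\<iota> (dilate t f)) \<le> C"
    using eventually_at_1_near
  proof (intro exI, eventually_elim)
    case (elim t)
    then show "norm (\<iota> (dilate t f)) \<le> B"
      by (intro norm_iota Linf_dilate f B0) (auto simp: AE_half_line intro!: B)
  qed
  obtain C where "\<forall>x\<ge>0. \<forall>t\<in>{1/2<..<2}. cmod (f (x / t) - f x) \<le> C * \<bar>t - 1\<bar>"
    using assms unfolding dilation_derivative_def by blast
  then have C: "\<And>x t. 0 \<le> x \<Longrightarrow> t \<in> {1/2<..<2} \<Longrightarrow> cmod (f (x / t) - f x) \<le> C * \<bar>t - 1\<bar>" by blast
  fix \<xi>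
  show "((\<lambda>t. blinfun_apply (\<iota> (dilate t f)) \<xi>) has_vector_derivative blinfun_apply (\<iota> g) \<xi>) (at 1)"
    unfolding has_vector_derivative_iff_quotient tendsto_at_iff_sequentially
  proof (intro allI impI)
    fix T :: "nat \<Rightarrow> real" assume "\<forall>i. T i \<in> UNIV - {1}" and T: "T \<longlonglongrightarrow> 1"
    then have T1: "T n \<noteq> 1" for n by auto
    have "\<forall>\<^sub>F n in sequentially. T n \<in> {1/2<..<2}"
      by (rule topological_tendstoD[OF T]) auto
    then obtain n0 where "\<forall>n\<ge>n0. T n \<in> {1/2<..<2}" unfolding eventually_sequentially ..
    then have n0: "\<And>n. T (n + n0) \<in> {1/2<..<2}" by simp
    define S where "S n = T (n + n0)" for n
    have S: "S n \<in> {1/2<..<2}" "S n \<noteq> 1" "0 < S n" for n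
      using n0[of n] T1 by (auto simp: S_def)
    have "S \<longlonglongrightarrow> 1" unfolding S_def by (rule LIMSEQ_ignore_initial_segment[OF T])
    then have Sat: "filterlim S (at 1) sequentially"
      using S(2) by (auto simp: filterlim_at)
    let ?h = "\<lambda>n x. complex_of_real (1 / (S n - 1)) * (f (x / S n) - f x)"
    have "(\<lambda>n. blinfun_apply (\<iota> (?h n)) \<xi>) \<longlonglongrightarrow> blinfun_apply (\<iota> g) \<xi>"
    proof (rule iota_strong_limit[OF _ g])
      show "?h n \<in> Linf" for n by (intro Linf_scale Linf_diff Linf_dilate f S)
      show "AE x in half_line. cmod (?h n x) \<le> C" for n
        unfolding AE_half_line
      proof (intro AE_I2 impI)
        fix x :: real assume "0 \<le> x"
        have "cmod (?h n x) = cmod (f (x / S n) - f x) / \<bar>S n - 1\<bar>"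
          by (simp only: norm_mult norm_of_real abs_divide abs_one) simp
        also have "\<dots> \<le> C"
          using C[OF \<open>0 \<le> x\<close> S(1)] S(2)[of n] by (simp add: pos_divide_le_eq)
        finally show "cmod (?h n x) \<le> C" .
      qed
      show "AE x in half_line. (\<lambda>n. ?h n x) \<longlonglongrightarrow> g x"
        using AE_half_line_neq[of 1] AE_space[of half_line]
      proof eventually_elim
        case (elim x)
        then have "((\<lambda>t. (1 / (t - 1)) *\<^sub>R (f (x / t) - f x)) \<longlongrightarrow> g x) (at 1)"
          using assms by (auto simp: dilation_derivative_def has_vector_derivative_iff_quotient)
        from filterlim_compose[OF this Sat] show ?case by (simp add: scaleR_conv_of_real)
      qed
    qed
    moreover have "blinfun_apply (\<iota> (?h n)) \<xi>
      = (1 / (S n - 1)) *\<^sub>R (blinfun_apply (\<iota> (dilate (S n) f)) \<xi> - blinfun_apply (\<iota> (dilate 1 f)) \<xi>)" for n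
      by (simp add: embed_scaleC[OF Linf_diff[OF Linf_dilate[OF f S(3)] f]] iota_diff[OF Linf_dilate[OF f S(3)] f]
          scaleR_scaleC blinfun.diff_left del: of_real_divide)
    ultimately have "(\<lambda>n. ((\<lambda>t. (1 / (t - 1)) *\<^sub>R (blinfun_apply (\<iota> (dilate t f)) \<xi>
        - blinfun_apply (\<iota> (dilate 1 f)) \<xi>)) \<circ> T) (n + n0)) \<longlonglongrightarrow> blinfun_apply (\<iota> g) \<xi>"
      by (simp add: S_def)
    then show "((\<lambda>t. (1 / (t - 1)) *\<^sub>R (blinfun_apply (\<iota> (dilate t f)) \<xi>
        - blinfun_apply (\<iota> (dilate 1 f)) \<xi>)) \<circ> T) \<longlonglongrightarrow> blinfun_apply (\<iota> g) \<xi>"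
      by (rule LIMSEQ_offset)
  qed
qed

lemma positive_square:
  assumes "a \<in> M"
  shows "adj a o\<^sub>L a \<in> pos_part M"
  using assms M_adj[OF assms] M_bounded[OF assms]
  by (simp add: pos_part_def positive_op_def M_compose M_bounded cinner_adj_left cinner_self)

lemma zero_finite_pos: "0 \<in> finite_pos M Tr" "Tr 0 = 0"
proof -
  have M0: "0 \<in> M" using M_scaleR[OF M_id, of 0] by simp
  then have p: "0 \<in> pos_part M" by (simp add: pos_part_def positive_op_def)
  from trace.homogeneous[OF p, of 0] show "Tr 0 = 0" by simp
  with p show "0 \<in> finite_pos M Tr" by (simp add: finite_pos_def)
qed

text \<open>The value does not depend on the decomposition: the quadratic form of a positive operator is real,
  so that the imaginary parts cancel, and the real parts are compared by additivity of the trace.\<close>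

lemma linear_trace_pos:
  assumes p: "p \<in> finite_pos M Tr"
  shows "linear_trace M Tr p = of_real (enn2real (Tr p))"
  unfolding linear_trace_def
proof (rule the_equality)
  show "\<exists>p'\<in>finite_pos M Tr. \<exists>q\<in>finite_pos M Tr. \<exists>r\<in>finite_pos M Tr. \<exists>s\<in>finite_pos M Tr.
       p = (p' - q) + \<i> *\<^sub>C (r - s) \<and> complex_of_real (enn2real (Tr p))
         = Complex (enn2real (Tr p') - enn2real (Tr q)) (enn2real (Tr r) - enn2real (Tr s))"
    by (rule bexI[OF _ p], (rule bexI[OF _ zero_finite_pos(1)])+)
       (simp add: zero_finite_pos complex_of_real_def)
next
  fix z
  assume "\<exists>p'\<in>finite_pos M Tr. \<exists>q\<in>finite_pos M Tr. \<exists>r\<in>finite_pos M Tr. \<exists>s\<in>finite_pos M Tr.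
       p = (p' - q) + \<i> *\<^sub>C (r - s) \<and>
       z = Complex (enn2real (Tr p') - enn2real (Tr q)) (enn2real (Tr r) - enn2real (Tr s))"
  then obtain p' q r s where fin: "p' \<in> finite_pos M Tr" "q \<in> finite_pos M Tr" "r \<in> finite_pos M Tr" "s \<in> finite_pos M Tr"
    and eq: "p = (p' - q) + \<i> *\<^sub>C (r - s)"
    and z: "z = Complex (enn2real (Tr p') - enn2real (Tr q)) (enn2real (Tr r) - enn2real (Tr s))"
    by blast
  have real: "Im (cinner (blinfun_apply a x) x) = 0" if "a \<in> finite_pos M Tr" for a x
    using that by (simp add: finite_pos_def pos_part_def positive_op_def)
  have inM: "a \<in> M" if "a \<in> finite_pos M Tr" for a
    using that by (simp add: finite_pos_def pos_part_def)
  have "r - s = 0"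
  proof (rule quadratic_form_zero)
    show "r - s \<in> bounded_ops" by (intro M_bounded M_diff inM fin)
    fix x
    have "cinner (blinfun_apply p x) x = cinner (blinfun_apply p' x) x - cinner (blinfun_apply q x) x
        + \<i> * cinner (blinfun_apply (r - s) x) x"
      by (simp add: eq blinfun.add_left blinfun.diff_left cinner_add_left cinner_diff_left cinner_scaleC_left)
    then have "Re (cinner (blinfun_apply (r - s) x) x) = 0"
      using arg_cong[of _ _ Im] real[OF p, of x] real[OF fin(1), of x] real[OF fin(2), of x] by fastforce
    then show "cinner (blinfun_apply (r - s) x) x = 0"
      using real[OF fin(3), of x] real[OF fin(4), of x]
      by (simp add: complex_eq_iff blinfun.diff_left cinner_diff_left)
  qed
  then have rs: "r = s" by simp
  then have "p + q = p'" by (simp add: eq)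
  then have "Tr p' = Tr p + Tr q"
    using trace.additive[of p q] p fin(2) by (simp add: finite_pos_def)
  then have "enn2real (Tr p') = enn2real (Tr p) + enn2real (Tr q)"
    using p fin(2) by (simp add: finite_pos_def enn2real_plus)
  then show "z = of_real (enn2real (Tr p))" by (simp add: z rs complex_of_real_def)
qed

lemma trace_cut: "Tr (cut r) < \<infinity>"
proof -
  have eq: "(\<lambda>x. complex_of_real (indicator {0..r} x)) = indicator {0..r}"
    by (auto simp: indicator_def)
  have "Tr (cut r) = (\<integral>\<^sup>+ x. ennreal (indicator {0..r} x) \<partial>half_line)"
    using trace_embed[of "indicator {0..r}"] by (simp add: eq Linf_indicator chi_def)
  also have "\<dots> = emeasure half_line {0..r}"
    by (subst ennreal_indicator) (rule nn_integral_indicator, simp add: sets_restrict_space_iff)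
  also have "\<dots> = emeasure lebesgue {0..r}"
    by (rule emeasure_restrict_space) auto
  also have "\<dots> < \<infinity>" by (cases "0 \<le> r") auto
  finally show ?thesis .
qed

text \<open>With \<open>c = \<chi>\<^bsub>[0,r]\<^esub>\<close> one has \<open>(a c)\<^sup>* (a c) \<le> \<parallel>a\<parallel>\<^sup>2 c\<close>, and the right-hand side has finite trace.\<close>

lemma square_integrable_compose_cut:
  assumes a: "a \<in> M"
  shows "a o\<^sub>L cut r \<in> square_integrable M Tr"
    and "adj (a o\<^sub>L cut r) o\<^sub>L (a o\<^sub>L cut r) \<in> finite_pos M Tr"
proof -
  let ?b = "a o\<^sub>L cut r" and ?c = "((norm a)\<^sup>2) *\<^sub>R cut r"
  have bM: "?b \<in> M" by (intro M_compose a chi_M)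
  have ab: "a \<in> bounded_ops" "cut r \<in> bounded_ops" by (intro M_bounded a chi_M)+
  have cc: "blinfun_apply (cut r) (blinfun_apply (cut r) x) = blinfun_apply (cut r) x" for x
    using chi_compose(1)[of r r] by (metis blinfun_apply_blinfun_compose order_refl)
  have cn: "cinner (blinfun_apply (cut r) x) x = of_real ((norm (blinfun_apply (cut r) x))\<^sup>2)" for x
    using cinner_adj_left[OF ab(2), of "blinfun_apply (cut r) x" x] by (simp add: chi_selfadjoint cc cinner_self)
  have p1: "adj ?b o\<^sub>L ?b \<in> pos_part M" by (rule positive_square[OF bM])
  have bn: "cinner (blinfun_apply (adj ?b o\<^sub>L ?b) x) x = of_real ((norm (blinfun_apply a (blinfun_apply (cut r) x)))\<^sup>2)" for x
    using M_bounded[OF bM] by (simp add: cinner_adj_left cinner_self)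
  have p0: "cut r \<in> pos_part M"
    by (simp add: pos_part_def positive_op_def chi_M ab cn)
  have "?c - (adj ?b o\<^sub>L ?b) \<in> M" by (intro M_diff M_scaleR chi_M M_compose M_adj bM)
  moreover have "(norm (blinfun_apply a (blinfun_apply (cut r) x)))\<^sup>2 \<le> (norm a)\<^sup>2 * (norm (blinfun_apply (cut r) x))\<^sup>2" for x
    using norm_blinfun[of a "blinfun_apply (cut r) x"] by (metis norm_ge_zero power_mono power_mult_distrib)
  ultimately have p2: "?c - (adj ?b o\<^sub>L ?b) \<in> pos_part M"
    by (simp add: pos_part_def positive_op_def M_bounded blinfun.diff_left cinner_diff_left
        blinfun.scaleR_left cinner_scaleR_left cn bn del: blinfun_apply_blinfun_compose of_real_power
        flip: of_real_mult of_real_diff)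
  have "Tr (adj ?b o\<^sub>L ?b) \<le> Tr (adj ?b o\<^sub>L ?b) + Tr (?c - (adj ?b o\<^sub>L ?b))" by simp
  also have "\<dots> = Tr ?c" using trace.additive[OF p1 p2] by simp
  also have "\<dots> = ennreal ((norm a)\<^sup>2) * Tr (cut r)" by (rule trace.homogeneous[OF p0]) simp
  also have "\<dots> < \<infinity>" using trace_cut by (simp add: ennreal_mult_less_top)
  finally show "?b \<in> square_integrable M Tr" "adj ?b o\<^sub>L ?b \<in> finite_pos M Tr"
    using p1 bM by (simp_all add: square_integrable_def finite_pos_def)
qed

lemma square_integrable_cut: "cut r \<in> square_integrable M Tr"
  using square_integrable_compose_cut(1)[OF M_id, of r] by (simp add: id_blinfun_compose)

lemma \<Lambda>_compose_cut: "a \<in> M \<Longrightarrow> \<Lambda> (a o\<^sub>L cut r) = blinfun_apply a (\<Lambda> (cut r))"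
  by (rule L2_left[symmetric, OF _ square_integrable_cut])

lemma cut_vector: "r \<le> s \<Longrightarrow> blinfun_apply (cut r) (\<Lambda> (cut s)) = \<Lambda> (cut r)"
  "r \<le> s \<Longrightarrow> blinfun_apply (cut s) (\<Lambda> (cut r)) = \<Lambda> (cut r)"
  using \<Lambda>_compose_cut[OF chi_M, of r s] \<Lambda>_compose_cut[OF chi_M, of s r] by (simp_all add: chi_compose)

text \<open>Faithfulness of the trace, seen in \<open>L\<^sup>2\<close>. On the corner it makes \<open>\<Lambda>\<close> injective, which is what
  determines \<open>\<delta>(a)\<close> by an \<open>L\<^sup>2\<close> derivative.\<close>

lemma cut_separating:
  assumes a: "a \<in> M" and 0: "blinfun_apply a (\<Lambda> (cut r)) = 0"
  shows "a o\<^sub>L cut r = 0"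
proof -
  let ?b = "a o\<^sub>L cut r"
  note si = square_integrable_compose_cut[OF a, of r]
  have "linear_trace M Tr (adj ?b o\<^sub>L ?b) = cinner (\<Lambda> ?b) (\<Lambda> ?b)"
    using L2_cinner[OF si(1) si(1)] by simp
  also have "\<dots> = 0" by (simp add: \<Lambda>_compose_cut[OF a] 0)
  finally have "enn2real (Tr (adj ?b o\<^sub>L ?b)) = 0" using linear_trace_pos[OF si(2)] by simp
  then have "Tr (adj ?b o\<^sub>L ?b) = 0" using si(2) by (auto simp: finite_pos_def enn2real_eq_0_iff)
  then have "adj ?b o\<^sub>L ?b = 0" using trace.faithful[of "adj ?b o\<^sub>L ?b"] si(2) by (simp add: finite_pos_def)
  then have "cinner (blinfun_apply ?b x) (blinfun_apply ?b x) = 0" for x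
    using cinner_adj_left[OF M_bounded[OF M_compose[OF a chi_M[of r]]], of "blinfun_apply ?b x" x]
    by (metis blinfun.zero_left blinfun_apply_blinfun_compose cinner_zero_left)
  then show ?thesis by (intro blinfun_eqI) (simp add: cinner_self_eq_0 del: blinfun_apply_blinfun_compose)
qed


section \<open>Words in the semicircular element\<close>

lemma word_snoc: "fs \<noteq> [] \<Longrightarrow> sc_word \<iota> Y (fs @ [f]) = sc_word \<iota> Y fs o\<^sub>L (Y o\<^sub>L \<iota> f)"
proof (induction fs)
  case (Cons g gs)
  then show ?case by (cases gs) (simp_all add: blinfun_compose_assoc)
qed simp

lemma word_merge:
  assumes "f \<in> Linf" "g \<in> Linf"
  shows "sc_word \<iota> Y (fs @ [f]) o\<^sub>L sc_word \<iota> Y (g # gs) = sc_word \<iota> Y (fs @ (\<lambda>x. f x * g x) # gs)"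
proof (induction fs)
  case Nil
  show ?case using embed_mult[OF assms] by (cases gs) (simp_all add: blinfun_compose_assoc)
next
  case (Cons h hs)
  show ?case using Cons by (cases hs) (simp_all add: blinfun_compose_assoc)
qed

lemma word_M:
  assumes "set fs \<subseteq> Linf" "0 < r"
  shows "sc_word \<iota> (X r) fs \<in> M"
proof (cases "fs = []")
  case False
  then show ?thesis using assms(1)
  proof (induction fs rule: list_nonempty_induct)
    case (cons f fs)
    then show ?case by (cases fs) (auto intro!: M_compose iota_M X_M assms(2))
  qed (auto intro: iota_M)
qed (simp add: M_id)

lemma cut_word:
  assumes "f \<in> Linf" "supported_upto r f"
  shows "cut r o\<^sub>L sc_word \<iota> Y (f # fs) = sc_word \<iota> Y (f # fs)"
  using chi_iota(1)[OF assms] by (cases fs) (simp_all flip: blinfun_compose_assoc)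

lemma word_cut:
  assumes "f \<in> Linf" "supported_upto r f"
  shows "sc_word \<iota> Y (fs @ [f]) o\<^sub>L cut r = sc_word \<iota> Y (fs @ [f])"
  using chi_iota(2)[OF assms] by (cases "fs = []") (simp_all add: word_snoc blinfun_compose_assoc)

text \<open>A coefficient supported in \<open>[0,r]\<close> absorbs the projection \<open>\<chi>\<^bsub>[0,r]\<^esub>\<close>, so cutting down the
  semicircular letters between such coefficients changes nothing.\<close>

lemma word_radius:
  assumes "0 < r" "r \<le> s" "fs \<noteq> []" "\<forall>f\<in>set fs. f \<in> Linf \<and> supported_upto r f"
  shows "sc_word \<iota> (X r) fs = sc_word \<iota> (X s) fs"
  using assms(3,4)
proof (induction fs rule: list_nonempty_induct)
  case (cons f fs)
  then obtain g gs where fs: "fs = g # gs" by (cases fs) auto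
  have "sc_word \<iota> (X r) (f # fs) = \<iota> f o\<^sub>L (X r o\<^sub>L sc_word \<iota> (X s) fs)"
    using cons fs by simp
  also have "\<dots> = (\<iota> f o\<^sub>L cut r) o\<^sub>L (X s o\<^sub>L (cut r o\<^sub>L sc_word \<iota> (X s) fs))"
    using X_compress[OF assms(1,2), symmetric] by (simp add: blinfun_compose_assoc)
  also have "\<dots> = sc_word \<iota> (X s) (f # fs)"
    using cons.prems fs by (simp add: chi_iota cut_word)
  finally show ?case .
qed simp

lemma word_adj:
  assumes "0 < r" "set fs \<subseteq> Linf"
  shows "adj (sc_word \<iota> (X r) fs) = sc_word \<iota> (X r) (rev (map (\<lambda>f x. cnj (f x)) fs))"
proof (cases "fs = []")
  case True
  then show ?thesis by (simp, intro adj_eqI) simp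
next
  case False
  then show ?thesis using assms(2)
  proof (induction fs rule: list_nonempty_induct)
    case (single f)
    then show ?case by (simp add: embed_cnj)
  next
    case (cons f fs)
    then obtain g gs where fs: "fs = g # gs" by (cases fs) auto
    have b: "\<iota> f \<in> bounded_ops" "X r \<in> bounded_ops" "sc_word \<iota> (X r) fs \<in> bounded_ops"
      using cons.prems assms(1) by (auto intro: embed_op X_op M_bounded word_M)
    have "adj (sc_word \<iota> (X r) (f # fs)) = adj (\<iota> f o\<^sub>L (X r o\<^sub>L sc_word \<iota> (X r) fs))"
      by (simp add: fs)
    also have "\<dots> = adj (sc_word \<iota> (X r) fs) o\<^sub>L (X r o\<^sub>L \<iota> (\<lambda>x. cnj (f x)))"
      using b cons.prems by (simp add: adj_compose bounded_ops_compose X_selfadjoint[OF assms(1)] embed_cnj blinfun_compose_assoc)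
    also have "adj (sc_word \<iota> (X r) fs) = sc_word \<iota> (X r) (rev (map (\<lambda>f x. cnj (f x)) fs))"
      using cons by simp
    finally show ?case
      by (simp only: list.map rev.simps) (subst word_snoc, simp_all add: fs)
  qed
qed

lemma \<alpha>_automorphism: "0 < t \<Longrightarrow> star_automorphism M (\<alpha> t)"
  and \<alpha>_iota: "0 < t \<Longrightarrow> f \<in> Linf \<Longrightarrow> \<alpha> t (\<iota> f) = \<iota> (dilate t f)"
  and \<alpha>_X: "0 < t \<Longrightarrow> 0 < r \<Longrightarrow> \<alpha> t (X r) = (t powr (-1/2)) *\<^sub>R X (t * r)"
  using dilation by (auto simp: dilation_action_def)

lemma \<alpha>_M: "0 < t \<Longrightarrow> a \<in> M \<Longrightarrow> \<alpha> t a \<in> M"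
  using \<alpha>_automorphism by (meson bij_betw_apply star_automorphism_def)

lemma \<alpha>_add: "0 < t \<Longrightarrow> a \<in> M \<Longrightarrow> b \<in> M \<Longrightarrow> \<alpha> t (a + b) = \<alpha> t a + \<alpha> t b"
  and \<alpha>_compose: "0 < t \<Longrightarrow> a \<in> M \<Longrightarrow> b \<in> M \<Longrightarrow> \<alpha> t (a o\<^sub>L b) = \<alpha> t a o\<^sub>L \<alpha> t b"
  and \<alpha>_scaleC: "0 < t \<Longrightarrow> a \<in> M \<Longrightarrow> \<alpha> t (c *\<^sub>C a) = c *\<^sub>C \<alpha> t a"
  using \<alpha>_automorphism by (auto simp: star_automorphism_def)

lemma \<alpha>_word:
  assumes "0 < t" "0 < r" "fs \<noteq> []" "set fs \<subseteq> Linf"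
  shows "\<alpha> t (sc_word \<iota> (X r) fs)
    = (t powr (- ((real (length fs) - 1) / 2))) *\<^sub>R sc_word \<iota> (X (t * r)) (map (dilate t) fs)"
  using assms(3,4)
proof (induction fs rule: list_nonempty_induct)
  case (single f)
  then show ?case using assms(1) by (simp add: \<alpha>_iota)
next
  case (cons f fs)
  then obtain g gs where fs: "fs = g # gs" by (cases fs) auto
  let ?W = "sc_word \<iota> (X (t * r)) (map (dilate t) fs)"
  have L: "f \<in> Linf" "set fs \<subseteq> Linf" using cons.prems by auto
  have W: "sc_word \<iota> (X r) fs \<in> M" using L assms(2) by (intro word_M)
  have "\<alpha> t (sc_word \<iota> (X r) (f # fs)) = \<alpha> t (\<iota> f o\<^sub>L (X r o\<^sub>L sc_word \<iota> (X r) fs))"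
    by (simp add: fs)
  also have "\<dots> = \<iota> (dilate t f) o\<^sub>L ((t powr (-1/2)) *\<^sub>R X (t * r)
      o\<^sub>L ((t powr (- ((real (length fs) - 1) / 2))) *\<^sub>R ?W))"
    using cons.IH[OF L(2)] L W assms
    by (simp add: \<alpha>_compose M_compose iota_M X_M \<alpha>_iota \<alpha>_X)
  also have "\<dots> = (t powr (-1/2) * t powr (- ((real (length fs) - 1) / 2))) *\<^sub>R (\<iota> (dilate t f) o\<^sub>L (X (t * r) o\<^sub>L ?W))"
    by (rule blinfun_eqI) (simp add: blinfun.scaleR_left blinfun.scaleR_right)
  also have "t powr (-1/2) * t powr (- ((real (length fs) - 1) / 2)) = t powr (- ((real (length (f # fs)) - 1) / 2))"
    by (simp add: field_simps flip: powr_add)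
  finally show ?case by (simp add: fs)
qed

lemma word_strong_derivative:
  assumes "fs \<noteq> []" "\<forall>f\<in>set fs. \<exists>g. dilation_derivative f g"
  shows "\<exists>a. strong_derivative (\<lambda>t. sc_word \<iota> Y (map (dilate t) fs)) a"
  using assms
proof (induction fs rule: list_nonempty_induct)
  case (single f)
  then show ?case by (auto intro: iota_strong_derivative)
next
  case (cons f fs)
  then obtain g gs where fs: "fs = g # gs" by (cases fs) auto
  obtain h where h: "dilation_derivative f h" using cons.prems by auto
  obtain a where "strong_derivative (\<lambda>t. sc_word \<iota> Y (map (dilate t) fs)) a" using cons by auto
  from strong_derivative_compose[OF iota_strong_derivative[OF h] strong_derivative_compose[OF strong_derivative_const[of Y] this]]
  show ?case by (auto simp: fs)
qed

inductive_set word_span :: "(real \<Rightarrow> complex) set \<Rightarrow> ('h \<Rightarrow>\<^sub>L 'h) set" for \<G> :: "(real \<Rightarrow> complex) set" where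
  word: "\<lbrakk>fs \<noteq> []; 0 < r; \<forall>f\<in>set fs. f \<in> \<G> \<and> supported_upto r f\<rbrakk> \<Longrightarrow> sc_word \<iota> (X r) fs \<in> word_span \<G>"
| add: "\<lbrakk>a \<in> word_span \<G>; b \<in> word_span \<G>\<rbrakk> \<Longrightarrow> a + b \<in> word_span \<G>"
| scale: "a \<in> word_span \<G> \<Longrightarrow> c *\<^sub>C a \<in> word_span \<G>"

lemma word_span_M: "a \<in> word_span \<G> \<Longrightarrow> \<G> \<subseteq> Linf \<Longrightarrow> a \<in> M"
  by (induction rule: word_span.induct) (auto intro!: word_M M_add M_scaleC)

text \<open>The product of two words is a word, because the two adjacent coefficients merge into one.\<close>

lemma word_span_mult:
  assumes a: "a \<in> word_span \<G>" and b: "b \<in> word_span \<G>" and L: "\<G> \<subseteq> Linf"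
    and closed: "\<And>f g. f \<in> \<G> \<Longrightarrow> g \<in> \<G> \<Longrightarrow> (\<lambda>x. f x * g x) \<in> \<G>"
  shows "a o\<^sub>L b \<in> word_span \<G>"
  using a
proof induction
  case (word fs r)
  show ?case using b
  proof induction
    case (word gs s)
    define R where "R = max r s"
    have R: "0 < R" "r \<le> R" "s \<le> R" using \<open>0 < r\<close> by (auto simp: R_def)
    have suppR: "supported_upto R f" if "supported_upto r f \<or> supported_upto s f" for f
      using that R by (auto simp: supported_upto_def)
    have 1: "sc_word \<iota> (X r) fs = sc_word \<iota> (X R) fs" "sc_word \<iota> (X s) gs = sc_word \<iota> (X R) gs"
      using word.hyps \<open>fs \<noteq> []\<close> \<open>0 < r\<close> \<open>\<forall>f\<in>set fs. f \<in> \<G> \<and> supported_upto r f\<close> R L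
      by (auto intro!: word_radius)
    obtain fs' f where fs: "fs = fs' @ [f]" using \<open>fs \<noteq> []\<close> by (metis rev_exhaust)
    obtain g gs' where gs: "gs = g # gs'" using \<open>gs \<noteq> []\<close> by (cases gs) auto
    have "sc_word \<iota> (X r) fs o\<^sub>L sc_word \<iota> (X s) gs = sc_word \<iota> (X R) (fs' @ (\<lambda>x. f x * g x) # gs')"
      unfolding 1 unfolding fs gs
      by (rule word_merge)
         (use word.hyps \<open>\<forall>f\<in>set fs. f \<in> \<G> \<and> supported_upto r f\<close> fs gs L in auto)
    also have "\<dots> \<in> word_span \<G>"
    proof (rule word_span.word)
      show "\<forall>h\<in>set (fs' @ (\<lambda>x. f x * g x) # gs'). h \<in> \<G> \<and> supported_upto R h"
        using word.hyps \<open>\<forall>f\<in>set fs. f \<in> \<G> \<and> supported_upto r f\<close> fs gs R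
        by (auto intro!: closed suppR) (auto simp: supported_upto_def)
    qed (use R in auto)
    finally show ?case .
  next
    case (add b c)
    then show ?case by (auto simp: blinfun_compose_add_right intro: word_span.add)
  next
    case (scale b c)
    have "sc_word \<iota> (X r) fs \<in> bounded_ops"
      using word L by (auto intro!: M_bounded word_M)
    then show ?case using scale by (auto simp: blinfun_compose_scaleC_right intro: word_span.scale)
  qed
next
  case (add a c)
  then show ?case by (auto simp: blinfun_compose_add_left intro: word_span.add)
next
  case (scale a c)
  then show ?case by (auto simp: blinfun_compose_scaleC_left intro: word_span.scale)
qed

text \<open>In the vector state of \<open>\<chi>\<^bsub>[0,R]\<^esub>\<close> a word has its trace as expectation.\<close>

lemma cinner_word_cut:
  assumes "0 < R" "fs \<noteq> []" "\<forall>f\<in>set fs. f \<in> Linf \<and> supported_upto R f"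
  shows "cinner (blinfun_apply (sc_word \<iota> (X R) fs) (\<Lambda> (cut R))) (\<Lambda> (cut R)) = (LINT x|half_line. sc_moment fs x)"
proof -
  let ?w = "sc_word \<iota> (X R) fs"
  have wM: "?w \<in> M" using assms by (intro word_M) auto
  obtain fs' f where fs: "fs = fs' @ [f]" using \<open>fs \<noteq> []\<close> by (metis rev_exhaust)
  have wc: "?w o\<^sub>L cut R = ?w" unfolding fs by (rule word_cut) (use assms fs in auto)
  have "cinner (blinfun_apply ?w (\<Lambda> (cut R))) (\<Lambda> (cut R)) = linear_trace M Tr (adj (cut R) o\<^sub>L (?w o\<^sub>L cut R))"
    using L2_cinner[OF square_integrable_compose_cut(1)[OF wM] square_integrable_cut] \<Lambda>_compose_cut[OF wM] by metis
  also have "\<dots> = linear_trace M Tr (\<iota> (indicator {0..R}) o\<^sub>L ?w)"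
    by (simp only: wc chi_selfadjoint) (simp add: chi_def)
  also have "\<dots> = (LINT x|half_line. indicator {0..R} x * sc_moment fs x)"
    using semicircular[OF assms] Linf_indicator by (simp add: has_cond_expectation_def)
  also have "\<dots> = (LINT x|half_line. sc_moment fs x)"
  proof (rule Bochner_Integration.integral_cong[OF refl])
    fix x assume "x \<in> space half_line"
    then have x: "0 \<le> x" by simp
    obtain g gs where gs: "fs = g # gs" using \<open>fs \<noteq> []\<close> by (cases fs) auto
    have "sc_moment fs x = 0" if "R < x"
      unfolding gs by (rule sc_moment_support) (use assms gs that in \<open>auto simp: supported_upto_def\<close>)
    then show "indicator {0..R} x * sc_moment fs x = sc_moment fs x" using x by (auto simp: indicator_def)
  qed
  finally show ?thesis .
qed

abbreviation "\<F> \<equiv> {f. \<exists>g. dilation_derivative f g}"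

lemma \<F>_Linf: "\<F> \<subseteq> Linf"
  using dilation_derivative_Linf by blast

lemma supported_upto_dilate: "supported_upto r f \<Longrightarrow> 0 < t \<Longrightarrow> supported_upto (t * r) (dilate t f)"
  by (simp add: supported_upto_def pos_less_divide_eq mult.commute)

lemma supported_upto_mono: "supported_upto r f \<Longrightarrow> r \<le> s \<Longrightarrow> supported_upto s f"
  by (simp add: supported_upto_def)

lemma \<alpha>_strong_derivative:
  assumes "strong_derivative (\<lambda>t. \<alpha> t a) a'" "a \<in> M"
  shows \<alpha>_strong_derivative_scaleC: "strong_derivative (\<lambda>t. \<alpha> t (c *\<^sub>C a)) (c *\<^sub>C a')"
    and \<alpha>_strong_derivative_add: "strong_derivative (\<lambda>t. \<alpha> t b) b' \<Longrightarrow> b \<in> M \<Longrightarrow>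
      strong_derivative (\<lambda>t. \<alpha> t (a + b)) (a' + b')"
    and \<alpha>_strong_derivative_compose: "strong_derivative (\<lambda>t. \<alpha> t b) b' \<Longrightarrow> b \<in> M \<Longrightarrow>
      strong_derivative (\<lambda>t. \<alpha> t (a o\<^sub>L b)) ((a' o\<^sub>L \<alpha> 1 b) + (\<alpha> 1 a o\<^sub>L b'))"
proof -
  have near: "\<forall>\<^sub>F t::real in at 1. 0 < t" using eventually_at_1_near by eventually_elim simp
  have "strong_derivative (\<lambda>t. (c *\<^sub>C id_blinfun) o\<^sub>L \<alpha> t a) (c *\<^sub>C a')"
    using strong_derivative_compose[OF strong_derivative_const[of "c *\<^sub>C id_blinfun"] assms(1)]
    by (simp add: blinfun_compose_scaleC_left id_blinfun_compose
        bounded_bilinear.zero_left[OF bounded_bilinear_blinfun_compose])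
  then show "strong_derivative (\<lambda>t. \<alpha> t (c *\<^sub>C a)) (c *\<^sub>C a')"
    by (rule strong_derivative_cong) (use near in eventually_elim,
      simp_all add: \<alpha>_scaleC assms(2) blinfun_compose_scaleC_left id_blinfun_compose)
  assume b: "strong_derivative (\<lambda>t. \<alpha> t b) b'" "b \<in> M"
  from strong_derivative_add[OF assms(1) b(1)]
  show "strong_derivative (\<lambda>t. \<alpha> t (a + b)) (a' + b')"
    by (rule strong_derivative_cong) (use near in eventually_elim, simp_all add: \<alpha>_add assms(2) b(2))
  from strong_derivative_compose[OF assms(1) b(1)]
  show "strong_derivative (\<lambda>t. \<alpha> t (a o\<^sub>L b)) ((a' o\<^sub>L \<alpha> 1 b) + (\<alpha> 1 a o\<^sub>L b'))"
    by (rule strong_derivative_cong) (use near in eventually_elim, simp_all add: \<alpha>_compose assms(2) b(2))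
qed

text \<open>The trace of \<open>\<alpha>\<^sub>t(a)\<close> is \<open>t\<close> times the trace of \<open>a\<close>, hence the derivative of \<open>\<alpha>\<^sub>t(a)\<close> at \<open>1\<close> has the
  trace of \<open>a\<close>. The trace is expressed by the vector states of large cutoffs: elements of the span
  have bounded support, which is moved but stays bounded under the dilations near \<open>t = 1\<close>.\<close>

lemma word_span_derivative:
  assumes "a \<in> word_span \<F>"
  shows "\<alpha> 1 a = a \<and> (\<exists>a'. strong_derivative (\<lambda>t. \<alpha> t a) a' \<and>
    (\<exists>R0. \<forall>R\<ge>R0. cinner (blinfun_apply a' (\<Lambda> (cut R))) (\<Lambda> (cut R)) = cinner (blinfun_apply a (\<Lambda> (cut R))) (\<Lambda> (cut R))))"
  using assms
proof induction
  case (word fs r)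
  have L: "\<forall>f\<in>set fs. f \<in> Linf" using word \<F>_Linf by blast
  define n where "n = (real (length fs) - 1) / 2"
  have \<alpha>w: "\<alpha> t (sc_word \<iota> (X r) fs) = (t powr (- n)) *\<^sub>R sc_word \<iota> (X R) (map (dilate t) fs)"
    if "0 < t" "t * r \<le> R" for t R
  proof -
    have "sc_word \<iota> (X (t * r)) (map (dilate t) fs) = sc_word \<iota> (X R) (map (dilate t) fs)"
      using word that L by (intro word_radius) (auto intro: Linf_dilate supported_upto_dilate)
    then show ?thesis using \<alpha>_word[OF that(1) word(2,1)] L by (simp add: n_def subset_iff)
  qed
  have one: "\<alpha> 1 (sc_word \<iota> (X r) fs) = sc_word \<iota> (X r) fs"
    using \<alpha>w[of 1 r] by (simp add: map_idI)
  \<comment> \<open>the radius \<open>2 r\<close> serves all \<open>t < 2\<close>\<close>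
  obtain d where d: "strong_derivative (\<lambda>t. sc_word \<iota> (X (2 * r)) (map (dilate t) fs)) d"
    using word_strong_derivative[of fs] word by blast
  have "((\<lambda>t. t powr (- n)) has_real_derivative - n) (at 1)"
    by (auto intro!: derivative_eq_intros)
  from strong_derivative_scaleR[OF this d]
  obtain a' where "strong_derivative (\<lambda>t. (t powr (- n)) *\<^sub>R sc_word \<iota> (X (2 * r)) (map (dilate t) fs)) a'" by blast
  then have a': "strong_derivative (\<lambda>t. \<alpha> t (sc_word \<iota> (X r) fs)) a'"
  proof (rule strong_derivative_cong)
    show "\<forall>\<^sub>F t in at 1. (t powr (- n)) *\<^sub>R sc_word \<iota> (X (2 * r)) (map (dilate t) fs) = \<alpha> t (sc_word \<iota> (X r) fs)"
      using eventually_at_1_near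
    proof eventually_elim
      case (elim t)
      then show ?case using \<alpha>w[of t "2 * r"] word(2) by simp
    qed
    show "(1 powr (- n)) *\<^sub>R sc_word \<iota> (X (2 * r)) (map (dilate 1) fs) = \<alpha> 1 (sc_word \<iota> (X r) fs)"
      using \<alpha>w[of 1 "2 * r"] word(2) by simp
  qed
  have "cinner (blinfun_apply a' (\<Lambda> (cut R))) (\<Lambda> (cut R))
      = cinner (blinfun_apply (sc_word \<iota> (X r) fs) (\<Lambda> (cut R))) (\<Lambda> (cut R))" if R: "2 * r \<le> R" for R
  proof -
    let ?c = "\<lambda>t. cinner (blinfun_apply (\<alpha> t (sc_word \<iota> (X r) fs)) (\<Lambda> (cut R))) (\<Lambda> (cut R))"
    let ?I = "LINT x|half_line. sc_moment fs x"
    have R0: "0 < R" using R word(2) by simp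
    have c: "?c t = of_real t * ?I" if "t \<in> {0<..<2}" for t
    proof -
      have tr: "t * r \<le> R" using that R word(2) by (intro order_trans[OF _ R] mult_right_mono) auto
      have t0: "0 < t" using that by simp
      have "cinner (blinfun_apply (sc_word \<iota> (X R) (map (dilate t) fs)) (\<Lambda> (cut R))) (\<Lambda> (cut R))
          = (LINT x|half_line. sc_moment (map (dilate t) fs) x)"
        using word L tr t0 R0
        by (intro cinner_word_cut) (auto intro!: Linf_dilate supported_upto_mono[OF supported_upto_dilate])
      also have "\<dots> = of_real (t powr n) * (of_real t * ?I)"
        by (simp add: sc_moment_dilate[OF t0 word(1)] integral_dilate[OF t0] n_def)
      finally show ?thesis using t0
        by (simp add: \<alpha>w[OF t0 tr] blinfun.scaleR_left cinner_scaleR_left powr_minus)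
    qed
    have "bounded_linear (\<lambda>x. cinner x (\<Lambda> (cut R)))"
      by (rule bounded_linear_cinner_left)
    from bounded_linear.has_vector_derivative[OF this strong_derivativeD[OF a']]
    have "(?c has_vector_derivative cinner (blinfun_apply a' (\<Lambda> (cut R))) (\<Lambda> (cut R))) (at 1)" .
    moreover have "(?c has_vector_derivative ?I) (at 1)"
    proof (rule has_vector_derivative_transform_within_open[of "\<lambda>t. of_real t * ?I" _ _ "{0<..<2}"])
      have "((\<lambda>t. t *\<^sub>R ?I) has_vector_derivative 1 *\<^sub>R ?I) (at 1)"
        by (rule bounded_linear.has_vector_derivative[OF bounded_linear_scaleR_left has_vector_derivative_id])
      then show "((\<lambda>t. of_real t * ?I) has_vector_derivative ?I) (at 1)" by (simp add: scaleR_conv_of_real)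
    qed (use c in auto)
    ultimately have "cinner (blinfun_apply a' (\<Lambda> (cut R))) (\<Lambda> (cut R)) = ?I"
      by (rule vector_derivative_unique_at)
    then show ?thesis using c[of 1] one by simp
  qed
  then show ?case using one a' by blast
next
  case (add a b)
  then obtain a' b' Ra Rb where d: "strong_derivative (\<lambda>t. \<alpha> t a) a'" "strong_derivative (\<lambda>t. \<alpha> t b) b'"
    and one: "\<alpha> 1 a = a" "\<alpha> 1 b = b"
    and R: "\<forall>R\<ge>Ra. cinner (blinfun_apply a' (\<Lambda> (cut R))) (\<Lambda> (cut R)) = cinner (blinfun_apply a (\<Lambda> (cut R))) (\<Lambda> (cut R))"
      "\<forall>R\<ge>Rb. cinner (blinfun_apply b' (\<Lambda> (cut R))) (\<Lambda> (cut R)) = cinner (blinfun_apply b (\<Lambda> (cut R))) (\<Lambda> (cut R))"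
    by blast
  have ab: "a \<in> M" "b \<in> M" using word_span_M[OF _ \<F>_Linf] add.hyps by auto
  have "strong_derivative (\<lambda>t. \<alpha> t (a + b)) (a' + b')"
    by (rule \<alpha>_strong_derivative_add[OF d(1) ab(1) d(2) ab(2)])
  moreover have "\<forall>R\<ge>max Ra Rb. cinner (blinfun_apply (a' + b') (\<Lambda> (cut R))) (\<Lambda> (cut R))
      = cinner (blinfun_apply (a + b) (\<Lambda> (cut R))) (\<Lambda> (cut R))"
    using R by (simp add: blinfun.add_left cinner_add_left)
  moreover have "\<alpha> 1 (a + b) = a + b" using one by (simp add: \<alpha>_add ab)
  ultimately show ?case by blast
next
  case (scale a c)
  then obtain a' Ra where d: "strong_derivative (\<lambda>t. \<alpha> t a) a'" and one: "\<alpha> 1 a = a"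
    and R: "\<forall>R\<ge>Ra. cinner (blinfun_apply a' (\<Lambda> (cut R))) (\<Lambda> (cut R)) = cinner (blinfun_apply a (\<Lambda> (cut R))) (\<Lambda> (cut R))"
    by blast
  have aM: "a \<in> M" using word_span_M[OF _ \<F>_Linf] scale.hyps by auto
  have "strong_derivative (\<lambda>t. \<alpha> t (c *\<^sub>C a)) (c *\<^sub>C a')"
    by (rule \<alpha>_strong_derivative_scaleC[OF d aM])
  moreover have "\<forall>R\<ge>Ra. cinner (blinfun_apply (c *\<^sub>C a') (\<Lambda> (cut R))) (\<Lambda> (cut R))
      = cinner (blinfun_apply (c *\<^sub>C a) (\<Lambda> (cut R))) (\<Lambda> (cut R))"
    using R by (simp add: cinner_scaleC_left)
  moreover have "\<alpha> 1 (c *\<^sub>C a) = c *\<^sub>C a" using one by (simp add: \<alpha>_scaleC aM)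
  ultimately show ?case by blast
qed

section \<open>The derivation\<close>

abbreviation "N \<equiv> corner \<iota> X"
abbreviation "D \<equiv> deriv_domain \<iota> X"
abbreviation "\<delta> \<equiv> dilation_deriv \<iota> X \<Lambda> \<alpha>"
abbreviation "\<Omega> \<equiv> \<Lambda> (cut 1)"

lemma corner_iff: "b \<in> N \<longleftrightarrow> b \<in> M \<and> cut 1 o\<^sub>L b = b \<and> b o\<^sub>L cut 1 = b"
proof
  assume "b \<in> N"
  then obtain a where a: "a \<in> M" "b = cut 1 o\<^sub>L a o\<^sub>L cut 1" by (auto simp: corner_def)
  then have "b \<in> M" by (simp add: M_compose chi_M)
  moreover have "cut 1 o\<^sub>L b = b"
    unfolding a(2) by (simp add: chi_compose flip: blinfun_compose_assoc)
  moreover have "b o\<^sub>L cut 1 = b"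
    unfolding a(2) by (simp add: chi_compose blinfun_compose_assoc)
  ultimately show "b \<in> M \<and> cut 1 o\<^sub>L b = b \<and> b o\<^sub>L cut 1 = b" by blast
next
  assume "b \<in> M \<and> cut 1 o\<^sub>L b = b \<and> b o\<^sub>L cut 1 = b"
  then show "b \<in> N" unfolding corner_def by (intro CollectI exI[of _ b]) simp
qed

lemma N_M: "a \<in> N \<Longrightarrow> a \<in> M"
  by (simp add: corner_iff)

lemma N_add: "a \<in> N \<Longrightarrow> b \<in> N \<Longrightarrow> a + b \<in> N"
  by (simp add: corner_iff M_add blinfun_compose_add_left blinfun_compose_add_right)

lemma N_scaleC: "a \<in> N \<Longrightarrow> c *\<^sub>C a \<in> N"
  by (simp add: corner_iff M_scaleC blinfun_compose_scaleC_left blinfun_compose_scaleC_right M_bounded chi_M)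

lemma N_compose: "a \<in> N \<Longrightarrow> b \<in> N \<Longrightarrow> a o\<^sub>L b \<in> N"
  by (simp add: corner_iff M_compose) (metis blinfun_compose_assoc)

lemma N_diff: "a \<in> N \<Longrightarrow> b \<in> N \<Longrightarrow> a - b \<in> N"
  using N_add[OF _ N_scaleC[of b "-1"], of a] by (simp add: scaleC_minus_one)

lemma \<Lambda>_N: "a \<in> N \<Longrightarrow> \<Lambda> a = blinfun_apply a \<Omega>"
  using \<Lambda>_compose_cut[of a 1] by (simp add: corner_iff)

lemma N_separating: "a \<in> N \<Longrightarrow> b \<in> N \<Longrightarrow> \<Lambda> a = \<Lambda> b \<Longrightarrow> a = b"
  using cut_separating[of "a - b" 1] N_diff[of a b]
  by (simp add: \<Lambda>_N corner_iff blinfun.diff_left)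

lemma C10_Linf: "f \<in> C10 \<Longrightarrow> f \<in> Linf"
  using C10_dilation_derivative dilation_derivative_Linf by blast

lemma Dc_Linf: "f \<in> Dc \<Longrightarrow> f \<in> Linf"
  using Dc_dilation_derivative dilation_derivative_Linf by blast

lemma C10_supported: "f \<in> C10 \<Longrightarrow> supported_upto 1 f"
  by (auto simp: C10_def supported_upto_def)

lemma D_N: "a \<in> D \<Longrightarrow> a \<in> N"
proof (induction rule: deriv_domain.induct)
  case (embed f)
  then show ?case by (simp add: corner_iff iota_M C10_Linf chi_iota C10_supported)
next
  case (word f g fs r)
  have "sc_word \<iota> (X r) (f # fs @ [g]) \<in> M"
    using word by (intro word_M) (auto intro: C10_Linf Dc_Linf)
  moreover have "cut 1 o\<^sub>L sc_word \<iota> (X r) (f # fs @ [g]) = sc_word \<iota> (X r) (f # fs @ [g])"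
    by (rule cut_word) (use word in \<open>auto intro: C10_Linf C10_supported\<close>)
  moreover have "sc_word \<iota> (X r) ((f # fs) @ [g]) o\<^sub>L cut 1 = sc_word \<iota> (X r) ((f # fs) @ [g])"
    by (rule word_cut) (use word in \<open>auto intro: C10_Linf C10_supported\<close>)
  ultimately show ?case by (simp add: corner_iff)
qed (auto intro: N_add N_scaleC N_compose)

lemma D_word_span: "a \<in> D \<Longrightarrow> a \<in> word_span \<F>"
proof (induction rule: deriv_domain.induct)
  case (embed f)
  then show ?case
    using word_span.word[of "[f]" 1 \<F>] by (simp add: C10_dilation_derivative C10_supported)
next
  case (word f g fs r)
  then show ?case
    by (intro word_span.word) (auto intro: C10_dilation_derivative Dc_dilation_derivative)
next
  case (mult a b)
  then show ?case
    using word_span_mult[OF _ _ \<F>_Linf] dilation_derivative_mult by blast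
qed (auto intro: word_span.intros)

text \<open>For \<open>t < 1\<close> the automorphism \<open>\<alpha>\<^sub>t\<close> maps the corner into the smaller corner of \<open>\<chi>\<^bsub>[0,t]\<^esub>\<close>. So the
  difference quotients from the left belong to the corner, which is strongly closed.\<close>

lemma strong_derivative_corner:
  assumes a: "a \<in> N" and d: "strong_derivative (\<lambda>t. \<alpha> t a) a'"
  shows "a' \<in> N"
proof -
  have \<alpha>N: "\<alpha> t a \<in> N" if t: "0 < t" "t \<le> 1" for t
  proof -
    have aM: "a \<in> M" using a by (rule N_M)
    have "dilate t (indicator {0..1}) = indicator {0..t}"
      using t by (auto simp: fun_eq_iff indicator_def zero_le_divide_iff)
    then have c: "\<alpha> t (cut 1) = cut t"
      using \<alpha>_iota[OF t(1) Linf_indicator[of 1]] by (simp add: chi_def)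
    have "cut t o\<^sub>L \<alpha> t a = \<alpha> t a" "\<alpha> t a o\<^sub>L cut t = \<alpha> t a"
      using a \<alpha>_compose[OF t(1) chi_M aM, of 1] \<alpha>_compose[OF t(1) aM chi_M, of 1]
      by (simp_all add: c corner_iff)
    then show ?thesis
      using t chi_compose[OF t(2)] \<alpha>_M[OF t(1) aM] by (metis blinfun_compose_assoc corner_iff)
  qed
  have one: "\<alpha> 1 a \<in> N" by (rule \<alpha>N) auto
  let ?q = "\<lambda>t. (1 / (t - 1)) *\<^sub>R (\<alpha> t a - \<alpha> 1 a)"
  have "\<forall>\<^sub>F t::real in at_left 1. 0 < t \<and> t \<le> 1"
    using eventually_at_left_real[of 0 1] by (auto elim: eventually_mono)
  then have qN: "\<forall>\<^sub>F t in at_left 1. ?q t \<in> N"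
    by eventually_elim (use one in \<open>simp add: scaleR_scaleC N_scaleC N_diff \<alpha>N\<close>)
  have lim: "((\<lambda>t. blinfun_apply (?q t) \<xi>) \<longlongrightarrow> blinfun_apply a' \<xi>) (at_left 1)" for \<xi>
    using strong_derivativeD[OF d, of \<xi>] unfolding has_vector_derivative_iff_quotient
    by (simp add: blinfun.scaleR_left blinfun.diff_left filterlim_at_split)
  have "\<forall>\<^sub>F t in at_left 1. ?q t \<in> commutant (commutant gens)"
    using qN by eventually_elim (drule N_M, simp add: sc_algebra_def generated_vN_def)
  from commutant_strong_limit[OF _ this lim] have "a' \<in> M"
    by (simp add: sc_algebra_def generated_vN_def)
  moreover have "blinfun_apply (cut 1) (blinfun_apply a' \<xi>) = blinfun_apply a' \<xi>" for \<xi>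
  proof (rule tendsto_unique[OF _ _ lim])
    have "((\<lambda>t. blinfun_apply (cut 1) (blinfun_apply (?q t) \<xi>)) \<longlongrightarrow> blinfun_apply (cut 1) (blinfun_apply a' \<xi>)) (at_left 1)"
      by (rule blinfun.tendsto[OF tendsto_const lim])
    then show "((\<lambda>t. blinfun_apply (?q t) \<xi>) \<longlongrightarrow> blinfun_apply (cut 1) (blinfun_apply a' \<xi>)) (at_left 1)"
    proof (rule Lim_transform_eventually)
      show "\<forall>\<^sub>F t in at_left 1. blinfun_apply (cut 1) (blinfun_apply (?q t) \<xi>) = blinfun_apply (?q t) \<xi>"
        using qN by eventually_elim (metis corner_iff blinfun_apply_blinfun_compose)
    qed
  qed simp
  moreover have "blinfun_apply a' (blinfun_apply (cut 1) \<xi>) = blinfun_apply a' \<xi>" for \<xi>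
  proof (rule tendsto_unique[OF _ _ lim])
    show "((\<lambda>t. blinfun_apply (?q t) \<xi>) \<longlongrightarrow> blinfun_apply a' (blinfun_apply (cut 1) \<xi>)) (at_left 1)"
      using lim[of "blinfun_apply (cut 1) \<xi>"]
    proof (rule Lim_transform_eventually)
      show "\<forall>\<^sub>F t in at_left 1. blinfun_apply (?q t) (blinfun_apply (cut 1) \<xi>) = blinfun_apply (?q t) \<xi>"
        using qN by eventually_elim (metis corner_iff blinfun_apply_blinfun_compose)
    qed
  qed simp
  ultimately show ?thesis by (auto simp: corner_iff intro!: blinfun_eqI)
qed

lemma strong_derivative_dilation:
  assumes a: "a \<in> N" and d: "strong_derivative (\<lambda>t. \<alpha> t a) a'"
  shows "has_dilation_derivative \<iota> \<Lambda> \<alpha> a a'" and "\<delta> a = a'"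
proof -
  have a': "a' \<in> N" by (rule strong_derivative_corner[OF assms])
  have "((\<lambda>t. blinfun_apply (cut 1) (blinfun_apply (\<alpha> t a) \<Omega>)) has_vector_derivative
      blinfun_apply (cut 1) (blinfun_apply a' \<Omega>)) (at 1)"
    by (rule bounded_linear.has_vector_derivative[OF blinfun.bounded_linear_right strong_derivativeD[OF d]])
  moreover have "blinfun_apply (cut 1) (blinfun_apply a' \<Omega>) = \<Lambda> a'"
    using a' by (simp add: \<Lambda>_N) (metis corner_iff blinfun_apply_blinfun_compose)
  ultimately have "((\<lambda>t. blinfun_apply (cut 1) (blinfun_apply (\<alpha> t a) \<Omega>)) has_vector_derivative \<Lambda> a') (at 1)"
    by simp
  then show dd: "has_dilation_derivative \<iota> \<Lambda> \<alpha> a a'"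
    unfolding has_dilation_derivative_def
  proof (rule has_vector_derivative_transform_within_open[of _ _ _ "{0<..}"])
    fix t :: real assume "t \<in> {0<..}"
    then have "cut 1 o\<^sub>L \<alpha> t a \<in> M" using \<alpha>_M[OF _ N_M[OF a]] by (simp add: M_compose chi_M)
    from \<Lambda>_compose_cut[OF this]
    show "blinfun_apply (cut 1) (blinfun_apply (\<alpha> t a) \<Omega>) = \<Lambda> (cut 1 o\<^sub>L \<alpha> t a o\<^sub>L cut 1)" by simp
  qed auto
  show "\<delta> a = a'"
    unfolding dilation_deriv_def
  proof (rule the_equality)
    fix d assume "d \<in> N \<and> has_dilation_derivative \<iota> \<Lambda> \<alpha> a d"
    then have "d \<in> N" "\<Lambda> d = \<Lambda> a'"
      using dd vector_derivative_unique_at unfolding has_dilation_derivative_def by blast+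
    then show "d = a'" using N_separating a' by blast
  qed (use a' dd in blast)
qed

lemma D_derivative:
  assumes a: "a \<in> D"
  shows "strong_derivative (\<lambda>t. \<alpha> t a) (\<delta> a)" and "\<alpha> 1 a = a" and "\<delta> a \<in> N"
    and "has_dilation_derivative \<iota> \<Lambda> \<alpha> a (\<delta> a)"
proof -
  obtain a' where "strong_derivative (\<lambda>t. \<alpha> t a) a'" and one: "\<alpha> 1 a = a"
    using word_span_derivative[OF D_word_span[OF a]] by blast
  with strong_derivative_dilation[OF D_N[OF a]] strong_derivative_corner[OF D_N[OF a]]
  show "strong_derivative (\<lambda>t. \<alpha> t a) (\<delta> a)" "\<alpha> 1 a = a" "\<delta> a \<in> N"
    "has_dilation_derivative \<iota> \<Lambda> \<alpha> a (\<delta> a)" by auto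
qed

lemma derivation: "is_derivation D N \<delta>"
proof -
  have M: "a \<in> M" if "a \<in> D" for a using that by (intro N_M D_N)
  obtain a0 where a0: "a0 \<in> D"
    using deriv_domain.embed[OF flat_algebra_C10[OF flat_algebra.bump]] by blast
  have "0 \<in> D" using deriv_domain.scale[OF a0, where c = 0] by simp
  then have "is_subalgebra D" by (auto simp: is_subalgebra_def intro: deriv_domain.intros)
  moreover have "\<delta> (a + b) = \<delta> a + \<delta> b" if "a \<in> D" "b \<in> D" for a b
    using that by (intro strong_derivative_dilation(2) \<alpha>_strong_derivative_add D_derivative(1) M
        D_N deriv_domain.add)
  moreover have "\<delta> (a o\<^sub>L b) = (\<delta> a o\<^sub>L b) + (a o\<^sub>L \<delta> b)" if "a \<in> D" "b \<in> D" for a b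
    using strong_derivative_dilation(2)[OF D_N[OF deriv_domain.mult[OF that]]
        \<alpha>_strong_derivative_compose[OF D_derivative(1)[OF that(1)] M[OF that(1)] D_derivative(1)[OF that(2)] M[OF that(2)]]]
    by (simp add: D_derivative(2) that)
  moreover have "\<delta> (c *\<^sub>C a) = c *\<^sub>C \<delta> a" if "a \<in> D" for a c
    using that by (intro strong_derivative_dilation(2) \<alpha>_strong_derivative_scaleC D_derivative(1) M
        D_N deriv_domain.scale)
  ultimately show ?thesis
    unfolding is_derivation_def using D_N D_derivative(3) by blast
qed

text \<open>Elements of the corner do not distinguish the vector states of \<open>\<chi>\<^bsub>[0,R]\<^esub>\<close> for \<open>R \<ge> 1\<close>.\<close>

lemma trace_derivative:
  assumes a: "a \<in> D"
  shows "cinner (\<Lambda> (\<delta> a)) \<Omega> = cinner (\<Lambda> a) \<Omega>"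
proof -
  obtain a' R0 where d: "strong_derivative (\<lambda>t. \<alpha> t a) a'"
    and R0: "\<And>R. R0 \<le> R \<Longrightarrow> cinner (blinfun_apply a' (\<Lambda> (cut R))) (\<Lambda> (cut R)) = cinner (blinfun_apply a (\<Lambda> (cut R))) (\<Lambda> (cut R))"
    using word_span_derivative[OF D_word_span[OF a]] by blast
  have a': "a' = \<delta> a" by (rule strong_derivative_dilation(2)[OF D_N[OF a] d, symmetric])
  define R where "R = max R0 1"
  have R: "R0 \<le> R" "1 \<le> R" by (auto simp: R_def)
  have "cinner (blinfun_apply b (\<Lambda> (cut R))) (\<Lambda> (cut R)) = cinner (\<Lambda> b) \<Omega>" if b: "b \<in> N" for b
  proof -
    have "cinner (blinfun_apply b (\<Lambda> (cut R))) (\<Lambda> (cut R))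
        = cinner (blinfun_apply (cut 1 o\<^sub>L b o\<^sub>L cut 1) (\<Lambda> (cut R))) (\<Lambda> (cut R))"
      using b by (simp add: corner_iff del: blinfun_apply_blinfun_compose)
    also have "\<dots> = cinner (blinfun_apply b \<Omega>) (blinfun_apply (adj (cut 1)) (\<Lambda> (cut R)))"
      by (simp add: cinner_adj[OF M_bounded[OF chi_M]] cut_vector(1)[OF R(2)])
    also have "\<dots> = cinner (\<Lambda> b) \<Omega>"
      by (simp add: chi_selfadjoint cut_vector(1)[OF R(2)] \<Lambda>_N b)
    finally show ?thesis .
  qed
  from this[OF D_derivative(3)[OF a]] this[OF D_N[OF a]] R0[OF R(1)] show ?thesis
    by (simp add: a')
qed


section \<open>Density of the domain\<close>

lemma flat_strong_approximation:
  assumes "f \<in> Linf" "supported_upto r f" "0 < r"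
  shows "\<exists>h. (\<forall>n. h n \<in> dilate r ` flat_algebra) \<and>
    (\<forall>\<xi>. (\<lambda>n. blinfun_apply (\<iota> (h n)) \<xi>) \<longlonglongrightarrow> blinfun_apply (\<iota> f) \<xi>)"
proof -
  have "dilate (1 / r) f \<in> Linf" "supported_upto 1 (dilate (1 / r) f)"
    using Linf_dilate[OF assms(1), of "1 / r"] supported_upto_dilate[OF assms(2), of "1 / r"] assms(3) by auto
  then obtain C g where g: "\<And>n. g n \<in> flat_algebra" and C: "\<And>n x. 0 \<le> x \<Longrightarrow> cmod (g n x) \<le> C"
    and lim: "AE x in half_line. (\<lambda>n. g n x) \<longlonglongrightarrow> dilate (1 / r) f x"
    by (rule flat_algebra_approximation) blast
  have "(\<lambda>n. blinfun_apply (\<iota> (dilate r (g n))) \<xi>) \<longlonglongrightarrow> blinfun_apply (\<iota> f) \<xi>" for \<xi>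
  proof (rule iota_strong_limit[OF _ assms(1)])
    show "dilate r (g n) \<in> Linf" for n by (intro Linf_dilate C10_Linf flat_algebra_C10 g assms(3))
    show "AE x in half_line. cmod (g n (x / r)) \<le> C" for n
      unfolding AE_half_line using assms(3) by (auto intro!: C)
    show "AE x in half_line. (\<lambda>n. g n (x / r)) \<longlonglongrightarrow> f x"
      using AE_half_line_scale[OF lim assms(3)] assms(3) by simp
  qed
  then show ?thesis using g by (intro exI[of _ "\<lambda>n. dilate r (g n)"]) auto
qed

text \<open>Coefficients are replaced one at a time with all other factors fixed, so that strong convergence
  of the single factor suffices.\<close>

lemma word_approximation:
  assumes "closed Z" and "fs \<noteq> []"
    and "list_all2 (\<lambda>r f. 0 < r \<and> f \<in> Linf \<and> supported_upto r f) rs fs"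
    and "\<And>gs. list_all2 (\<lambda>r g. g \<in> dilate r ` flat_algebra) rs gs \<Longrightarrow> blinfun_apply T (blinfun_apply (sc_word \<iota> Y gs) \<xi>) \<in> Z"
  shows "blinfun_apply T (blinfun_apply (sc_word \<iota> Y fs) \<xi>) \<in> Z"
  using assms(2-)
proof (induction fs arbitrary: rs T rule: list_nonempty_induct)
  case (single f)
  then obtain r where rs: "rs = [r]" and f: "0 < r" "f \<in> Linf" "supported_upto r f"
    by (auto simp: list_all2_Cons2)
  obtain h where h: "\<And>n. h n \<in> dilate r ` flat_algebra"
    and lim: "\<And>\<xi>. (\<lambda>n. blinfun_apply (\<iota> (h n)) \<xi>) \<longlonglongrightarrow> blinfun_apply (\<iota> f) \<xi>"
    using flat_strong_approximation[OF f(2,3,1)] by blast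
  have "blinfun_apply T (blinfun_apply (\<iota> (h n)) \<xi>) \<in> Z" for n
    using single(2)[of "[h n]"] h by (simp add: rs)
  then have "blinfun_apply T (blinfun_apply (\<iota> f) \<xi>) \<in> Z"
    by (rule closed_sequentially[OF assms(1)]) (rule blinfun.tendsto[OF tendsto_const lim])
  then show ?case by simp
next
  case (cons f fs)
  from cons.prems(1) obtain r rs' where rs: "rs = r # rs'" and f: "0 < r" "f \<in> Linf" "supported_upto r f"
    and fs: "list_all2 (\<lambda>r f. 0 < r \<and> f \<in> Linf \<and> supported_upto r f) rs' fs"
    by (auto simp: list_all2_Cons2)
  obtain h where h: "\<And>n. h n \<in> dilate r ` flat_algebra"
    and lim: "\<And>\<xi>. (\<lambda>n. blinfun_apply (\<iota> (h n)) \<xi>) \<longlonglongrightarrow> blinfun_apply (\<iota> f) \<xi>"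
    using flat_strong_approximation[OF f(2,3,1)] by blast
  have word: "sc_word \<iota> Y (g # gs) = \<iota> g o\<^sub>L (Y o\<^sub>L sc_word \<iota> Y gs)" if "gs \<noteq> []" for g gs
    using that by (cases gs) auto
  let ?\<eta> = "blinfun_apply Y (blinfun_apply (sc_word \<iota> Y fs) \<xi>)"
  have "blinfun_apply T (blinfun_apply (\<iota> (h n)) ?\<eta>) \<in> Z" for n
  proof -
    have "blinfun_apply (T o\<^sub>L (\<iota> (h n) o\<^sub>L Y)) (blinfun_apply (sc_word \<iota> Y fs) \<xi>) \<in> Z"
    proof (rule cons.IH[OF fs])
      fix gs assume gs: "list_all2 (\<lambda>r g. g \<in> dilate r ` flat_algebra) rs' gs"
      have "gs \<noteq> []" using gs fs cons.hyps by auto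
      then show "blinfun_apply (T o\<^sub>L (\<iota> (h n) o\<^sub>L Y)) (blinfun_apply (sc_word \<iota> Y gs) \<xi>) \<in> Z"
        using cons.prems(2)[of "h n # gs"] gs h by (simp add: rs word)
    qed
    then show ?thesis by simp
  qed
  then have "blinfun_apply T (blinfun_apply (\<iota> f) ?\<eta>) \<in> Z"
    by (rule closed_sequentially[OF assms(1)]) (rule blinfun.tendsto[OF tendsto_const lim])
  then show ?case using cons.hyps by (simp add: word)
qed

text \<open>The projections on both sides cut the outer coefficients down to \<open>[0,1]\<close>, where they are limits of
  elements of \<^const>\<open>C10\<close>; the inner ones are limits of elements of \<^const>\<open>Dc\<close>.\<close>

lemma word_in_closure:
  assumes "fs \<noteq> []" "0 < r" "\<forall>f\<in>set fs. f \<in> Linf \<and> supported_upto r f"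
  shows "blinfun_apply (cut 1) (blinfun_apply (sc_word \<iota> (X r) fs) \<Omega>) \<in> closure (\<Lambda> ` D)"
proof -
  have in_D: "blinfun_apply a \<Omega> \<in> closure (\<Lambda> ` D)" if "a \<in> D" for a
    using that closure_subset[of "\<Lambda> ` D"] by (auto simp flip: \<Lambda>_N[OF D_N])
  have ind: "(\<lambda>x. indicator {0..1} x * f x) \<in> Linf" "supported_upto 1 (\<lambda>x. indicator {0..1} x * f x)"
    if "f \<in> Linf" for f :: "real \<Rightarrow> complex"
    using that by (auto intro: Linf_mult Linf_indicator simp: supported_upto_def)
  have cut_iota: "cut 1 o\<^sub>L \<iota> f = \<iota> (\<lambda>x. indicator {0..1} x * f x)"
    "\<iota> f o\<^sub>L cut 1 = \<iota> (\<lambda>x. indicator {0..1} x * f x)" if "f \<in> Linf" for f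
    using embed_mult[OF Linf_indicator that, of 1] embed_mult[OF that Linf_indicator, of 1]
    by (simp_all add: chi_def mult.commute)
  define R where "R = max r 1"
  have R: "0 < R" "r \<le> R" "1 \<le> R" using assms(2) by (auto simp: R_def)
  have wR: "sc_word \<iota> (X r) fs = sc_word \<iota> (X R) fs" using assms R by (intro word_radius) auto
  have fsR: "\<forall>f\<in>set fs. f \<in> Linf \<and> supported_upto R f" using assms R supported_upto_mono by blast
  obtain f fs' where fs: "fs = f # fs'" using assms(1) by (cases fs) auto
  show ?thesis
  proof (cases "fs' = []")
    case True
    let ?f = "\<lambda>x. indicator {0..1} x * f x"
    have f: "f \<in> Linf" using fs assms by simp
    have "blinfun_apply id_blinfun (blinfun_apply (sc_word \<iota> (X R) [?f]) \<Omega>) \<in> closure (\<Lambda> ` D)"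
    proof (rule word_approximation[where rs = "[1]"])
      fix gs assume "list_all2 (\<lambda>r g. g \<in> dilate r ` flat_algebra) [1] gs"
      then obtain g where "gs = [g]" "g \<in> flat_algebra" by (auto simp: list_all2_Cons1)
      then show "blinfun_apply id_blinfun (blinfun_apply (sc_word \<iota> (X R) gs) \<Omega>) \<in> closure (\<Lambda> ` D)"
        using in_D[OF deriv_domain.embed[OF flat_algebra_C10]] by simp
    qed (use ind[OF f] in auto)
    then show ?thesis using cut_iota(1)[OF f] by (simp add: fs True flip: blinfun_apply_blinfun_compose)
  next
    case False
    then obtain mid l where fs': "fs' = mid @ [l]" by (metis rev_exhaust)
    let ?f = "\<lambda>x. indicator {0..1} x * f x" and ?l = "\<lambda>x. indicator {0..1} x * l x"
    have fl: "f \<in> Linf" "l \<in> Linf" and mid: "\<forall>m\<in>set mid. m \<in> Linf \<and> supported_upto R m"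
      using fsR by (auto simp: fs fs')
    have "blinfun_apply id_blinfun (blinfun_apply (sc_word \<iota> (X R) (?f # mid @ [?l])) \<Omega>) \<in> closure (\<Lambda> ` D)"
    proof (rule word_approximation[where rs = "1 # replicate (length mid) R @ [1]"])
      have "list_all2 (\<lambda>r f. 0 < r \<and> f \<in> Linf \<and> supported_upto r f) (replicate (length mid) R) mid"
        using mid R by (auto simp: list_all2_conv_all_nth)
      then show "list_all2 (\<lambda>r f. 0 < r \<and> f \<in> Linf \<and> supported_upto r f)
          (1 # replicate (length mid) R @ [1]) (?f # mid @ [?l])"
        using ind[OF fl(1)] ind[OF fl(2)] by (auto intro!: list_all2_appendI)
    next
      fix gs assume "list_all2 (\<lambda>r g. g \<in> dilate r ` flat_algebra) (1 # replicate (length mid) R @ [1]) gs"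
      then obtain g mid' l' where gs: "gs = g # mid' @ [l']" and g: "g \<in> flat_algebra" "l' \<in> flat_algebra"
        and "list_all2 (\<lambda>r g. g \<in> dilate r ` flat_algebra) (replicate (length mid) R) mid'"
        by (auto simp: list_all2_Cons1 list_all2_append1)
      then have mid': "m \<in> dilate R ` flat_algebra" if "m \<in> set mid'" for m
        using that by (auto simp: list_all2_conv_all_nth in_set_conv_nth)
      have "sc_word \<iota> (X R) gs \<in> D"
        unfolding gs
      proof (rule deriv_domain.word)
        show "set mid' \<subseteq> Dc" using mid' flat_algebra_dilate_Dc R by blast
        have "supported_upto R m" if "m \<in> set mid'" for m
          using mid'[OF that] supported_upto_dilate[OF C10_supported[OF flat_algebra_C10], of _ R] R by auto
        then show "\<forall>h\<in>set (g # mid' @ [l']). supported_upto R h"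
          using g R supported_upto_mono[OF C10_supported[OF flat_algebra_C10]] by auto
      qed (use g R flat_algebra_C10 in auto)
      then show "blinfun_apply id_blinfun (blinfun_apply (sc_word \<iota> (X R) gs) \<Omega>) \<in> closure (\<Lambda> ` D)"
        using in_D by simp
    qed auto
    moreover have "sc_word \<iota> (X R) (?f # mid @ [?l]) = cut 1 o\<^sub>L (sc_word \<iota> (X R) fs o\<^sub>L cut 1)"
    proof -
      have 1: "cut 1 o\<^sub>L sc_word \<iota> (X R) (f # gs) = sc_word \<iota> (X R) (?f # gs)" for gs
        using cut_iota(1)[OF fl(1)] by (cases gs) (simp_all flip: blinfun_compose_assoc)
      have 2: "sc_word \<iota> (X R) ((f # mid) @ [l]) o\<^sub>L cut 1 = sc_word \<iota> (X R) ((f # mid) @ [?l])"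
        using cut_iota(2)[OF fl(2)] by (subst (1 2) word_snoc) (simp_all add: blinfun_compose_assoc)
      show ?thesis using 1[of "mid @ [?l]"] 2 by (simp add: fs fs')
    qed
    moreover have "blinfun_apply (cut 1) \<Omega> = \<Omega>" by (simp add: cut_vector)
    ultimately show ?thesis by (simp add: wR)
  qed
qed

text \<open>A bounded function is absorbed by the first coefficient, and a compression of the semicircular
  element starts a new word. This makes the closure of the word vectors invariant under the generators.\<close>

lemma word_span_Linf_invariant:
  assumes "a \<in> word_span Linf" "b \<in> gens"
  shows "b o\<^sub>L a \<in> word_span Linf"
  using assms(1)
proof induction
  case (word fs r)
  obtain f fs' where fs: "fs = f # fs'" using word(1) by (cases fs) auto
  have fsL: "f \<in> Linf" "supported_upto r f" "\<forall>g\<in>set fs'. g \<in> Linf \<and> supported_upto r g"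
    using word by (auto simp: fs)
  from assms(2) consider (coeff) g where "g \<in> Linf" "b = \<iota> g" | (semi) s where "0 < s" "b = X s" by auto
  then show ?case
  proof cases
    case coeff
    have "b o\<^sub>L sc_word \<iota> (X r) fs = sc_word \<iota> (X r) ((\<lambda>x. g x * f x) # fs')"
      using word_merge[OF coeff(1) fsL(1), of "X r" "[]"] by (simp add: fs coeff(2))
    then show ?thesis
      using word fsL coeff(1) by (auto intro!: word_span.word Linf_mult simp: supported_upto_def)
  next
    case semi
    define R where "R = max r s"
    have R: "0 < R" "r \<le> R" "s \<le> R" using semi by (auto simp: R_def)
    have sup: "supported_upto R g" if "supported_upto r g \<or> supported_upto s g" for g
      using that R by (auto simp: supported_upto_def)
    have 1: "supported_upto s (indicator {0..s})" by (simp add: supported_upto_def)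
    have 2: "supported_upto r (\<lambda>x. indicator {0..s} x * f x)" using fsL by (simp add: supported_upto_def)
    have "b o\<^sub>L sc_word \<iota> (X r) fs = X s o\<^sub>L sc_word \<iota> (X R) fs"
      using word_radius[OF word(2) R(2) word(1)] word semi by simp
    also have "\<dots> = cut s o\<^sub>L (X R o\<^sub>L (cut s o\<^sub>L sc_word \<iota> (X R) fs))"
      using X_compress[OF semi(1) R(3), symmetric] by (simp add: blinfun_compose_assoc)
    also have "cut s o\<^sub>L sc_word \<iota> (X R) fs = sc_word \<iota> (X R) ((\<lambda>x. indicator {0..s} x * f x) # fs')"
      using word_merge[OF Linf_indicator[of s] fsL(1), of "X R" "[]"] by (simp add: fs chi_def)
    also have "cut s o\<^sub>L (X R o\<^sub>L sc_word \<iota> (X R) ((\<lambda>x. indicator {0..s} x * f x) # fs'))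
        = sc_word \<iota> (X R) (indicator {0..s} # (\<lambda>x. indicator {0..s} x * f x) # fs')"
      by (simp add: chi_def)
    also have "\<dots> \<in> word_span Linf"
      using R fsL 1 2 by (intro word_span.word) (auto intro!: Linf_mult Linf_indicator sup)
    finally show ?thesis .
  qed
next
  case (add a c)
  then show ?case by (auto simp: blinfun_compose_add_right intro: word_span.add)
next
  case (scale a c)
  have "b \<in> bounded_ops" using gens_adj[OF assms(2)] by blast
  then show ?case using scale by (auto simp: blinfun_compose_scaleC_right intro: word_span.scale)
qed

lemma M_vector_approximation:
  assumes a: "a \<in> M"
  shows "blinfun_apply a \<Omega> \<in> closure ((\<lambda>b. blinfun_apply b \<Omega>) ` word_span Linf)"
    (is "_ \<in> closure ?V")
proof (rule generated_vN_invariant[of "closure ?V" gens])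
  have cutV: "cut 1 \<in> word_span Linf"
    using word_span.word[of "[indicator {0..1}]" 1 Linf] by (simp add: Linf_indicator supported_upto_def chi_def)
  have Vsub: "x \<in> ?V \<Longrightarrow> x \<in> closure ?V" for x by (rule subsetD[OF closure_subset])
  have "\<Omega> = blinfun_apply (cut 1) \<Omega>" by (simp add: cut_vector)
  then show "\<Omega> \<in> closure ?V" by (intro Vsub) (use cutV in blast)
  have "0 \<in> word_span Linf" using word_span.scale[OF cutV, of 0] by simp
  then show "0 \<in> closure ?V" by (intro Vsub) (force intro!: rev_image_eqI[of 0])
  show "a \<in> generated_vN gens" using a by (simp add: sc_algebra_def)
  show "b \<in> bounded_ops \<and> adj b \<in> gens" if "b \<in> gens" for b using that by (rule gens_adj)
  show "x + y \<in> closure ?V" if "x \<in> closure ?V" "y \<in> closure ?V" for x y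
  proof (rule closure_add[OF _ that])
    fix x y assume "x \<in> ?V" "y \<in> ?V"
    then show "x + y \<in> ?V" by (auto simp: blinfun.add_left[symmetric] intro: word_span.add)
  qed
  show "c *\<^sub>C x \<in> closure ?V" if "x \<in> closure ?V" for c x
  proof (rule closure_bounded_linear_image[OF bounded_linear_scaleC _ that])
    fix x assume "x \<in> ?V"
    then have "c *\<^sub>C x \<in> ?V" by (auto simp flip: blinfun_apply_scaleC intro: word_span.scale)
    then show "c *\<^sub>C x \<in> closure ?V" by (rule Vsub)
  qed
  show "blinfun_apply b x \<in> closure ?V" if b: "b \<in> gens" and x: "x \<in> closure ?V" for b x
  proof (rule closure_bounded_linear_image[OF blinfun.bounded_linear_right _ x])
    fix x assume "x \<in> ?V"
    then obtain a where "a \<in> word_span Linf" "x = blinfun_apply a \<Omega>" by blast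
    then have "blinfun_apply b x = blinfun_apply (b o\<^sub>L a) \<Omega>" "b o\<^sub>L a \<in> word_span Linf"
      using word_span_Linf_invariant[OF _ b] by auto
    then show "blinfun_apply b x \<in> closure ?V" by (intro Vsub) blast
  qed
qed simp

lemma closure_D:
  "closure (\<Lambda> ` D) = closure (\<Lambda> ` N)"
proof (rule antisym)
  show "closure (\<Lambda> ` D) \<subseteq> closure (\<Lambda> ` N)" using D_N by (intro closure_mono) blast
  have Dsub: "x \<in> \<Lambda> ` D \<Longrightarrow> x \<in> closure (\<Lambda> ` D)" for x by (rule subsetD[OF closure_subset])
  have Dadd: "x + y \<in> closure (\<Lambda> ` D)" if "x \<in> closure (\<Lambda> ` D)" "y \<in> closure (\<Lambda> ` D)" for x y
  proof (rule closure_add[OF _ that])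
    fix x y assume "x \<in> \<Lambda> ` D" "y \<in> \<Lambda> ` D"
    then obtain a b where ab: "a \<in> D" "b \<in> D" "x = \<Lambda> a" "y = \<Lambda> b" by blast
    then have "x + y = \<Lambda> (a + b)" by (simp add: \<Lambda>_N D_N N_add blinfun.add_left)
    then show "x + y \<in> \<Lambda> ` D" using ab deriv_domain.add by blast
  qed
  have Dsc: "c *\<^sub>C x \<in> closure (\<Lambda> ` D)" if "x \<in> closure (\<Lambda> ` D)" for c x
  proof (rule closure_bounded_linear_image[OF bounded_linear_scaleC _ that])
    fix x assume "x \<in> \<Lambda> ` D"
    then obtain a where a: "a \<in> D" "x = \<Lambda> a" by blast
    then have "c *\<^sub>C x = \<Lambda> (c *\<^sub>C a)" by (simp add: \<Lambda>_N D_N N_scaleC)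
    then have "c *\<^sub>C x \<in> \<Lambda> ` D" using a deriv_domain.scale by blast
    then show "c *\<^sub>C x \<in> closure (\<Lambda> ` D)" by (rule Dsub)
  qed
  have span: "blinfun_apply (cut 1) (blinfun_apply b \<Omega>) \<in> closure (\<Lambda> ` D)" if "b \<in> word_span Linf" for b
    using that
  proof induction
    case (word fs r)
    then show ?case by (rule word_in_closure)
  next
    case (add a b)
    then show ?case using Dadd by (simp add: blinfun.add_left blinfun.add_right)
  next
    case (scale a c)
    then show ?case using Dsc by (simp add: bounded_opsD[OF M_bounded[OF chi_M]])
  qed
  have "\<Lambda> a \<in> closure (\<Lambda> ` D)" if a: "a \<in> N" for a
  proof -
    have "blinfun_apply (cut 1) (blinfun_apply a \<Omega>) \<in> closure (\<Lambda> ` D)"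
      by (rule closure_bounded_linear_image[OF blinfun.bounded_linear_right _ M_vector_approximation[OF N_M[OF a]]])
         (use span in auto)
    moreover have "blinfun_apply (cut 1) (blinfun_apply a \<Omega>) = \<Lambda> a"
      using a by (simp add: \<Lambda>_N) (metis corner_iff blinfun_apply_blinfun_compose)
    ultimately show ?thesis by simp
  qed
  then show "closure (\<Lambda> ` N) \<subseteq> closure (\<Lambda> ` D)" by (intro closure_minimal) auto
qed

lemma D_adj: "a \<in> D \<Longrightarrow> adj a \<in> D"
proof (induction rule: deriv_domain.induct)
  case (embed f)
  then show ?case using deriv_domain.embed[OF C10_cnj] by (simp add: C10_Linf flip: embed_cnj)
next
  case (word f g fs r)
  have "adj (sc_word \<iota> (X r) (f # fs @ [g]))
      = sc_word \<iota> (X r) ((\<lambda>x. cnj (g x)) # rev (map (\<lambda>f x. cnj (f x)) fs) @ [\<lambda>x. cnj (f x)])"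
    using word by (subst word_adj) (auto intro: C10_Linf Dc_Linf)
  also have "\<dots> \<in> D"
    using word by (intro deriv_domain.word) (auto intro: C10_cnj Dc_cnj simp: supported_upto_def)
  finally show ?case .
next
  case (add a b)
  then show ?case using M_bounded[OF N_M[OF D_N]] by (auto simp: adj_add intro: deriv_domain.add)
next
  case (scale a c)
  then show ?case using M_bounded[OF N_M[OF D_N]] by (auto simp: adj_scaleC intro: deriv_domain.scale)
next
  case (mult a b)
  then show ?case using M_bounded[OF N_M[OF D_N]] by (auto simp: adj_compose intro: deriv_domain.mult)
qed

text \<open>The pairing of \<open>\<delta>(x)\<close> with a vector \<open>\<Lambda> b\<close>, \<open>b \<in> \<D>\<close>, is rewritten by the Leibniz rule for \<open>b\<^sup>* x\<close>
  and the invariance of the trace as a pairing that only involves \<open>x\<close>. So a limit of \<open>\<delta>(x\<^sub>n)\<close> along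
  \<open>x\<^sub>n \<rightarrow> 0\<close> is orthogonal to a dense set.\<close>

lemma closable_derivation: "closable (L2_graph \<Lambda> D \<delta>)"
  unfolding closable_def
proof (intro allI impI)
  let ?G = "L2_graph \<Lambda> D \<delta>"
  fix y assume "(0, y) \<in> closure ?G"
  then obtain g where g: "\<And>n. g n \<in> ?G" and "g \<longlonglongrightarrow> (0, y)" by (auto simp: closure_sequential)
  then have "\<exists>a. a \<in> D \<and> g n = (\<Lambda> a, \<Lambda> (\<delta> a))" for n by (auto simp: L2_graph_def)
  then obtain x where x: "\<And>n. x n \<in> D" and gx: "\<And>n. g n = (\<Lambda> (x n), \<Lambda> (\<delta> (x n)))" by metis
  from tendsto_fst[OF \<open>g \<longlonglongrightarrow> (0, y)\<close>] tendsto_snd[OF \<open>g \<longlonglongrightarrow> (0, y)\<close>]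
  have lim: "(\<lambda>n. \<Lambda> (x n)) \<longlonglongrightarrow> 0" "(\<lambda>n. \<Lambda> (\<delta> (x n))) \<longlonglongrightarrow> y"
    by (simp_all add: gx)
  have NM: "a \<in> M" if "a \<in> D" for a using that by (intro N_M D_N)
  have orth: "cinner y (\<Lambda> b) = 0" if b: "b \<in> D" for b
  proof -
    define z where "z = adj b"
    have z: "z \<in> D" unfolding z_def by (rule D_adj[OF b])
    have zb: "cinner \<xi> (\<Lambda> b) = cinner (blinfun_apply z \<xi>) \<Omega>" for \<xi>
      using b by (simp add: z_def \<Lambda>_N D_N cinner_adj_left M_bounded NM)
    have eq: "cinner (\<Lambda> (\<delta> (x n))) (\<Lambda> b)
        = cinner (blinfun_apply z (\<Lambda> (x n))) \<Omega> - cinner (blinfun_apply (\<delta> z) (\<Lambda> (x n))) \<Omega>" for n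
    proof -
      have zx: "z o\<^sub>L x n \<in> D" by (intro deriv_domain.mult z x)
      have "\<delta> (z o\<^sub>L x n) = (\<delta> z o\<^sub>L x n) + (z o\<^sub>L \<delta> (x n))"
        using derivation z x by (simp add: is_derivation_def)
      then have "\<Lambda> (\<delta> (z o\<^sub>L x n)) = blinfun_apply (\<delta> z) (\<Lambda> (x n)) + blinfun_apply z (\<Lambda> (\<delta> (x n)))"
        using D_derivative(3)[OF zx] D_derivative(3)[OF x] by (simp add: \<Lambda>_N D_N x blinfun.add_left)
      moreover have "cinner (\<Lambda> (\<delta> (z o\<^sub>L x n))) \<Omega> = cinner (blinfun_apply z (\<Lambda> (x n))) \<Omega>"
        using trace_derivative[OF zx] by (simp add: \<Lambda>_N D_N zx x)
      ultimately show ?thesis by (simp add: zb cinner_add_left eq_diff_eq add.commute)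
    qed
    have "(\<lambda>n. cinner (\<Lambda> (\<delta> (x n))) (\<Lambda> b)) \<longlonglongrightarrow> cinner (blinfun_apply z 0) \<Omega> - cinner (blinfun_apply (\<delta> z) 0) \<Omega>"
      unfolding eq by (intro tendsto_diff tendsto_cinner_left blinfun.tendsto tendsto_const lim)
    moreover have "(\<lambda>n. cinner (\<Lambda> (\<delta> (x n))) (\<Lambda> b)) \<longlonglongrightarrow> cinner y (\<Lambda> b)"
      by (rule tendsto_cinner_left[OF lim(2)])
    ultimately show ?thesis using LIMSEQ_unique by fastforce
  qed
  have "y \<in> closure (\<Lambda> ` N)"
    unfolding closure_sequential using lim(2) D_derivative(3)[OF x]
    by (intro exI[of _ "\<lambda>n. \<Lambda> (\<delta> (x n))"]) blast
  then have "y \<in> closure (\<Lambda> ` D)" by (simp add: closure_D)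
  then obtain v where v: "\<And>n. v n \<in> \<Lambda> ` D" "v \<longlonglongrightarrow> y" by (auto simp: closure_sequential)
  have "cinner (v n) y = 0" for n
    using v(1)[of n] orth by (metis cinner_commute complex_cnj_zero imageE)
  then have "(\<lambda>n. 0) \<longlonglongrightarrow> cinner y y" using tendsto_cinner_left[OF v(2), of y] by simp
  then have "cinner y y = 0" using LIMSEQ_unique tendsto_const by blast
  then show "y = 0" by (simp add: cinner_self_eq_0)
qed

lemma adjoint_derivation_unit:
  "(\<Omega>, 1 *\<^sub>R \<Omega>) \<in> adjoint_graph (closure (\<Lambda> ` N)) (L2_graph \<Lambda> D \<delta>)"
proof -
  have "cut 1 \<in> N" by (simp add: corner_iff chi_M chi_compose)
  then have "\<Omega> \<in> closure (\<Lambda> ` N)" by (intro subsetD[OF closure_subset] imageI)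
  then show ?thesis using trace_derivative by (auto simp: adjoint_graph_def L2_graph_def)
qed

lemma flat_algebra_Linf01: "flat_algebra \<subseteq> Linf01"
  using C10_Linf C10_supported flat_algebra_C10 by (auto simp: Linf01_def)

lemma flat_algebra_weak_star_dense: "weak_star_dense01 flat_algebra"
  unfolding weak_star_dense01_def
proof (intro conjI ballI allI impI)
  show "flat_algebra \<subseteq> Linf01" by (rule flat_algebra_Linf01)
  fix f G and e :: real
  assume f: "f \<in> Linf01" and G: "finite G" "0 < e"
    and int: "\<forall>g\<in>G. integrable (lebesgue_on {0..1}) (g :: real \<Rightarrow> complex)"
  from f have "f \<in> Linf" "supported_upto 1 f" by (simp_all add: Linf01_def)
  then obtain C h where h: "\<And>n. h n \<in> flat_algebra" and C: "\<And>n x. 0 \<le> x \<Longrightarrow> cmod (h n x) \<le> C"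
    and lim: "AE x in half_line. (\<lambda>n. h n x) \<longlonglongrightarrow> f x"
    by (rule flat_algebra_approximation) blast
  obtain B where B: "AE x in half_line. cmod (f x) \<le> B" using f by (auto simp: Linf01_def Linf_def)
  have AE01: "AE x in lebesgue_on {0..1}. P x" if "AE x in half_line. P x" for P
    using that unfolding AE_half_line by (subst AE_restrict_space_iff) auto
  have meas: "k \<in> borel_measurable (lebesgue_on {0..1})" if "k \<in> Linf01" for k
    by (rule measurable_restrict_mono[of k lebesgue "{0..}"]) (use that in \<open>auto simp: Linf01_def Linf_def\<close>)
  have "\<forall>\<^sub>F n in sequentially. \<forall>g\<in>G. cmod (LINT x|lebesgue_on {0..1}. (f x - h n x) * g x) < e"
  proof (intro eventually_ball_finite[OF G(1)] ballI)
    fix g assume "g \<in> G"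
    then have g: "integrable (lebesgue_on {0..1}) g" using int by blast
    have "(\<lambda>n. LINT x|lebesgue_on {0..1}. (f x - h n x) * g x) \<longlonglongrightarrow> (LINT x|lebesgue_on {0..1::real}. 0)"
    proof (rule integral_dominated_convergence[where w = "\<lambda>x. (B + C) * cmod (g x)"])
      have "(\<lambda>x. f x - h n x) \<in> borel_measurable (lebesgue_on {0..1})" for n
        using meas[OF f] meas[of "h n"] h flat_algebra_Linf01 by (intro borel_measurable_diff) auto
      then show "(\<lambda>x. (f x - h n x) * g x) \<in> borel_measurable (lebesgue_on {0..1})" for n
        using g by (intro borel_measurable_times) auto
      show "integrable (lebesgue_on {0..1}) (\<lambda>x. (B + C) * cmod (g x))"
        using g by (intro integrable_mult_right integrable_norm)
      show "AE x in lebesgue_on {0..1}. (\<lambda>n. (f x - h n x) * g x) \<longlonglongrightarrow> 0"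
        using AE01[OF lim]
      proof eventually_elim
        case (elim x)
        then have "(\<lambda>n. (f x - h n x) * g x) \<longlonglongrightarrow> (f x - f x) * g x" by (intro tendsto_intros)
        then show ?case by simp
      qed
      show "AE x in lebesgue_on {0..1}. cmod ((f x - h n x) * g x) \<le> (B + C) * cmod (g x)" for n
        using AE01[OF B] AE_space[of "lebesgue_on {0..1}"]
      proof eventually_elim
        case (elim x)
        then have "cmod (f x - h n x) \<le> B + C"
          using C[of x n] by (intro order_trans[OF norm_triangle_ineq4] add_mono) auto
        then show ?case by (simp add: norm_mult mult_right_mono)
      qed
    qed simp
    then have "(\<lambda>n. LINT x|lebesgue_on {0..1}. (f x - h n x) * g x) \<longlonglongrightarrow> 0" by simp
    from tendstoD[OF this G(2)]
    show "\<forall>\<^sub>F n in sequentially. cmod (LINT x|lebesgue_on {0..1}. (f x - h n x) * g x) < e" by simp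
  qed
  then obtain n where "\<forall>g\<in>G. cmod (LINT x|lebesgue_on {0..1}. (f x - h n x) * g x) < e"
    by (auto simp: eventually_sequentially)
  then show "\<exists>h\<in>flat_algebra. \<forall>g\<in>G. cmod (LINT x|lebesgue_on {0..1}. (f x - h x) * g x) < e"
    using h by blast
qed

lemma flat_algebra_subalgebra: "is_subalgebra (\<iota> ` flat_algebra)"
proof -
  have L: "f \<in> Linf" if "f \<in> flat_algebra" for f using that flat_algebra_Linf01 by (auto simp: Linf01_def)
  have scale: "c *\<^sub>C \<iota> f \<in> \<iota> ` flat_algebra" if "f \<in> flat_algebra" for c f
    using flat_algebra.scale[OF that, of c] embed_scaleC[OF L[OF that], of c] by (metis imageI)
  moreover have "\<iota> f + \<iota> g \<in> \<iota> ` flat_algebra" if "f \<in> flat_algebra" "g \<in> flat_algebra" for f g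
    using flat_algebra.add[OF that] embed_add[OF L[OF that(1)] L[OF that(2)]] by (metis imageI)
  moreover have "\<iota> f o\<^sub>L \<iota> g \<in> \<iota> ` flat_algebra" if "f \<in> flat_algebra" "g \<in> flat_algebra" for f g
    using flat_algebra.mult[OF that] embed_mult[OF L[OF that(1)] L[OF that(2)]] by (metis imageI)
  moreover have "0 \<in> \<iota> ` flat_algebra" using scale[OF flat_algebra.bump, of 0] by simp
  ultimately show ?thesis by (auto simp: is_subalgebra_def)
qed

lemma flat_algebra_invariant: "\<delta> ` \<iota> ` flat_algebra \<subseteq> \<iota> ` flat_algebra"
proof (intro subsetI, elim imageE)
  fix y x f assume y: "y = \<delta> x" "x = \<iota> f" and f: "f \<in> flat_algebra"
  obtain g where g: "g \<in> flat_algebra" "dilation_derivative f g"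
    using flat_algebra_dilation_derivative[OF f] by blast
  have fL: "f \<in> Linf" using f flat_algebra_Linf01 by (auto simp: Linf01_def)
  have "\<delta> (\<iota> f) = \<iota> g"
  proof (rule strong_derivative_dilation(2))
    show "\<iota> f \<in> N" by (intro D_N deriv_domain.embed flat_algebra_C10 f)
    show "strong_derivative (\<lambda>t. \<alpha> t (\<iota> f)) (\<iota> g)"
    proof (rule strong_derivative_cong[OF iota_strong_derivative[OF g(2)]])
      show "\<forall>\<^sub>F t in at 1. \<iota> (dilate t f) = \<alpha> t (\<iota> f)"
        using eventually_at_1_near by eventually_elim (simp add: \<alpha>_iota fL)
    qed (simp add: \<alpha>_iota fL)
  qed
  then show "y \<in> \<iota> ` flat_algebra" using g y by blast
qed

end

theorem proposition20:
  fixes \<iota> :: "(real \<Rightarrow> complex) \<Rightarrow> 'h::complex_hilbert_space \<Rightarrow>\<^sub>L 'h"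
    and X :: "real \<Rightarrow> 'h \<Rightarrow>\<^sub>L 'h"
    and Tr :: "('h \<Rightarrow>\<^sub>L 'h) \<Rightarrow> ennreal"
    and \<Lambda> :: "('h \<Rightarrow>\<^sub>L 'h) \<Rightarrow> 'h"
    and \<alpha> :: "real \<Rightarrow> ('h \<Rightarrow>\<^sub>L 'h) \<Rightarrow> ('h \<Rightarrow>\<^sub>L 'h)"
    and D N :: "('h \<Rightarrow>\<^sub>L 'h) set"
    and \<delta> :: "('h \<Rightarrow>\<^sub>L 'h) \<Rightarrow> ('h \<Rightarrow>\<^sub>L 'h)"
  assumes "infinite_semicircular \<iota> X Tr"
    and "standard_representation (sc_algebra \<iota> X) Tr \<Lambda>"
    and "dilation_action \<iota> X \<alpha>"
    and "N = corner \<iota> X"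
    and "D = deriv_domain \<iota> X"
    and "\<delta> = dilation_deriv \<iota> X \<Lambda> \<alpha>"
  shows "(\<forall>a\<in>D. has_dilation_derivative \<iota> \<Lambda> \<alpha> a (\<delta> a)) \<and>
    is_derivation D N \<delta> \<and>
    closable (L2_graph \<Lambda> D \<delta>) \<and>
    closure (\<Lambda> ` D) = closure (\<Lambda> ` N) \<and>
    (\<exists>c::real. c > 0 \<and>
       (\<Lambda> (chi \<iota> 1), c *\<^sub>R \<Lambda> (chi \<iota> 1)) \<in> adjoint_graph (closure (\<Lambda> ` N)) (L2_graph \<Lambda> D \<delta>)) \<and>
    (\<exists>A. weak_star_dense01 A \<and> \<iota> ` A \<subseteq> D \<and> is_subalgebra (\<iota> ` A) \<and> \<delta> ` \<iota> ` A \<subseteq> \<iota> ` A)"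
proof -
  interpret dilated_semicircular \<iota> X Tr \<Lambda> \<alpha>
    using assms(1-3) by (simp add: dilated_semicircular_def dilated_semicircular_axioms_def)
  have "\<iota> ` flat_algebra \<subseteq> deriv_domain \<iota> X"
    by (auto intro: deriv_domain.embed flat_algebra_C10)
  then show ?thesis
    unfolding assms(4-6)
    using D_derivative(4) derivation closable_derivation closure_D adjoint_derivation_unit
      flat_algebra_weak_star_dense flat_algebra_subalgebra flat_algebra_invariant zero_less_one
    by blast
qed

end
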